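(* Let $\mathcal{M}$ be a model category. Suppose that either $\mathcal{M}$ is cofibrantly generated, or $\mathcal{M}$ is fibrantly generated and all acyclic fibrations of $\mathcal{M}$ are epimorphisms. Then $\mathcal{M}$ has a cofibrant-replacement cotriple.
   Context: A cotriple is a comonad. A cofibrant-replacement cotriple on a model category $\mathcal{M}$ is a cotriple $(S,\epsilon,\Delta)$ on $\mathcal{M}$, with $\epsilon_X: SX\to X$ and $\Delta_X: SX\to S^2X$, such that for every object $X$ the map $\epsilon_X$ is a weak equivalence and $SX$ is cofibrant ($\epsilon_X$ is not required to be a fibration). $\mathcal{M}$ is cofibrantly generated if there are sets $I$ of cofibrations and $J$ of acyclic cofibrations such that the cofibrations are exactly the retracts of relative $I$-cell complexes (transfinite compositions of pushouts of elements of $I$), the acyclic cofibrations are exactly the retracts of relative $J$-cell complexes, and for some regular ordinal $\lambda$ the domains of the elements of $I$ (resp. $J$) are $\lambda$-small relative to the subcategory of cofibrations (resp. acyclic cofibrations). $\mathcal{M}$ is fibrantly generated if the opposite model category $\mathcal{M}^{op}$ is cofibrantly generated. *)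

theory Defs
  imports Main
begin

unbundle cardinal_syntax

text \<open>
  Categories live on carrier sets and may be large. As usual, "small" refers to a fixed
  Grothendieck universe, given here by an inaccessible cardinal \<open>\<kappa>\<close>: a set is small iff its
  cardinality is below \<open>\<kappa>\<close>. Since every small set injects into the type \<open>'u\<close> underlying \<open>\<kappa>\<close>,
  small index categories and small ordinals may be taken to live on subsets of \<open>'u\<close>.
\<close>

definition inaccessible :: "'u rel \<Rightarrow> bool" where
  "inaccessible \<kappa> \<longleftrightarrow> Card_order \<kappa> \<and> natLeq <o \<kappa> \<and> regularCard \<kappa> \<and>
     (\<forall>A :: 'u set. |A| <o \<kappa> \<longrightarrow> |Pow A| <o \<kappa>)"

definition small :: "'u rel \<Rightarrow> 'a set \<Rightarrow> bool" where
  "small \<kappa> A \<longleftrightarrow> |A| <o \<kappa>"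

record ('o, 'm) cat =
  Obj :: "'o set"
  Arr :: "'m set"
  Dom :: "'m \<Rightarrow> 'o"
  Cod :: "'m \<Rightarrow> 'o"
  Idt :: "'o \<Rightarrow> 'm"
  Cmp :: "'m \<Rightarrow> 'm \<Rightarrow> 'm"  (infixr "\<cdot>\<index>" 70)

definition Hom :: "('o, 'm, 'z) cat_scheme \<Rightarrow> 'o \<Rightarrow> 'o \<Rightarrow> 'm set" where
  "Hom C x y = {f \<in> Arr C. Dom C f = x \<and> Cod C f = y}"

locale category =
  fixes C :: "('o, 'm, 'z) cat_scheme" (structure)
  assumes Dom_in: "f \<in> Arr C \<Longrightarrow> Dom C f \<in> Obj C"
    and Cod_in: "f \<in> Arr C \<Longrightarrow> Cod C f \<in> Obj C"
    and Idt_in: "x \<in> Obj C \<Longrightarrow> Idt C x \<in> Hom C x x"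
    and Cmp_in: "f \<in> Hom C x y \<Longrightarrow> g \<in> Hom C y z \<Longrightarrow> g \<cdot> f \<in> Hom C x z"
    and Idt_left: "f \<in> Hom C x y \<Longrightarrow> Idt C y \<cdot> f = f"
    and Idt_right: "f \<in> Hom C x y \<Longrightarrow> f \<cdot> Idt C x = f"
    and assoc: "f \<in> Hom C w x \<Longrightarrow> g \<in> Hom C x y \<Longrightarrow> h \<in> Hom C y z \<Longrightarrow>
      (h \<cdot> g) \<cdot> f = h \<cdot> (g \<cdot> f)"

definition op_cat :: "('o, 'm, 'z) cat_scheme \<Rightarrow> ('o, 'm) cat" where
  "op_cat C = \<lparr>Obj = Obj C, Arr = Arr C, Dom = Cod C, Cod = Dom C, Idt = Idt C,
     Cmp = (\<lambda>g f. f \<cdot>\<^bsub>C\<^esub> g)\<rparr>"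

record ('o1, 'm1, 'o2, 'm2) functor_data =
  on_obj :: "'o1 \<Rightarrow> 'o2"
  on_arr :: "'m1 \<Rightarrow> 'm2"

definition id_functor :: "('o, 'm, 'o, 'm) functor_data" where
  "id_functor = \<lparr>on_obj = (\<lambda>x. x), on_arr = (\<lambda>f. f)\<rparr>"

definition comp_functor ::
  "('o2, 'm2, 'o3, 'm3) functor_data \<Rightarrow> ('o1, 'm1, 'o2, 'm2) functor_data \<Rightarrow>
    ('o1, 'm1, 'o3, 'm3) functor_data" where
  "comp_functor G F =
     \<lparr>on_obj = (\<lambda>x. on_obj G (on_obj F x)), on_arr = (\<lambda>f. on_arr G (on_arr F f))\<rparr>"

locale cat_functor = A: category A + B: category B
  for A :: "('o1, 'm1, 'z1) cat_scheme"
    and B :: "('o2, 'm2, 'z2) cat_scheme" +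
  fixes F :: "('o1, 'm1, 'o2, 'm2) functor_data"
  assumes obj_in: "x \<in> Obj A \<Longrightarrow> on_obj F x \<in> Obj B"
    and arr_in: "f \<in> Hom A x y \<Longrightarrow> on_arr F f \<in> Hom B (on_obj F x) (on_obj F y)"
    and map_Idt: "x \<in> Obj A \<Longrightarrow> on_arr F (Idt A x) = Idt B (on_obj F x)"
    and map_Cmp: "f \<in> Hom A x y \<Longrightarrow> g \<in> Hom A y z \<Longrightarrow>
      on_arr F (g \<cdot>\<^bsub>A\<^esub> f) = on_arr F g \<cdot>\<^bsub>B\<^esub> on_arr F f"

locale nat_trans = F: cat_functor A B F + G: cat_functor A B G
  for A :: "('o1, 'm1, 'z1) cat_scheme"
    and B :: "('o2, 'm2, 'z2) cat_scheme"
    and F G :: "('o1, 'm1, 'o2, 'm2) functor_data" +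
  fixes \<tau> :: "'o1 \<Rightarrow> 'm2"
  assumes component_in: "x \<in> Obj A \<Longrightarrow> \<tau> x \<in> Hom B (on_obj F x) (on_obj G x)"
    and naturality: "f \<in> Hom A x y \<Longrightarrow>
      \<tau> y \<cdot>\<^bsub>B\<^esub> on_arr F f = on_arr G f \<cdot>\<^bsub>B\<^esub> \<tau> x"

locale cotriple =
  counit: nat_trans C C S id_functor \<epsilon> +
  comult: nat_trans C C S "comp_functor S S" \<Delta>
  for C :: "('o, 'm, 'z) cat_scheme"
    and S :: "('o, 'm, 'o, 'm) functor_data"
    and \<epsilon> \<Delta> :: "'o \<Rightarrow> 'm" +
  assumes counit_left: "x \<in> Obj C \<Longrightarrow>
      \<epsilon> (on_obj S x) \<cdot>\<^bsub>C\<^esub> \<Delta> x = Idt C (on_obj S x)"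
    and counit_right: "x \<in> Obj C \<Longrightarrow>
      on_arr S (\<epsilon> x) \<cdot>\<^bsub>C\<^esub> \<Delta> x = Idt C (on_obj S x)"
    and coassoc: "x \<in> Obj C \<Longrightarrow>
      \<Delta> (on_obj S x) \<cdot>\<^bsub>C\<^esub> \<Delta> x = on_arr S (\<Delta> x) \<cdot>\<^bsub>C\<^esub> \<Delta> x"

definition epi :: "('o, 'm, 'z) cat_scheme \<Rightarrow> 'm \<Rightarrow> bool" where
  "epi C f \<longleftrightarrow> f \<in> Arr C \<and>
     (\<forall>z. \<forall>g \<in> Hom C (Cod C f) z. \<forall>h \<in> Hom C (Cod C f) z.
        g \<cdot>\<^bsub>C\<^esub> f = h \<cdot>\<^bsub>C\<^esub> f \<longrightarrow> g = h)"

definition is_cocone ::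
  "('i, 'j, 'y) cat_scheme \<Rightarrow> ('o, 'm, 'z) cat_scheme \<Rightarrow> ('i, 'j, 'o, 'm) functor_data \<Rightarrow>
    'o \<Rightarrow> ('i \<Rightarrow> 'm) \<Rightarrow> bool" where
  "is_cocone J C F y t \<longleftrightarrow> y \<in> Obj C \<and>
     (\<forall>j \<in> Obj J. t j \<in> Hom C (on_obj F j) y) \<and>
     (\<forall>u \<in> Arr J. t (Cod J u) \<cdot>\<^bsub>C\<^esub> on_arr F u = t (Dom J u))"

definition is_colimit ::
  "('i, 'j, 'y) cat_scheme \<Rightarrow> ('o, 'm, 'z) cat_scheme \<Rightarrow> ('i, 'j, 'o, 'm) functor_data \<Rightarrow>
    'o \<Rightarrow> ('i \<Rightarrow> 'm) \<Rightarrow> bool" where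
  "is_colimit J C F y t \<longleftrightarrow> is_cocone J C F y t \<and>
     (\<forall>z s. is_cocone J C F z s \<longrightarrow>
        (\<exists>!h. h \<in> Hom C y z \<and> (\<forall>j \<in> Obj J. h \<cdot>\<^bsub>C\<^esub> t j = s j)))"

definition cocomplete :: "'u rel \<Rightarrow> ('o, 'm, 'z) cat_scheme \<Rightarrow> bool" where
  "cocomplete \<kappa> C \<longleftrightarrow>
     (\<forall>(J :: ('u, 'u) cat) F. cat_functor J C F \<and> small \<kappa> (Obj J) \<and> small \<kappa> (Arr J) \<longrightarrow>
        (\<exists>y t. is_colimit J C F y t))"

definition complete :: "'u rel \<Rightarrow> ('o, 'm, 'z) cat_scheme \<Rightarrow> bool" where
  "complete \<kappa> C \<longleftrightarrow> cocomplete \<kappa> (op_cat C)"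

definition initial :: "('o, 'm, 'z) cat_scheme \<Rightarrow> 'o \<Rightarrow> bool" where
  "initial C x \<longleftrightarrow> x \<in> Obj C \<and> (\<forall>y \<in> Obj C. \<exists>!f. f \<in> Hom C x y)"

text \<open>\<open>is_pushout C i u f v\<close>: in the square \<open>f u = v i\<close>, the arrow \<open>f\<close> is the pushout of \<open>i\<close>
  along \<open>u\<close>.\<close>

definition is_pushout :: "('o, 'm, 'z) cat_scheme \<Rightarrow> 'm \<Rightarrow> 'm \<Rightarrow> 'm \<Rightarrow> 'm \<Rightarrow> bool" where
  "is_pushout C i u f v \<longleftrightarrow>
     (\<exists>a b x y. i \<in> Hom C a b \<and> u \<in> Hom C a x \<and> f \<in> Hom C x y \<and> v \<in> Hom C b y \<and>
        f \<cdot>\<^bsub>C\<^esub> u = v \<cdot>\<^bsub>C\<^esub> i \<and>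
        (\<forall>z. \<forall>p \<in> Hom C x z. \<forall>q \<in> Hom C b z. p \<cdot>\<^bsub>C\<^esub> u = q \<cdot>\<^bsub>C\<^esub> i \<longrightarrow>
           (\<exists>!h. h \<in> Hom C y z \<and> h \<cdot>\<^bsub>C\<^esub> f = p \<and> h \<cdot>\<^bsub>C\<^esub> v = q)))"

definition is_retract :: "('o, 'm, 'z) cat_scheme \<Rightarrow> 'm \<Rightarrow> 'm \<Rightarrow> bool" where
  "is_retract C f g \<longleftrightarrow> f \<in> Arr C \<and> g \<in> Arr C \<and>
     (\<exists>i \<in> Hom C (Dom C f) (Dom C g). \<exists>r \<in> Hom C (Dom C g) (Dom C f).
      \<exists>i' \<in> Hom C (Cod C f) (Cod C g). \<exists>r' \<in> Hom C (Cod C g) (Cod C f).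
        r \<cdot>\<^bsub>C\<^esub> i = Idt C (Dom C f) \<and> r' \<cdot>\<^bsub>C\<^esub> i' = Idt C (Cod C f) \<and>
        g \<cdot>\<^bsub>C\<^esub> i = i' \<cdot>\<^bsub>C\<^esub> f \<and> f \<cdot>\<^bsub>C\<^esub> r = r' \<cdot>\<^bsub>C\<^esub> g)"

definition retracts :: "('o, 'm, 'z) cat_scheme \<Rightarrow> 'm set \<Rightarrow> 'm set" where
  "retracts C D = {f. \<exists>g \<in> D. is_retract C f g}"

text \<open>An ordinal is represented by a well-order \<open>r\<close>, with \<open>Field r\<close> as its set of elements;
  it is regarded as a category whose arrows are the pairs in \<open>r\<close>.\<close>

definition ord_cat :: "'u rel \<Rightarrow> ('u, 'u \<times> 'u) cat" where
  "ord_cat r = \<lparr>Obj = Field r, Arr = r, Dom = fst, Cod = snd, Idt = (\<lambda>b. (b, b)),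
     Cmp = (\<lambda>g f. (fst f, snd g))\<rparr>"

definition is_successor_of :: "'u rel \<Rightarrow> 'u \<Rightarrow> 'u \<Rightarrow> bool" where
  "is_successor_of r c b \<longleftrightarrow> c \<in> Field r \<and> b \<in> Field r \<and> underS r c = under r b"

definition is_limit_elem :: "'u rel \<Rightarrow> 'u \<Rightarrow> bool" where
  "is_limit_elem r c \<longleftrightarrow> c \<in> Field r \<and> underS r c \<noteq> {} \<and> \<not> (\<exists>b. is_successor_of r c b)"

text \<open>A sequence in \<open>D\<close> indexed by the ordinal \<open>r\<close>, continuous at all limit elements; only the
  successor steps are required to lie in \<open>D\<close>.\<close>

definition is_sequence ::
  "('o, 'm, 'z) cat_scheme \<Rightarrow> 'm set \<Rightarrow> 'u rel \<Rightarrow> ('u, 'u \<times> 'u, 'o, 'm) functor_data \<Rightarrow> bool"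
  where
  "is_sequence C D r X \<longleftrightarrow> Well_order r \<and> Field r \<noteq> {} \<and> cat_functor (ord_cat r) C X \<and>
     (\<forall>b c. is_successor_of r c b \<longrightarrow> on_arr X (b, c) \<in> D) \<and>
     (\<forall>c. is_limit_elem r c \<longrightarrow>
        is_colimit (ord_cat (Restr r (underS r c))) C X (on_obj X c) (\<lambda>b. on_arr X (b, c)))"

definition transfinite_compositions ::
  "'u rel \<Rightarrow> ('o, 'm, 'z) cat_scheme \<Rightarrow> 'm set \<Rightarrow> 'm set" where
  "transfinite_compositions \<kappa> C D =
     {t b | (r :: 'u rel) X y t b. small \<kappa> (Field r) \<and> is_sequence C D r X \<and>
        is_colimit (ord_cat r) C X y t \<and> b \<in> Field r \<and> underS r b = {}}"

definition relative_cell_complexes ::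
  "'u rel \<Rightarrow> ('o, 'm, 'z) cat_scheme \<Rightarrow> 'm set \<Rightarrow> 'm set" where
  "relative_cell_complexes \<kappa> C I =
     transfinite_compositions \<kappa> C {f. \<exists>i \<in> I. \<exists>u v. is_pushout C i u f v}"

definition regular_ordinal :: "'u rel \<Rightarrow> bool" where
  "regular_ordinal r \<longleftrightarrow> Card_order r \<and> infinite (Field r) \<and> regularCard r"

text \<open>\<open>a\<close> is \<open>l\<close>-small relative to \<open>D\<close>: for every small regular \<open>r \<ge> l\<close> and every \<open>r\<close>-sequence
  \<open>X\<close> in \<open>D\<close>, the canonical map \<open>colim\<^sub>b Hom(a, X\<^sub>b) \<rightarrow> Hom(a, colim\<^sub>b X\<^sub>b)\<close> is bijective. The two
  conjuncts are surjectivity and injectivity of this map; elements of the directed colimit on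
  the left are represented by arrows \<open>a \<rightarrow> X\<^sub>b\<close>, and two such arrows are identified iff they
  become equal in some later \<open>X\<^sub>d\<close>.\<close>

definition small_object_rel ::
  "'u rel \<Rightarrow> ('o, 'm, 'z) cat_scheme \<Rightarrow> 'u rel \<Rightarrow> 'm set \<Rightarrow> 'o \<Rightarrow> bool" where
  "small_object_rel \<kappa> C l D a \<longleftrightarrow> a \<in> Obj C \<and>
     (\<forall>(r :: 'u rel) X y t.
        regular_ordinal r \<and> small \<kappa> (Field r) \<and> l \<le>o r \<and> is_sequence C D r X \<and>
        is_colimit (ord_cat r) C X y t \<longrightarrow>
        (\<forall>g \<in> Hom C a y. \<exists>b \<in> Field r. \<exists>h \<in> Hom C a (on_obj X b). g = t b \<cdot>\<^bsub>C\<^esub> h) \<and>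
        (\<forall>b \<in> Field r. \<forall>c \<in> Field r.
           \<forall>h \<in> Hom C a (on_obj X b). \<forall>k \<in> Hom C a (on_obj X c).
             t b \<cdot>\<^bsub>C\<^esub> h = t c \<cdot>\<^bsub>C\<^esub> k \<longrightarrow>
             (\<exists>d. (b, d) \<in> r \<and> (c, d) \<in> r \<and>
                on_arr X (b, d) \<cdot>\<^bsub>C\<^esub> h = on_arr X (c, d) \<cdot>\<^bsub>C\<^esub> k)))"

record ('o, 'm) model_cat = "('o, 'm) cat" +
  weq :: "'m set"
  cof :: "'m set"
  fib :: "'m set"

abbreviation acyclic_cof :: "('o, 'm, 'z) model_cat_scheme \<Rightarrow> 'm set" where
  "acyclic_cof M \<equiv> cof M \<inter> weq M"

abbreviation acyclic_fib :: "('o, 'm, 'z) model_cat_scheme \<Rightarrow> 'm set" where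
  "acyclic_fib M \<equiv> fib M \<inter> weq M"

definition has_lifting :: "('o, 'm, 'z) cat_scheme \<Rightarrow> 'm \<Rightarrow> 'm \<Rightarrow> bool" where
  "has_lifting C i p \<longleftrightarrow>
     (\<forall>u \<in> Hom C (Dom C i) (Dom C p). \<forall>v \<in> Hom C (Cod C i) (Cod C p).
        p \<cdot>\<^bsub>C\<^esub> u = v \<cdot>\<^bsub>C\<^esub> i \<longrightarrow>
        (\<exists>h \<in> Hom C (Cod C i) (Dom C p). h \<cdot>\<^bsub>C\<^esub> i = u \<and> p \<cdot>\<^bsub>C\<^esub> h = v))"

text \<open>Factorizations are not assumed to be functorial. Closure of the three classes under
  composition and identities follows from the axioms.\<close>

locale model_category = category M
  for \<kappa> :: "'u rel" and M :: "('o, 'm, 'z) model_cat_scheme" (structure) +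
  assumes locally_small: "x \<in> Obj M \<Longrightarrow> y \<in> Obj M \<Longrightarrow> small \<kappa> (Hom M x y)"
    and has_colimits: "cocomplete \<kappa> M"
    and has_limits: "complete \<kappa> M"
    and weq_Arr: "weq M \<subseteq> Arr M"
    and cof_Arr: "cof M \<subseteq> Arr M"
    and fib_Arr: "fib M \<subseteq> Arr M"
    and two_of_three: "f \<in> Hom M x y \<Longrightarrow> g \<in> Hom M y z \<Longrightarrow>
        (f \<in> weq M \<and> g \<in> weq M \<longrightarrow> g \<cdot> f \<in> weq M) \<and>
        (f \<in> weq M \<and> g \<cdot> f \<in> weq M \<longrightarrow> g \<in> weq M) \<and>
        (g \<in> weq M \<and> g \<cdot> f \<in> weq M \<longrightarrow> f \<in> weq M)"
    and weq_retract: "g \<in> weq M \<Longrightarrow> is_retract M f g \<Longrightarrow> f \<in> weq M"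
    and cof_retract: "g \<in> cof M \<Longrightarrow> is_retract M f g \<Longrightarrow> f \<in> cof M"
    and fib_retract: "g \<in> fib M \<Longrightarrow> is_retract M f g \<Longrightarrow> f \<in> fib M"
    and lift_cof_acyclic_fib: "i \<in> cof M \<Longrightarrow> p \<in> acyclic_fib M \<Longrightarrow> has_lifting M i p"
    and lift_acyclic_cof_fib: "i \<in> acyclic_cof M \<Longrightarrow> p \<in> fib M \<Longrightarrow> has_lifting M i p"
    and factor_cof_acyclic_fib: "f \<in> Hom M x y \<Longrightarrow>
        \<exists>z. \<exists>i \<in> Hom M x z \<inter> cof M. \<exists>p \<in> Hom M z y \<inter> acyclic_fib M. f = p \<cdot> i"
    and factor_acyclic_cof_fib: "f \<in> Hom M x y \<Longrightarrow>
        \<exists>z. \<exists>i \<in> Hom M x z \<inter> acyclic_cof M. \<exists>p \<in> Hom M z y \<inter> fib M. f = p \<cdot> i"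

definition op_model :: "('o, 'm, 'z) model_cat_scheme \<Rightarrow> ('o, 'm) model_cat" where
  "op_model M = \<lparr>Obj = Obj M, Arr = Arr M, Dom = Cod M, Cod = Dom M, Idt = Idt M,
     Cmp = (\<lambda>g f. f \<cdot>\<^bsub>M\<^esub> g), weq = weq M, cof = fib M, fib = cof M\<rparr>"

definition cofibrantly_generated :: "'u rel \<Rightarrow> ('o, 'm, 'z) model_cat_scheme \<Rightarrow> bool" where
  "cofibrantly_generated \<kappa> M \<longleftrightarrow>
     (\<exists>I J. I \<subseteq> cof M \<and> small \<kappa> I \<and> J \<subseteq> acyclic_cof M \<and> small \<kappa> J \<and>
        cof M = retracts M (relative_cell_complexes \<kappa> M I) \<and>
        acyclic_cof M = retracts M (relative_cell_complexes \<kappa> M J) \<and>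
        (\<exists>l :: 'u rel. regular_ordinal l \<and> small \<kappa> (Field l) \<and>
           (\<forall>i \<in> I. small_object_rel \<kappa> M l (cof M) (Dom M i)) \<and>
           (\<forall>j \<in> J. small_object_rel \<kappa> M l (acyclic_cof M) (Dom M j))))"

definition fibrantly_generated :: "'u rel \<Rightarrow> ('o, 'm, 'z) model_cat_scheme \<Rightarrow> bool" where
  "fibrantly_generated \<kappa> M \<longleftrightarrow> cofibrantly_generated \<kappa> (op_model M)"

definition cofibrant :: "('o, 'm, 'z) model_cat_scheme \<Rightarrow> 'o \<Rightarrow> bool" where
  "cofibrant M x \<longleftrightarrow> (\<exists>e f. initial M e \<and> f \<in> Hom M e x \<and> f \<in> cof M)"

locale cofibrant_replacement_cotriple = cotriple M S \<epsilon> \<Delta>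
  for M :: "('o, 'm, 'z) model_cat_scheme"
    and S :: "('o, 'm, 'o, 'm) functor_data"
    and \<epsilon> \<Delta> :: "'o \<Rightarrow> 'm" +
  assumes counit_weq: "x \<in> Obj M \<Longrightarrow> \<epsilon> x \<in> weq M"
    and cofibrant_replacement: "x \<in> Obj M \<Longrightarrow> cofibrant M (on_obj S x)"

end

theory Submission
  imports Defs
begin

text \<open>
  In the cofibrantly generated case, \<open>SX\<close> is the outcome of Quillen's small object argument applied
  to \<open>\<emptyset> \<rightarrow> X\<close>. An arrow \<open>g: SX \<rightarrow> Y\<close> lifts to a map of chains \<open>SX \<rightarrow> SY\<close>, sending the cell attached along
  \<open>(i, u, v)\<close> to the cell attached along the image of \<open>u\<close> and the restriction of \<open>g\<close> to the first cell.
  Among chain maps compatible with cells in this sense, the lift is uniquely determined by its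
  composite with \<open>\<epsilon>\<close>, so all comonad laws follow from uniqueness.

  In the fibrantly generated case, work in the opposite category, where acyclic cofibrations are
  monomorphisms, and attach at each stage only those cells whose attaching arrow does not factor
  through an earlier stage. Each attaching arrow into \<open>SX\<close> then has a canonical filler, and \<open>SX\<close> becomes the free
  algebraically fibrant object on \<open>X\<close> (Nikolaus); free objects again give a monad by uniqueness.
\<close>

section \<open>Small sets and colimits of small graphs\<close>

text \<open>Functorial factorization yields \<open>S\<close> and the counit; the obstacle is a
  comultiplication that satisfies the laws strictly, because a lift obtained from a lifting property
  depends on a choice. Both halves let the cells of the chain name their own fillers. In the
  cofibrantly generated half a cell remembers its whole square, so its image in another chain is a
  definite cell at the same stage. In the other half an arrow has to be extended into the constant
  object \<open>S y\<close>; if one attaching arrow received cells again at all later stages, it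
  would have many fillers in \<open>S y\<close>, and filler-preserving maps would not be determined
  on all of them. Hence the flag \<open>new\<close>, and hence monomorphisms: two arrows into a
  stage that agree in the colimit already agree, so the first stage through which an arrow factors
  carries exactly one factorization. Apart from the end points, the flag is the only difference
  between the two kinds of chain. So chains, their lifting properties and the recursion for maps out
  of them are treated once.\<close>

lemma inaccessible_Cinfinite: "inaccessible \<kappa> \<Longrightarrow> Cinfinite \<kappa>"
  unfolding inaccessible_def
  using cinfinite_mono[OF ordLess_imp_ordLeq natLeq_cinfinite] by blast

lemma small_mono: "small \<kappa> B \<Longrightarrow> A \<subseteq> B \<Longrightarrow> small \<kappa> A"
  unfolding small_def by (rule ordLeq_ordLess_trans[OF card_of_mono1])

lemma small_image: "small \<kappa> A \<Longrightarrow> small \<kappa> (f ` A)"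
  unfolding small_def by (rule ordLeq_ordLess_trans[OF card_of_image])

lemma small_UN:
  assumes "inaccessible \<kappa>" "small \<kappa> A" "\<And>a. a \<in> A \<Longrightarrow> small \<kappa> (B a)"
  shows "small \<kappa> (\<Union>a\<in>A. B a)"
  using assms(2,3) unfolding small_def
  by (intro card_of_UNION_ordLess_infinite_Field_regularCard inaccessible_Cinfinite assms(1))
     (use assms(1) in \<open>auto simp: inaccessible_def\<close>)

lemma small_Un:
  assumes "inaccessible \<kappa>" "small \<kappa> A" "small \<kappa> B"
  shows "small \<kappa> (A \<union> B)"
  using assms(2,3) unfolding small_def
  by (rule Un_Cinfinite_bound_strict[OF _ _ inaccessible_Cinfinite[OF assms(1)]])

lemma small_finite:
  assumes "inaccessible \<kappa>" "finite A"
  shows "small \<kappa> A"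
  unfolding small_def
proof (rule finite_ordLess_infinite)
  show "Well_order \<kappa>" "infinite (Field \<kappa>)"
    using inaccessible_Cinfinite[OF assms(1)] by (auto simp: cinfinite_def card_order_on_def)
qed (use assms(2) in \<open>auto simp: Field_card_of card_of_well_order_on\<close>)

lemma small_Sigma:
  assumes "inaccessible \<kappa>" "small \<kappa> A" "\<And>a. a \<in> A \<Longrightarrow> small \<kappa> (B a)"
  shows "small \<kappa> (Sigma A B)"
proof -
  have "Sigma A B = (\<Union>a\<in>A. Pair a ` B a)" by auto
  then show ?thesis by (simp add: small_UN[OF assms(1,2)] small_image assms(3))
qed

lemma small_Plus:
  assumes "inaccessible \<kappa>" "small \<kappa> A" "small \<kappa> B"
  shows "small \<kappa> (A <+> B)"
  unfolding Plus_def by (intro small_Un small_image assms)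

text \<open>\<open>cocomplete\<close> quantifies only over index categories on \<open>'u\<close>, so
  an index set of another type has to be transported. The embedding exists because a set below
  \<open>\<kappa>\<close> is no larger than the field of \<open>\<kappa>\<close>, which consists of
  elements of \<open>'u\<close>.\<close>

lemma small_inj:
  fixes \<kappa> :: "'u rel"
  assumes "inaccessible \<kappa>" "small \<kappa> A"
  obtains f :: "'a \<Rightarrow> 'u" where "inj_on f A"
proof -
  have "|A| \<le>o \<kappa>" using assms(2) ordLess_imp_ordLeq unfolding small_def by blast
  moreover have "\<kappa> \<le>o |UNIV :: 'u set|"
    using ordIso_ordLeq_trans[OF ordIso_symmetric[OF card_of_Field_ordIso] card_of_mono1[OF subset_UNIV]]
      assms(1) unfolding inaccessible_def by blast
  ultimately have "|A| \<le>o |UNIV :: 'u set|" using ordLeq_transitive by blast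
  then show thesis using that card_of_ordLeq[of A "UNIV :: 'u set"] by auto
qed

text \<open>The index category has the nodes and edges as objects, and two arrows from each edge to its ends,
  the one to the source being sent to an identity; so it has no nontrivial composites.\<close>

lemma graph_colimit:
  fixes \<kappa> :: "'u rel" and C :: "('o, 'm, 'z) cat_scheme"
    and N :: "'n set" and E :: "'e set"
  assumes inacc: "inaccessible \<kappa>" and cat: "category C" and cocomp: "cocomplete \<kappa> C"
    and N: "small \<kappa> N" and E: "small \<kappa> E"
    and G: "\<And>n. n \<in> N \<Longrightarrow> G n \<in> Obj C"
    and e: "\<And>e. e \<in> E \<Longrightarrow> s e \<in> N \<and> d e \<in> N \<and> m e \<in> Hom C (G (s e)) (G (d e))"
  obtains y g where "y \<in> Obj C" "\<And>n. n \<in> N \<Longrightarrow> g n \<in> Hom C (G n) y"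
    "\<And>e. e \<in> E \<Longrightarrow> g (d e) \<cdot>\<^bsub>C\<^esub> m e = g (s e)"
    "\<And>w g'. w \<in> Obj C \<Longrightarrow> (\<And>n. n \<in> N \<Longrightarrow> g' n \<in> Hom C (G n) w) \<Longrightarrow>
      (\<And>e. e \<in> E \<Longrightarrow> g' (d e) \<cdot>\<^bsub>C\<^esub> m e = g' (s e)) \<Longrightarrow>
      \<exists>!h. h \<in> Hom C y w \<and> (\<forall>n\<in>N. h \<cdot>\<^bsub>C\<^esub> g n = g' n)"
proof -
  interpret category C by (rule cat)
  \<comment> \<open>The left summand serves twice, as the objects and as their identity arrows. The
    right one holds the proper arrows: \<open>Inr (Inl e)\<close> from the edge \<open>e\<close> to
    its source, \<open>Inr (Inr e)\<close> to its target.\<close>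
  define Z where "Z = (N <+> E) <+> (E <+> E)"
  have "small \<kappa> Z" unfolding Z_def by (intro small_Plus inacc N E)
  then obtain \<iota> :: "_ \<Rightarrow> 'u" where \<iota>: "inj_on \<iota> Z" by (rule small_inj[OF inacc])
  define \<rho> where "\<rho> = inv_into Z \<iota>"
  have \<rho>[simp]: "\<rho> (\<iota> z) = z" if "z \<in> Z" for z using \<iota> that unfolding \<rho>_def by simp
  have Zs[simp]: "Inl (Inl n) \<in> Z \<longleftrightarrow> n \<in> N" "Inl (Inr e) \<in> Z \<longleftrightarrow> e \<in> E"
    "Inr (Inl e) \<in> Z \<longleftrightarrow> e \<in> E" "Inr (Inr e) \<in> Z \<longleftrightarrow> e \<in> E" for n e
    unfolding Z_def by auto
  define dm :: "('n + 'e) + ('e + 'e) \<Rightarrow> ('n + 'e) + ('e + 'e)" where "dm z = (case z of Inl z \<Rightarrow> Inl z | Inr (Inl e) \<Rightarrow> Inl (Inr e) | Inr (Inr e) \<Rightarrow> Inl (Inr e))"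
    for z :: "('n + 'e) + ('e + 'e)"
  define cd :: "('n + 'e) + ('e + 'e) \<Rightarrow> ('n + 'e) + ('e + 'e)" where "cd z = (case z of Inl z \<Rightarrow> Inl z | Inr (Inl e) \<Rightarrow> Inl (Inl (s e)) | Inr (Inr e) \<Rightarrow> Inl (Inl (d e)))"
    for z :: "('n + 'e) + ('e + 'e)"
  define ob where "ob z = (case z of Inl (Inl n) \<Rightarrow> G n | Inl (Inr e) \<Rightarrow> G (s e) | _ \<Rightarrow> undefined)"
    for z :: "('n + 'e) + ('e + 'e)"
  define ar where "ar z = (case z of Inl z \<Rightarrow> Idt C (ob (Inl z)) | Inr (Inl e) \<Rightarrow> Idt C (G (s e)) | Inr (Inr e) \<Rightarrow> m e)"
    for z :: "('n + 'e) + ('e + 'e)"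
  \<comment> \<open>\<open>Cmp\<close> returns the second factor unless that is an identity. This
    suffices: proper arrows lead from edges to nodes, so two of them never compose.\<close>
  define J :: "('u, 'u) cat" where "J = \<lparr>Obj = \<iota> ` (Z \<inter> range Inl), Arr = \<iota> ` Z,
    Dom = (\<lambda>a. \<iota> (dm (\<rho> a))), Cod = (\<lambda>a. \<iota> (cd (\<rho> a))), Idt = (\<lambda>a. a),
    Cmp = (\<lambda>g f. if \<exists>z. \<rho> g = Inl z then f else g)\<rparr>"
  define F where "F = \<lparr>on_obj = (\<lambda>a. ob (\<rho> a)), on_arr = (\<lambda>a. ar (\<rho> a))\<rparr>"
  have dmZ: "dm z \<in> Z" "cd z \<in> Z" if "z \<in> Z" for z
    using that e by (auto simp: dm_def cd_def split: sum.splits)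
  have dmI: "\<exists>w. dm z = Inl w" "\<exists>w. cd z = Inl w" for z
    by (auto simp: dm_def cd_def split: sum.splits)
  have \<iota>_eq: "\<iota> z = \<iota> w \<longleftrightarrow> z = w" if "z \<in> Z" "w \<in> Z" for z w
    using that \<iota> by (auto dest: inj_onD)
  have HomJ: "Hom J x y = {\<iota> z | z. z \<in> Z \<and> x = \<iota> (dm z) \<and> y = \<iota> (cd z)}" for x y
    by (auto simp: Hom_def J_def)
  have comp: "\<exists>w. b = Inl w \<and> w \<in> N <+> E \<or> a = cd a \<and> a = dm a \<and> (\<exists>w. a = Inl w)"
    if "a \<in> Z" "b \<in> Z" "cd a = dm b" for a b
    using that by (auto simp: dm_def cd_def split: sum.splits)
  have J: "category J"
  proof
    fix f assume "f \<in> Arr J"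
    then obtain z where z: "z \<in> Z" "f = \<iota> z" by (auto simp: J_def)
    then show "Dom J f \<in> Obj J" "Cod J f \<in> Obj J"
      using dmZ[of z] dmI[of z] by (auto simp: J_def)
  next
    fix x assume "x \<in> Obj J"
    then show "Idt J x \<in> Hom J x x" by (auto simp: J_def Hom_def dm_def cd_def)
  next
    fix f g x y z assume fg: "f \<in> Hom J x y" "g \<in> Hom J y z"
    then obtain a b where ab: "a \<in> Z" "b \<in> Z" "f = \<iota> a" "g = \<iota> b" "x = \<iota> (dm a)"
      "y = \<iota> (cd a)" "z = \<iota> (cd b)" "cd a = dm b"
      unfolding HomJ using \<iota>_eq dmZ by auto
    show "g \<cdot>\<^bsub>J\<^esub> f \<in> Hom J x z"
      using comp[OF ab(1,2,8)] ab unfolding HomJ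
      by (cases b) (auto simp: J_def dm_def cd_def split: sum.splits)
  next
    fix f x y assume fg: "f \<in> Hom J x y"
    then have "\<exists>w. \<rho> y = Inl w" unfolding HomJ using dmI(2) dmZ(2) by fastforce
    then show "Idt J y \<cdot>\<^bsub>J\<^esub> f = f" by (simp add: J_def)
    show "f \<cdot>\<^bsub>J\<^esub> Idt J x = f" using fg
      unfolding HomJ by (auto simp: J_def dm_def)
  next
    fix f g h w x y z assume "f \<in> Hom J w x" "g \<in> Hom J x y" "h \<in> Hom J y z"
    then show "(h \<cdot>\<^bsub>J\<^esub> g) \<cdot>\<^bsub>J\<^esub> f = h \<cdot>\<^bsub>J\<^esub> g \<cdot>\<^bsub>J\<^esub> f"
      by (auto simp: J_def)
  qed
  have obC: "ob z \<in> Obj C" if "z \<in> Z" "\<exists>w. z = Inl w" for z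
    using that G e by (auto simp: ob_def split: sum.splits)
  have arC: "ar z \<in> Hom C (ob (dm z)) (ob (cd z))" if "z \<in> Z" for z
    using that obC[OF that] G e Idt_in
    by (cases z) (auto simp: ar_def dm_def cd_def ob_def split: sum.splits)
  have ar_comp: "ar (if \<exists>w. b = Inl w then a else b) = ar b \<cdot>\<^bsub>C\<^esub> ar a"
    if "a \<in> Z" "b \<in> Z" "cd a = dm b" for a b
  proof (cases "\<exists>w. b = Inl w")
    case True
    then have "ar b = Idt C (ob (cd a))" using that by (auto simp: ar_def dm_def)
    then show ?thesis using True arC[OF that(1)] Idt_left by simp
  next
    case False
    then have "a = dm b" "\<exists>w. a = Inl w" using comp[OF that] that by auto
    then have "ar a = Idt C (ob (dm b))" by (auto simp: ar_def)
    then show ?thesis using False arC[OF that(2)] Idt_right by simp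
  qed
  have F: "cat_functor J C F"
  proof (intro cat_functor.intro J cat cat_functor_axioms.intro)
    fix x assume "x \<in> Obj J"
    then show "on_obj F x \<in> Obj C" using obC by (auto simp: J_def F_def)
  next
    fix f x y assume "f \<in> Hom J x y"
    then show "on_arr F f \<in> Hom C (on_obj F x) (on_obj F y)"
      unfolding HomJ using arC dmZ by (auto simp: F_def)
  next
    fix x assume "x \<in> Obj J"
    then show "on_arr F (Idt J x) = Idt C (on_obj F x)" by (auto simp: J_def F_def ar_def)
  next
    fix f g x y z assume "f \<in> Hom J x y" "g \<in> Hom J y z"
    then obtain a b where ab: "a \<in> Z" "b \<in> Z" "f = \<iota> a" "g = \<iota> b" "cd a = dm b"
      unfolding HomJ using \<iota>_eq dmZ by auto
    then show "on_arr F (g \<cdot>\<^bsub>J\<^esub> f) = on_arr F g \<cdot>\<^bsub>C\<^esub> on_arr F f"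
      using ar_comp[OF ab(1,2,5)] by (auto simp: J_def F_def split: if_splits)
  qed
  \<comment> \<open>The arrow from an edge to its source is sent to an identity, which forces the
    component at the edge to equal that at the source. So a cocone is just a compatible family on
    nodes.\<close>
  have cocone: "is_cocone J C F w t \<longleftrightarrow> w \<in> Obj C \<and>
     (\<forall>n\<in>N. t (\<iota> (Inl (Inl n))) \<in> Hom C (G n) w) \<and>
     (\<forall>e\<in>E. t (\<iota> (Inl (Inr e))) = t (\<iota> (Inl (Inl (s e)))) \<and>
        t (\<iota> (Inl (Inl (d e)))) \<cdot>\<^bsub>C\<^esub> m e = t (\<iota> (Inl (Inl (s e)))))" (is "?L = ?R") for w t
  proof
    assume L: ?L
    have 1: "t (\<iota> z) \<in> Hom C (ob z) w" if "z \<in> Z" "\<exists>v. z = Inl v" for z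
      using L that unfolding is_cocone_def J_def F_def by auto
    have 2: "t (\<iota> (cd z)) \<cdot>\<^bsub>C\<^esub> ar z = t (\<iota> (dm z))" if "z \<in> Z" for z
      using L that unfolding is_cocone_def J_def F_def by auto
    have 3: "t (\<iota> (Inl (Inl n))) \<in> Hom C (G n) w" if "n \<in> N" for n
      using 1[of "Inl (Inl n)"] that by (auto simp: ob_def)
    have 4: "t (\<iota> (Inl (Inl (s e)))) = t (\<iota> (Inl (Inr e)))" if "e \<in> E" for e
      using 2[of "Inr (Inl e)"] 3[of "s e"] that e[OF that] Idt_right
      by (auto simp: ar_def dm_def cd_def)
    show ?R using L 3 4 2[of "Inr (Inr e)" for e]
      by (auto simp: is_cocone_def ar_def dm_def cd_def)
  next
    assume R: ?R
    have 1: "t (\<iota> z) \<in> Hom C (ob z) w" if "z \<in> Z" "\<exists>v. z = Inl v" for z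
      using R that e by (auto simp: ob_def split: sum.splits)
    have 2: "t (\<iota> (cd z)) \<cdot>\<^bsub>C\<^esub> ar z = t (\<iota> (dm z))" if "z \<in> Z" for z
    proof (cases z)
      case (Inl v)
      then show ?thesis using 1[of z] that Idt_right by (auto simp: ar_def dm_def cd_def)
    next
      case (Inr v)
      have "t (\<iota> (Inl (Inl n))) \<cdot>\<^bsub>C\<^esub> Idt C (G n) = t (\<iota> (Inl (Inl n)))" if "n \<in> N" for n
        using R that Idt_right by blast
      then show ?thesis using Inr R that e
        by (cases v) (auto simp: ar_def dm_def cd_def)
    qed
    show ?L unfolding is_cocone_def using R 1 2 by (auto simp: J_def F_def)
  qed
  have "small \<kappa> (Obj J)" "small \<kappa> (Arr J)"
    using \<open>small \<kappa> Z\<close> by (auto simp: J_def intro!: small_image intro: small_mono)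
  then obtain y t where yt: "is_colimit J C F y t"
    using cocomp F unfolding cocomplete_def by blast
  define g where "g n = t (\<iota> (Inl (Inl n)))" for n
  have c: "is_cocone J C F y t" using yt unfolding is_colimit_def by blast
  show thesis
  proof (rule that[of y g])
    show "y \<in> Obj C" "\<And>n. n \<in> N \<Longrightarrow> g n \<in> Hom C (G n) y"
      "\<And>e. e \<in> E \<Longrightarrow> g (d e) \<cdot>\<^bsub>C\<^esub> m e = g (s e)"
      using c unfolding cocone g_def by auto
  next
    fix w g' assume w: "w \<in> Obj C" "\<And>n. n \<in> N \<Longrightarrow> g' n \<in> Hom C (G n) w"
      "\<And>e. e \<in> E \<Longrightarrow> g' (d e) \<cdot>\<^bsub>C\<^esub> m e = g' (s e)"
    define t' where "t' a = (case \<rho> a of Inl (Inl n) \<Rightarrow> g' n | Inl (Inr e) \<Rightarrow> g' (s e) | _ \<Rightarrow> undefined)" for a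
    have "is_cocone J C F w t'" unfolding cocone t'_def using w e by auto
    then have "\<exists>!h. h \<in> Hom C y w \<and> (\<forall>j\<in>Obj J. h \<cdot>\<^bsub>C\<^esub> t j = t' j)"
      using yt unfolding is_colimit_def by blast
    moreover have "(\<forall>j\<in>Obj J. h \<cdot>\<^bsub>C\<^esub> t j = t' j) \<longleftrightarrow> (\<forall>n\<in>N. h \<cdot>\<^bsub>C\<^esub> g n = g' n)" for h
    proof -
      have "(\<forall>j\<in>Obj J. h \<cdot>\<^bsub>C\<^esub> t j = t' j) \<longleftrightarrow> (\<forall>n\<in>N. h \<cdot>\<^bsub>C\<^esub> g n = g' n) \<and> (\<forall>e\<in>E. h \<cdot>\<^bsub>C\<^esub> g (s e) = g' (s e))"
      proof -
        have "Obj J = (\<lambda>n. \<iota> (Inl (Inl n))) ` N \<union> (\<lambda>e. \<iota> (Inl (Inr e))) ` E"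
          by (auto simp: J_def Z_def image_iff)
        then show ?thesis using c unfolding cocone by (simp add: ball_Un t'_def g_def)
      qed
      then show ?thesis using e by blast
    qed
    ultimately show "\<exists>!h. h \<in> Hom C y w \<and> (\<forall>n\<in>N. h \<cdot>\<^bsub>C\<^esub> g n = g' n)" by simp
  qed
qed

section \<open>Liftings and weak factorization systems\<close>

lemma Hom_Arr: "f \<in> Arr C \<Longrightarrow> f \<in> Hom C (Dom C f) (Cod C f)"
  by (simp add: Hom_def)

lemma Hom_Dom: "f \<in> Hom C x y \<Longrightarrow> Dom C f = x"
  and Hom_Cod: "f \<in> Hom C x y \<Longrightarrow> Cod C f = y"
  and Hom_in_Arr: "f \<in> Hom C x y \<Longrightarrow> f \<in> Arr C"
  by (auto simp: Hom_def)

lemma has_liftingD: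
  assumes "has_lifting C i p" "i \<in> Hom C a b" "p \<in> Hom C x y"
    "u \<in> Hom C a x" "v \<in> Hom C b y" "p \<cdot>\<^bsub>C\<^esub> u = v \<cdot>\<^bsub>C\<^esub> i"
  obtains h where "h \<in> Hom C b x" "h \<cdot>\<^bsub>C\<^esub> i = u" "p \<cdot>\<^bsub>C\<^esub> h = v"
  using assms unfolding has_lifting_def by (auto simp: Hom_Dom Hom_Cod)

lemma has_liftingI:
  assumes "i \<in> Hom C a b" "p \<in> Hom C x y"
    "\<And>u v. u \<in> Hom C a x \<Longrightarrow> v \<in> Hom C b y \<Longrightarrow> p \<cdot>\<^bsub>C\<^esub> u = v \<cdot>\<^bsub>C\<^esub> i \<Longrightarrow>
      \<exists>h\<in>Hom C b x. h \<cdot>\<^bsub>C\<^esub> i = u \<and> p \<cdot>\<^bsub>C\<^esub> h = v"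
  shows "has_lifting C i p"
  using assms unfolding has_lifting_def by (auto simp: Hom_Dom Hom_Cod)

context category
begin

lemma Hom_Obj: "f \<in> Hom C x y \<Longrightarrow> x \<in> Obj C \<and> y \<in> Obj C"
  using Dom_in Cod_in by (auto simp: Hom_def)

lemma has_lifting_comp:
  assumes "f \<in> Hom C x y" "g \<in> Hom C y z" "p \<in> Arr C" "has_lifting C f p" "has_lifting C g p"
  shows "has_lifting C (g \<cdot> f) p"
proof (rule has_liftingI[OF Cmp_in[OF assms(1,2)] Hom_Arr[OF assms(3)]])
  fix u v assume u: "u \<in> Hom C x (Dom C p)" and v: "v \<in> Hom C z (Cod C p)"
    and sq: "p \<cdot> u = v \<cdot> (g \<cdot> f)"
  note p = Hom_Arr[OF assms(3)]
  have "p \<cdot> u = (v \<cdot> g) \<cdot> f" using sq assoc[OF assms(1,2) v] by simp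
  then obtain h where h: "h \<in> Hom C y (Dom C p)" "h \<cdot> f = u" "p \<cdot> h = v \<cdot> g"
    by (rule has_liftingD[OF assms(4,1) p u Cmp_in[OF assms(2) v]])
  then obtain k where k: "k \<in> Hom C z (Dom C p)" "k \<cdot> g = h" "p \<cdot> k = v"
    by (blast intro: has_liftingD[OF assms(5,2) p h(1) v])
  then show "\<exists>h\<in>Hom C z (Dom C p). h \<cdot> g \<cdot> f = u \<and> p \<cdot> h = v"
    using assoc[OF assms(1,2) k(1)] h by auto
qed

text \<open>The problem is extended along the retractions, solved for \<open>g\<close>, and the
  solution restricted along the section \<open>i'\<close>.\<close>

lemma has_lifting_retract:
  assumes "is_retract C f g" "has_lifting C g p" "p \<in> Arr C"
  shows "has_lifting C f p"
proof -
  from assms(1) obtain i r i' r' where fg: "f \<in> Arr C" "g \<in> Arr C"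
    and h: "i \<in> Hom C (Dom C f) (Dom C g)" "r \<in> Hom C (Dom C g) (Dom C f)"
      "i' \<in> Hom C (Cod C f) (Cod C g)" "r' \<in> Hom C (Cod C g) (Cod C f)"
    and e: "r \<cdot> i = Idt C (Dom C f)" "r' \<cdot> i' = Idt C (Cod C f)" "g \<cdot> i = i' \<cdot> f" "f \<cdot> r = r' \<cdot> g"
    unfolding is_retract_def by blast
  note f = Hom_Arr[OF fg(1)] and g = Hom_Arr[OF fg(2)] and p = Hom_Arr[OF assms(3)]
  show ?thesis
  proof (rule has_liftingI[OF f p])
    fix u v assume u: "u \<in> Hom C (Dom C f) (Dom C p)" and v: "v \<in> Hom C (Cod C f) (Cod C p)"
      and sq: "p \<cdot> u = v \<cdot> f"
    have "p \<cdot> (u \<cdot> r) = (v \<cdot> r') \<cdot> g"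
      using assoc[OF h(2) u p] assoc[OF h(2) f v] assoc[OF g h(4) v] sq e(4) by simp
    then obtain k where k: "k \<in> Hom C (Cod C g) (Dom C p)" "k \<cdot> g = u \<cdot> r" "p \<cdot> k = v \<cdot> r'"
      by (rule has_liftingD[OF assms(2) g p Cmp_in[OF h(2) u] Cmp_in[OF h(4) v]])
    have "(k \<cdot> i') \<cdot> f = u"
      using assoc[OF f h(3) k(1)] assoc[OF h(1) g k(1)] assoc[OF h(1,2) u] e k Idt_right[OF u] by simp
    moreover have "p \<cdot> (k \<cdot> i') = v"
      using assoc[OF h(3) k(1) p] assoc[OF h(3,4) v] e k Idt_right[OF v] by simp
    ultimately show "\<exists>h\<in>Hom C (Cod C f) (Dom C p). h \<cdot> f = u \<and> p \<cdot> h = v"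
      using Cmp_in[OF h(3) k(1)] by blast
  qed
qed

text \<open>A lift against \<open>i\<close> and the given \<open>U\<close> glue to an arrow out of
  the pushout; the lower triangle follows from uniqueness of such arrows, tested on both
  legs.\<close>

lemma has_lifting_pushout:
  assumes "is_pushout C i u f v" "has_lifting C i p" "p \<in> Arr C"
  shows "has_lifting C f p"
proof -
  from assms(1) obtain a b x y where
    h: "i \<in> Hom C a b" "u \<in> Hom C a x" "f \<in> Hom C x y" "v \<in> Hom C b y" "f \<cdot> u = v \<cdot> i"
    and univ: "\<And>z s q. s \<in> Hom C x z \<Longrightarrow> q \<in> Hom C b z \<Longrightarrow> s \<cdot> u = q \<cdot> i \<Longrightarrow>
           \<exists>!h. h \<in> Hom C y z \<and> h \<cdot> f = s \<and> h \<cdot> v = q"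
    unfolding is_pushout_def by blast
  note p = Hom_Arr[OF assms(3)]
  show ?thesis
  proof (rule has_liftingI[OF h(3) p])
    fix U V assume U: "U \<in> Hom C x (Dom C p)" and V: "V \<in> Hom C y (Cod C p)"
      and sq: "p \<cdot> U = V \<cdot> f"
    have "p \<cdot> (U \<cdot> u) = (V \<cdot> v) \<cdot> i"
      using assoc[OF h(2) U p] assoc[OF h(2,3) V] assoc[OF h(1,4) V] sq h by simp
    then obtain k where k: "k \<in> Hom C b (Dom C p)" "k \<cdot> i = U \<cdot> u" "p \<cdot> k = V \<cdot> v"
      by (rule has_liftingD[OF assms(2) h(1) p Cmp_in[OF h(2) U] Cmp_in[OF h(4) V]])
    obtain m where m: "m \<in> Hom C y (Dom C p)" "m \<cdot> f = U" "m \<cdot> v = k"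
      using univ[OF U k(1)] k by metis
    have "V \<cdot> f \<cdot> u = (V \<cdot> v) \<cdot> i" using assoc[OF h(1,4) V] h(5) by simp
    then have "\<exists>!h. h \<in> Hom C y (Cod C p) \<and> h \<cdot> f = V \<cdot> f \<and> h \<cdot> v = V \<cdot> v"
      using univ[OF Cmp_in[OF h(3) V] Cmp_in[OF h(4) V]] assoc[OF h(2,3) V] by simp
    moreover have "(p \<cdot> m) \<cdot> f = V \<cdot> f" "(p \<cdot> m) \<cdot> v = V \<cdot> v"
      using assoc[OF h(3) m(1) p] assoc[OF h(4) m(1) p] m k sq by simp_all
    ultimately have "p \<cdot> m = V" using V Cmp_in[OF m(1) p] by blast
    then show "\<exists>h\<in>Hom C y (Dom C p). h \<cdot> f = U \<and> p \<cdot> h = V" using m by blast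
  qed
qed

end

section \<open>Lifting against transfinite compositions and relative cell complexes\<close>

lemma is_cocone_ord_cat:
  "is_cocone (ord_cat s) C X w k \<longleftrightarrow> w \<in> Obj C \<and> (\<forall>b\<in>Field s. k b \<in> Hom C (on_obj X b) w) \<and>
     (\<forall>b c. (b, c) \<in> s \<longrightarrow> k c \<cdot>\<^bsub>C\<^esub> on_arr X (b, c) = k b)"
  by (auto simp: is_cocone_def ord_cat_def)

lemma Field_Restr_underS: "Refl r \<Longrightarrow> Field (Restr r (underS r c)) = underS r c"
  by (auto simp: Field_def underS_def refl_on_def)

lemma Well_order_underS_mem:
  assumes "Well_order r" "b \<in> Field r" "c \<in> Field r"
  shows "(c, b) \<in> r \<or> b \<in> underS r c"
  using assms wo_rel.TOTALS[of r] by (auto simp: wo_rel_def underS_def refl_on_def)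

lemma Well_order_facts:
  assumes "Well_order r"
  shows "Refl r" "trans r" "antisym r" "wf (r - Id)"
  using assms by (auto simp: well_order_on_def linear_order_on_def partial_order_on_def preorder_on_def)

context category
begin

text \<open>Partial lifts are built by well-founded recursion, each extending the earlier ones:
  restrictions of \<open>u\<close> up to \<open>b\<close>, a lift against the step at successors,
  the colimit arrow at limits. Allowing any \<open>b\<close>, not only the least one, later gives
  the lifting property of every stage inclusion.\<close>

lemma sequence_lifting:
  fixes r :: "'u rel"
  assumes seq: "is_sequence C D r X" and colim: "is_colimit (ord_cat r) C X y t"
    and D: "\<And>d. d \<in> D \<Longrightarrow> has_lifting C d p" and p: "p \<in> Arr C" and b: "b \<in> Field r"
  shows "has_lifting C (t b) p"
proof -
  have wo: "Well_order r" and F: "cat_functor (ord_cat r) C X"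
    using seq unfolding is_sequence_def by auto
  note wof = Well_order_facts[OF wo]
  interpret F: cat_functor "ord_cat r" C X by (rule F)
  let ?X = "on_obj X" and ?x = "\<lambda>b c. on_arr X (b, c)"
  have X: "?x c d \<in> Hom C (?X c) (?X d)" if "(c, d) \<in> r" for c d
    using F.arr_in[of "(c, d)" c d] that by (simp add: Hom_def ord_cat_def)
  have Xid: "?x c c = Idt C (?X c)" if "c \<in> Field r" for c
    using F.map_Idt[of c] that by (simp add: ord_cat_def)
  have Xcomp: "?x d e \<cdot> ?x c d = ?x c e" if "(c, d) \<in> r" "(d, e) \<in> r" for c d e
    using F.map_Cmp[of "(c, d)" c d "(d, e)" e] that by (simp add: Hom_def ord_cat_def)
  have fld: "c \<in> Field r" "d \<in> Field r" if "(c, d) \<in> r" for c d using that by (auto simp: Field_def)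
  have t: "t c \<in> Hom C (?X c) y" if "c \<in> Field r" for c
    using colim that unfolding is_colimit_def is_cocone_ord_cat by blast
  have tX: "t d \<cdot> ?x c d = t c" if "(c, d) \<in> r" for c d
    using colim that unfolding is_colimit_def is_cocone_ord_cat by blast
  let ?a = "Dom C p" and ?b = "Cod C p"
  note p = Hom_Arr[OF p]
  show ?thesis
  proof (rule has_liftingI[OF t[OF b] p])
    fix u v assume u: "u \<in> Hom C (?X b) ?a" and v: "v \<in> Hom C y ?b" and sq: "p \<cdot> u = v \<cdot> t b"
    \<comment> \<open>\<open>h\<close> enters only at indices strictly below \<open>c\<close>, as
      the recursion demands. The value is prescribed up to \<open>b\<close>; beyond \<open>b\<close>
      it only has to extend the earlier values and to cover \<open>v\<close>.\<close>
    define P where "P h c a \<longleftrightarrow> (c \<in> Field r \<longrightarrow> a \<in> Hom C (?X c) ?a \<and> p \<cdot> a = v \<cdot> t c \<and>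
      (\<forall>c'\<in>underS r c. a \<cdot> ?x c' c = h c') \<and> ((c, b) \<in> r \<longrightarrow> a = u \<cdot> ?x c b))" for h c a
    have "\<exists>h. \<forall>c. P h c (h c)"
    proof (rule dependent_wf_choice[of "r - Id"])
      show "wf (r - Id)" by (rule wof)
      show "P f c a = P g c a" if "\<And>z. (z, c) \<in> r - Id \<Longrightarrow> f z = g z" for f g c a
        using that unfolding P_def underS_def by auto
      fix c h assume IH: "\<And>z. (z, c) \<in> r - Id \<Longrightarrow> P h z (h z)"
      show "\<exists>a. P h c a"
      proof (cases "c \<in> Field r")
        case c: True
        have IH: "h z \<in> Hom C (?X z) ?a" "p \<cdot> h z = v \<cdot> t z" "\<And>c'. c' \<in> underS r z \<Longrightarrow> h z \<cdot> ?x c' z = h c'"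
          "(z, b) \<in> r \<Longrightarrow> h z = u \<cdot> ?x z b" if "z \<in> underS r c" for z
          using IH[of z] that fld unfolding P_def underS_def by auto
        consider "(c, b) \<in> r" | "b \<in> underS r c" using Well_order_underS_mem[OF wo b c] by blast
        then show ?thesis
        proof cases
          case 1
          have "p \<cdot> u \<cdot> ?x c b = v \<cdot> t c"
            using assoc[OF X[OF 1] u p] assoc[OF X[OF 1] t[OF b] v] tX[OF 1] sq by simp
          moreover have "(u \<cdot> ?x c b) \<cdot> ?x c' c = h c'" if "c' \<in> underS r c" for c'
          proof -
            have 2: "(c', c) \<in> r" using that by (simp add: underS_def)
            then have "(c', b) \<in> r" using 1 wof(2) by (meson transD)
            then show ?thesis using assoc[OF X[OF 2] X[OF 1] u] Xcomp[OF 2 1] IH(4)[OF that] by simp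
          qed
          ultimately show ?thesis using Cmp_in[OF X[OF 1] u] unfolding P_def by blast
        next
          case 2
          then have ncb: "(c, b) \<notin> r" using wof(3) by (auto simp: underS_def antisym_def)
          \<comment> \<open>Here \<open>b\<close> lies strictly below \<open>c\<close>, so
            \<open>c\<close> is not the least element and is either a successor or a limit.\<close>
          show ?thesis
          proof (cases "\<exists>d. is_successor_of r c d")
            case True
            then obtain d where d: "is_successor_of r c d" ..
            then have ud: "underS r c = under r d" and df: "d \<in> Field r" by (auto simp: is_successor_of_def)
            then have dc: "d \<in> underS r c" using wof(1) by (auto simp: under_def refl_on_def)
            then have dcr: "(d, c) \<in> r" by (simp add: underS_def)
            have "?x d c \<in> D" using seq d unfolding is_sequence_def by blast
            then have lift: "has_lifting C (?x d c) p" by (rule D)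
            have "p \<cdot> h d = (v \<cdot> t c) \<cdot> ?x d c"
              using IH(2)[OF dc] assoc[OF X[OF dcr] t[OF c] v] tX[OF dcr] by simp
            then obtain a where a: "a \<in> Hom C (?X c) ?a" "a \<cdot> ?x d c = h d" "p \<cdot> a = v \<cdot> t c"
              by (rule has_liftingD[OF lift X[OF dcr] p IH(1)[OF dc] Cmp_in[OF t[OF c] v]])
            have "a \<cdot> ?x c' c = h c'" if "c' \<in> underS r c" for c'
            proof (cases "c' = d")
              case False
              then have 3: "c' \<in> underS r d" "(c', d) \<in> r" using that ud by (auto simp: under_def underS_def)
              show ?thesis
                using IH(3)[OF dc 3(1)] a assoc[OF X[OF 3(2)] X[OF dcr] a(1)] Xcomp[OF 3(2) dcr] by simp
            qed (simp add: a)
            then show ?thesis using a ncb unfolding P_def by blast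
          next
            case False
            then have "is_limit_elem r c" using 2 c unfolding is_limit_elem_def by blast
            then have lim: "is_colimit (ord_cat (Restr r (underS r c))) C X (?X c) (\<lambda>b. ?x b c)"
              using seq unfolding is_sequence_def by blast
            note Fl = Field_Restr_underS[OF wof(1)]
            have Rc: "is_cocone (ord_cat (Restr r (underS r c))) C X w k \<longleftrightarrow> w \<in> Obj C \<and>
               (\<forall>b\<in>underS r c. k b \<in> Hom C (?X b) w) \<and>
               (\<forall>b\<in>underS r c. \<forall>d\<in>underS r c. (b, d) \<in> r \<longrightarrow> k d \<cdot> ?x b d = k b)" for w k
              unfolding is_cocone_ord_cat Fl by auto
            have Ro: "Obj (ord_cat (Restr r (underS r c))) = underS r c" unfolding ord_cat_def using Fl by simp
            have "is_cocone (ord_cat (Restr r (underS r c))) C X ?a h"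
              unfolding Rc
            proof (intro conjI ballI impI)
              fix e d assume e: "e \<in> underS r c" "d \<in> underS r c" "(e, d) \<in> r"
              show "h d \<cdot> ?x e d = h e"
              proof (cases "e = d")
                case True
                then show ?thesis using Xid[of d] fld(1)[OF e(3)] Idt_right[OF IH(1)[OF e(2)]] by simp
              next
                case False
                then show ?thesis using IH(3)[OF e(2)] e by (auto simp: underS_def)
              qed
            qed (use IH(1) Hom_Obj[OF p] in auto)
            then obtain a where a: "a \<in> Hom C (?X c) ?a" "\<And>d. d \<in> underS r c \<Longrightarrow> a \<cdot> ?x d c = h d"
              using lim unfolding is_colimit_def Ro by metis
            have cc: "is_cocone (ord_cat (Restr r (underS r c))) C X ?b (\<lambda>d. v \<cdot> t d)"
              unfolding Rc using Hom_Obj[OF p] Cmp_in[OF t v] fld tX assoc[OF X t v] by (auto simp: underS_def)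
            then have ex1: "\<exists>!k. k \<in> Hom C (?X c) ?b \<and> (\<forall>d\<in>underS r c. k \<cdot> ?x d c = v \<cdot> t d)"
              using lim unfolding is_colimit_def Ro by blast
            have "(p \<cdot> a) \<cdot> ?x d c = v \<cdot> t d" "(v \<cdot> t c) \<cdot> ?x d c = v \<cdot> t d" if "d \<in> underS r c" for d
            proof -
              have dc: "(d, c) \<in> r" using that by (simp add: underS_def)
              show "(p \<cdot> a) \<cdot> ?x d c = v \<cdot> t d" using assoc[OF X[OF dc] a(1) p] a(2) IH(2) that by simp
              show "(v \<cdot> t c) \<cdot> ?x d c = v \<cdot> t d" using assoc[OF X[OF dc] t[OF c] v] tX[OF dc] by simp
            qed
            then have "p \<cdot> a = v \<cdot> t c"
              using ex1 Cmp_in[OF a(1) p] Cmp_in[OF t[OF c] v] by blast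
            then show ?thesis using a ncb unfolding P_def by blast
          qed
        qed
      qed (simp add: P_def)
    qed
    then obtain h where h: "\<And>c. P h c (h c)" by blast
    have h1: "h c \<in> Hom C (?X c) ?a" "p \<cdot> h c = v \<cdot> t c" if "c \<in> Field r" for c
      using h[of c] that unfolding P_def by auto
    have Ob: "Obj (ord_cat r) = Field r" by (simp add: ord_cat_def)
    have "is_cocone (ord_cat r) C X ?a h" unfolding is_cocone_ord_cat
    proof (intro conjI ballI allI impI)
      fix e d assume e: "(e, d) \<in> r"
      show "h d \<cdot> ?x e d = h e"
      proof (cases "e = d")
        case True
        then show ?thesis using Xid[of d] fld(1)[OF e] Idt_right[OF h1(1)] by simp
      next
        case False
        then show ?thesis using h[of d] e fld(2)[OF e] unfolding P_def by (auto simp: underS_def)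
      qed
    qed (use h1(1) Hom_Obj[OF p] in auto)
    then obtain k where k: "k \<in> Hom C y ?a" "\<And>c. c \<in> Field r \<Longrightarrow> k \<cdot> t c = h c"
      using colim unfolding is_colimit_def Ob by metis
    have "is_cocone (ord_cat r) C X ?b (\<lambda>d. v \<cdot> t d)"
      unfolding is_cocone_ord_cat using Hom_Obj[OF p] Cmp_in[OF t v] fld tX assoc[OF X t v] by auto
    then have ex1: "\<exists>!k. k \<in> Hom C y ?b \<and> (\<forall>d\<in>Field r. k \<cdot> t d = v \<cdot> t d)"
      using colim unfolding is_colimit_def Ob by blast
    have "(p \<cdot> k) \<cdot> t d = v \<cdot> t d" if "d \<in> Field r" for d
      using assoc[OF t[OF that] k(1) p] k(2)[OF that] h1(2)[OF that] by simp
    then have "p \<cdot> k = v" using ex1 Cmp_in[OF k(1) p] v by blast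
    moreover have "k \<cdot> t b = u"
    proof -
      have "(b, b) \<in> r" using b wof(1) by (simp add: refl_on_def)
      then have "h b = u \<cdot> ?x b b" using h[of b] b unfolding P_def by blast
      then show ?thesis using k(2)[OF b] Xid[OF b] Idt_right[OF u] by simp
    qed
    ultimately show "\<exists>h\<in>Hom C y ?a. h \<cdot> t b = u \<and> p \<cdot> h = v" using k(1) by blast
  qed
qed

text \<open>Reduces lifting against everything that \<open>I\<close> generates to lifting against
  the members of \<open>I\<close>.\<close>

lemma has_lifting_retracts_cell:
  assumes "f \<in> retracts C (relative_cell_complexes \<kappa> C I)" "\<And>i. i \<in> I \<Longrightarrow> has_lifting C i p"
    and p: "p \<in> Arr C"
  shows "has_lifting C f p"
proof -
  obtain g where g: "g \<in> relative_cell_complexes \<kappa> C I" "is_retract C f g"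
    using assms(1) by (auto simp: retracts_def)
  have "has_lifting C g p"
    using g(1) unfolding relative_cell_complexes_def transfinite_compositions_def
    by (fastforce intro: sequence_lifting has_lifting_pushout[OF _ assms(2) p] p)
  then show ?thesis using has_lifting_retract g(2) p by blast
qed

end

text \<open>Only cofibrations against acyclic fibrations are involved. Abstracting from the model
  structure lets the same construction run in the opposite category, with the two classes
  exchanged.\<close>

locale weak_factorization_system = category C
  for C :: "('o, 'm, 'z) cat_scheme" (structure) +
  fixes L R :: "'m set"
  assumes L_Arr: "L \<subseteq> Arr C" and R_Arr: "R \<subseteq> Arr C"
    and lifting: "i \<in> L \<Longrightarrow> p \<in> R \<Longrightarrow> has_lifting C i p"
    and factorization: "f \<in> Hom C x y \<Longrightarrow>
      \<exists>z. \<exists>i \<in> Hom C x z \<inter> L. \<exists>p \<in> Hom C z y \<inter> R. f = p \<cdot> i"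
    and L_retract: "g \<in> L \<Longrightarrow> is_retract C f g \<Longrightarrow> f \<in> L"
    and R_retract: "g \<in> R \<Longrightarrow> is_retract C f g \<Longrightarrow> f \<in> R"
begin

lemma L_Hom: "i \<in> L \<Longrightarrow> i \<in> Hom C (Dom C i) (Cod C i)"
  and R_Hom: "p \<in> R \<Longrightarrow> p \<in> Hom C (Dom C p) (Cod C p)"
  using L_Arr R_Arr by (auto intro: Hom_Arr)

text \<open>The retract argument: \<open>i\<close> factors as \<open>p\<close> after
  \<open>j\<close>, and a lift of \<open>i\<close> against \<open>p\<close> exhibits
  \<open>i\<close> as a retract of \<open>j\<close>.\<close>

lemma L_if_lifting:
  assumes "i \<in> Arr C" "\<And>p. p \<in> R \<Longrightarrow> has_lifting C i p"
  shows "i \<in> L"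
proof -
  note i = Hom_Arr[OF assms(1)]
  let ?a = "Dom C i" and ?b = "Cod C i"
  have ab: "Idt C ?a \<in> Hom C ?a ?a" "Idt C ?b \<in> Hom C ?b ?b" using Hom_Obj[OF i] Idt_in by auto
  from factorization[OF i] obtain z j p where j: "j \<in> Hom C ?a z" "j \<in> L"
    and p: "p \<in> Hom C z ?b" "p \<in> R" and e: "i = p \<cdot> j" by blast
  have "p \<cdot> j = Idt C ?b \<cdot> i" using e Idt_left[OF i] by simp
  then obtain h where h: "h \<in> Hom C ?b z" "h \<cdot> i = j" "p \<cdot> h = Idt C ?b"
    by (rule has_liftingD[OF assms(2)[OF p(2)] i p(1) j(1) ab(2)])
  have dc: "Dom C j = ?a" "Cod C j = z" using j(1) by (auto simp: Hom_def)
  have "is_retract C i j" unfolding is_retract_def dc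
    using assms(1) j(1) ab h p(1) e Idt_left Idt_right[OF j(1)] Idt_right[OF i]
    by (metis Hom_in_Arr)
  then show ?thesis using L_retract j(2) by blast
qed

text \<open>Dually, a lift of the first factor against \<open>p\<close> makes \<open>p\<close> a
  retract of the second factor.\<close>

lemma R_if_lifting:
  assumes "p \<in> Arr C" "\<And>i. i \<in> L \<Longrightarrow> has_lifting C i p"
  shows "p \<in> R"
proof -
  note p = Hom_Arr[OF assms(1)]
  let ?a = "Dom C p" and ?b = "Cod C p"
  have ab: "Idt C ?a \<in> Hom C ?a ?a" "Idt C ?b \<in> Hom C ?b ?b" using Hom_Obj[OF p] Idt_in by auto
  from factorization[OF p] obtain z j q where j: "j \<in> Hom C ?a z" "j \<in> L"
    and q: "q \<in> Hom C z ?b" "q \<in> R" and e: "p = q \<cdot> j" by blast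
  have "p \<cdot> Idt C ?a = q \<cdot> j" using e Idt_right[OF p] by simp
  then obtain h where h: "h \<in> Hom C z ?a" "h \<cdot> j = Idt C ?a" "p \<cdot> h = q"
    by (rule has_liftingD[OF assms(2)[OF j(2)] j(1) p ab(1) q(1)])
  have dc: "Dom C q = z" "Cod C q = ?b" using q(1) by (auto simp: Hom_def)
  have "is_retract C p q" unfolding is_retract_def dc
    using assms(1) j(1) ab h q(1) e Idt_left[OF ab(2)] Idt_left[OF q(1)] Idt_left[OF p]
    by (metis Hom_in_Arr)
  then show ?thesis using R_retract q(2) by blast
qed

end

section \<open>Chains of cell attachments\<close>

text \<open>Names for the legs that present a stage: the starting object, an earlier stage, and the
  cell attached to stage \<open>c\<close> along \<open>u\<close> for the square with second leg
  \<open>v\<close>. Being formal, a name keeps its meaning at all later stages, and after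
  transporting \<open>u\<close> and \<open>v\<close> it can be looked up in the chain of another
  object.\<close>

datatype ('u, 'm) gen = Base | Stage 'u | Cell 'u 'm 'm 'm

definition below :: "'u rel \<Rightarrow> 'u option \<Rightarrow> 'u set" where
  "below r a = (case a of None \<Rightarrow> Field r | Some b \<Rightarrow> underS r b)"

lemma below_simps [simp]: "below r None = Field r" "below r (Some b) = underS r b"
  by (simp_all add: below_def)

lemma below_Field: "c \<in> below r a \<Longrightarrow> c \<in> Field r"
  by (cases a) (auto simp: underS_def Field_def)

lemma underS_trans:
  assumes "Well_order r" "d \<in> underS r c" "c \<in> underS r b"
  shows "d \<in> underS r b"
proof -
  have "d \<noteq> c" "(d, c) \<in> r" "c \<noteq> b" "(c, b) \<in> r" using assms(2,3) by (auto simp: underS_def)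
  then have "(d, b) \<in> r" "d \<noteq> b"
    using Well_order_facts(2,3)[OF assms(1)] by (blast dest: transD antisymD)+
  then show ?thesis by (simp add: underS_def)
qed

lemma below_trans:
  assumes "Well_order r" "c \<in> below r a" "d \<in> underS r c"
  shows "d \<in> below r a"
proof (cases a)
  case None
  then show ?thesis using assms(3) by (auto simp: underS_def Field_def)
next
  case (Some b)
  then show ?thesis using underS_trans[OF assms(1,3)] assms(2) by simp
qed

lemma underS_linear:
  assumes "Well_order r" "c \<in> Field r" "d \<in> Field r"
  obtains "c = d" | "c \<in> underS r d" | "d \<in> underS r c"
  using assms Well_order_underS_mem[OF assms] by (auto simp: underS_def)

text \<open>Only \<open>Some\<close> indices precede anything. Well-foundedness of \<open>l\<close>
  settles them, and \<open>None\<close> follows by one more step.\<close>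

lemma wf_below:
  assumes "Well_order r"
  shows "wf {(Some c, a) | c a. c \<in> below r a}"
proof (rule wfUNIVI)
  fix Q a
  assume H: "\<forall>x. (\<forall>y. (y, x) \<in> {(Some c, a) | c a. c \<in> below r a} \<longrightarrow> Q y) \<longrightarrow> Q x"
  have S: "Q (Some b)" for b
    using Well_order_facts(4)[OF assms]
  proof (induct b rule: wf_induct_rule)
    case (less b)
    show ?case
    proof (rule H[rule_format])
      fix y assume "(y, Some b) \<in> {(Some c, a) | c a. c \<in> below r a}"
      then show "Q y" using less by (auto simp: underS_def)
    qed
  qed
  then show "Q a" using H[rule_format, of a] by blast
qed

locale small_object_argument = weak_factorization_system C L R
  for C :: "('o, 'm, 'z) cat_scheme" (structure) and L R +
  fixes \<kappa> l :: "'u rel" and I :: "'m set"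
  assumes inacc: "inaccessible \<kappa>" and cocomp: "cocomplete \<kappa> C"
    and loc_small: "x \<in> Obj C \<Longrightarrow> y \<in> Obj C \<Longrightarrow> small \<kappa> (Hom C x y)"
    and I_L: "I \<subseteq> L" and I_small: "small \<kappa> I"
    and L_cell: "L = retracts C (relative_cell_complexes \<kappa> C I)"
    and regular: "regular_ordinal l" and l_small: "small \<kappa> (Field l)"
    and dom_small: "i \<in> I \<Longrightarrow> small_object_rel \<kappa> C l L (Dom C i)"
begin

lemma wo: "Well_order l"
  using regular unfolding regular_ordinal_def card_order_on_def by blast

lemma I_Arr: "i \<in> I \<Longrightarrow> i \<in> Hom C (Dom C i) (Cod C i)"
  using I_L by (auto intro: L_Hom)

text \<open>
  The index \<open>None\<close> stands for the colimit of the chain. Successor and limit steps are not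
  distinguished: every stage is universal among the objects that receive all earlier stages and all
  cells attached to them. An index \<open>Some b\<close> with \<open>b\<close> outside \<open>Field l\<close> has no earlier stages, so no case
  distinction is needed for it.
\<close>

definition cells ::
  "bool \<Rightarrow> 'o \<Rightarrow> ('u option \<Rightarrow> 'o) \<Rightarrow> ('u option \<Rightarrow> ('u, 'm) gen \<Rightarrow> 'm) \<Rightarrow> ('u option \<Rightarrow> 'm) \<Rightarrow>
    'u \<Rightarrow> ('m \<times> 'm \<times> 'm) set" where
  "cells new x X G P c = {(i, u, v). i \<in> I \<and> u \<in> Hom C (Dom C i) (X (Some c)) \<and>
     v \<in> Hom C (Cod C i) x \<and> P (Some c) \<cdot> u = v \<cdot> i \<and>
     (new \<longrightarrow> \<not> (\<exists>d\<in>underS l c. \<exists>u'\<in>Hom C (Dom C i) (X (Some d)). u = G (Some c) (Stage d) \<cdot> u'))}"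

definition gens ::
  "bool \<Rightarrow> 'o \<Rightarrow> ('u option \<Rightarrow> 'o) \<Rightarrow> ('u option \<Rightarrow> ('u, 'm) gen \<Rightarrow> 'm) \<Rightarrow> ('u option \<Rightarrow> 'm) \<Rightarrow>
    'u set \<Rightarrow> ('u, 'm) gen set" where
  "gens new x X G P B = insert Base (Stage ` B \<union>
     {Cell c i u v | c i u v. c \<in> B \<and> (i, u, v) \<in> cells new x X G P c})"

fun gob :: "'o \<Rightarrow> ('u option \<Rightarrow> 'o) \<Rightarrow> ('u, 'm) gen \<Rightarrow> 'o" where
  "gob x0 X Base = x0"
| "gob x0 X (Stage c) = X (Some c)"
| "gob x0 X (Cell c i u v) = Cod C i"

fun gval :: "'m \<Rightarrow> ('u option \<Rightarrow> 'm) \<Rightarrow> ('u, 'm) gen \<Rightarrow> 'm" where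
  "gval f P Base = f"
| "gval f P (Stage c) = P (Some c)"
| "gval f P (Cell c i u v) = v"

text \<open>Compatibility is demanded for all generators of an earlier stage, cells included. The
  leg at an old cell is thereby its composite through any stage that already contains the cell, so
  cells keep their names along the chain.\<close>

definition cocone where
  "cocone new x0 x X G P B w g \<longleftrightarrow> w \<in> Obj C \<and>
     (\<forall>\<alpha>\<in>gens new x X G P B. g \<alpha> \<in> Hom C (gob x0 X \<alpha>) w) \<and>
     (\<forall>c\<in>B. \<forall>\<alpha>\<in>gens new x X G P (underS l c). g (Stage c) \<cdot> G (Some c) \<alpha> = g \<alpha>) \<and>
     (\<forall>c\<in>B. \<forall>(i, u, v)\<in>cells new x X G P c. g (Cell c i u v) \<cdot> i = g (Stage c) \<cdot> u)"

definition stage where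
  "stage new f x0 x X G P B y g p \<longleftrightarrow> cocone new x0 x X G P B y g \<and>
     (\<forall>w g'. cocone new x0 x X G P B w g' \<longrightarrow>
        (\<exists>!h. h \<in> Hom C y w \<and> (\<forall>\<alpha>\<in>gens new x X G P B. h \<cdot> g \<alpha> = g' \<alpha>))) \<and>
     p \<in> Hom C y x \<and> (\<forall>\<alpha>\<in>gens new x X G P B. p \<cdot> g \<alpha> = gval f P \<alpha>)"

context
  fixes B :: "'u set" and X X' :: "'u option \<Rightarrow> 'o" and G G' :: "'u option \<Rightarrow> ('u, 'm) gen \<Rightarrow> 'm"
    and P P' :: "'u option \<Rightarrow> 'm"
  assumes down: "\<And>c d. c \<in> B \<Longrightarrow> d \<in> underS l c \<Longrightarrow> d \<in> B"
    and eq: "\<And>c. c \<in> B \<Longrightarrow> X (Some c) = X' (Some c) \<and> G (Some c) = G' (Some c) \<and> P (Some c) = P' (Some c)"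
begin

lemma cells_cong: "c \<in> B \<Longrightarrow> cells new x X G P c = cells new x X' G' P' c"
  using eq down unfolding cells_def by fastforce

lemma gens_cong: "A \<subseteq> B \<Longrightarrow> gens new x X G P A = gens new x X' G' P' A"
  using cells_cong[of _ new x] by (auto simp: gens_def subset_iff)

lemma gob_cong: "\<alpha> \<in> gens new x X G P B \<Longrightarrow> gob x0 X \<alpha> = gob x0 X' \<alpha>"
  using eq by (auto simp: gens_def)

lemma gval_cong: "\<alpha> \<in> gens new x X G P B \<Longrightarrow> gval f P \<alpha> = gval f P' \<alpha>"
  using eq by (auto simp: gens_def)

lemma cocone_cong: "cocone new x0 x X G P B w g = cocone new x0 x X' G' P' B w g"
proof -
  have "gens new x X G P (underS l c) = gens new x X' G' P' (underS l c)" if "c \<in> B" for c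
    using down that by (intro gens_cong) blast
  then show ?thesis unfolding cocone_def
    using gens_cong[OF order_refl, of new x] gob_cong[of _ new x x0] cells_cong[of _ new x] eq by simp
qed

text \<open>What recursive choice of the chain requires: a stage reads the data only at earlier
  indices. Downward closure matters because newness of a cell at \<open>c\<close> looks at the
  stages below \<open>c\<close>.\<close>

lemma stage_cong: "stage new f x0 x X G P B y g p = stage new f x0 x X' G' P' B y g p"
  unfolding stage_def cocone_cong
  using gens_cong[OF order_refl, of new x] gval_cong[of _ new x f] by simp

end

text \<open>The cells on one stage lie in a sum over \<open>I\<close> of products of two hom sets,
  all of which are small.\<close>

lemma gens_small:
  assumes "small \<kappa> B" "\<And>c. c \<in> B \<Longrightarrow> X (Some c) \<in> Obj C" "x \<in> Obj C"
  shows "small \<kappa> (gens new x X G P B)"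
proof -
  have c: "small \<kappa> (cells new x X G P c)" if "c \<in> B" for c
  proof (rule small_mono)
    show "cells new x X G P c \<subseteq> (SIGMA i:I. Hom C (Dom C i) (X (Some c)) \<times> Hom C (Cod C i) x)"
      by (auto simp: cells_def)
    show "small \<kappa> (SIGMA i:I. Hom C (Dom C i) (X (Some c)) \<times> Hom C (Cod C i) x)"
      using Hom_Obj[OF I_Arr] that assms by (intro small_Sigma inacc I_small loc_small) auto
  qed
  have "{Cell c i u v | c i u v. c \<in> B \<and> (i, u, v) \<in> cells new x X G P c} =
    (\<lambda>(c, i, u, v). Cell c i u v) ` (SIGMA c:B. cells new x X G P c)" by force
  then have "small \<kappa> {Cell c i u v | c i u v. c \<in> B \<and> (i, u, v) \<in> cells new x X G P c}"
    by (simp add: small_image small_Sigma inacc assms(1) c)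
  then have "small \<kappa> ({Base} \<union> (Stage ` B \<union>
     {Cell c i u v | c i u v. c \<in> B \<and> (i, u, v) \<in> cells new x X G P c}))"
    by (intro small_Un inacc small_image assms(1) small_finite[of _ "{Base}"]) simp_all
  then show ?thesis by (simp add: gens_def)
qed

lemma stage_exists:
  assumes f: "f \<in> Hom C x0 x" and B: "small \<kappa> B" "\<And>c d. c \<in> B \<Longrightarrow> d \<in> underS l c \<Longrightarrow> d \<in> B"
    and st: "\<And>c. c \<in> B \<Longrightarrow> stage new f x0 x X G P (underS l c) (X (Some c)) (G (Some c)) (P (Some c))"
  shows "\<exists>y g p. stage new f x0 x X G P B y g p"
proof -
  let ?gens = "gens new x X G P" and ?ob = "gob x0 X" and ?cells = "cells new x X G P"
    and ?cocone = "cocone new x0 x X G P"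
  have x: "x0 \<in> Obj C" "x \<in> Obj C" using Hom_Obj[OF f] by auto
  have X: "X (Some c) \<in> Obj C" if "c \<in> B" for c
    using st[OF that] unfolding stage_def cocone_def by blast
  have G: "G (Some c) \<alpha> \<in> Hom C (?ob \<alpha>) (X (Some c))" if "c \<in> B" "\<alpha> \<in> ?gens (underS l c)" for c \<alpha>
    using st that unfolding stage_def cocone_def by blast
  have P: "P (Some c) \<in> Hom C (X (Some c)) x" if "c \<in> B" for c
    using st that unfolding stage_def by blast
  have PG: "P (Some c) \<cdot> G (Some c) \<alpha> = gval f P \<alpha>" if "c \<in> B" "\<alpha> \<in> ?gens (underS l c)" for c \<alpha>
    using st that unfolding stage_def by blast
  have obG: "?ob \<alpha> \<in> Obj C" if "\<alpha> \<in> ?gens B" for \<alpha>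
    using that X x Hom_Obj[OF I_Arr] by (auto simp: gens_def cells_def)
  have sub: "\<alpha> \<in> ?gens B" if "c \<in> B" "\<alpha> \<in> ?gens (underS l c)" for c \<alpha>
    using that B(2) by (auto simp: gens_def)
  have stB: "Stage c \<in> ?gens B" if "c \<in> B" for c using that by (simp add: gens_def)
  define K where "K = {Cell c i u v | c i u v. c \<in> B \<and> (i, u, v) \<in> ?cells c}"
  have KG: "K \<subseteq> ?gens B" unfolding K_def gens_def by blast
  \<comment> \<open>Each cell contributes two nodes: its codomain, which is among the generators,
    and, in the copy of \<open>K\<close>, its domain, from which the two attaching edges
    start.\<close>
  define N where "N = ?gens B <+> K"
  \<comment> \<open>An edge from every generator of an earlier stage \<open>c\<close> into
    \<open>Stage c\<close>; for each cell, one edge along \<open>i\<close> into the cell (tag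
    \<open>True\<close>) and one along \<open>u\<close> into its stage (tag
    \<open>False\<close>).\<close>
  define E where "E = (SIGMA c:B. ?gens (underS l c)) <+> (K \<times> (UNIV :: bool set))"
  define src :: "'u \<times> ('u, 'm) gen + ('u, 'm) gen \<times> bool \<Rightarrow> ('u, 'm) gen + ('u, 'm) gen" where
    "src e = (case e of Inl (c, \<alpha>) \<Rightarrow> Inl \<alpha> | Inr (k, _) \<Rightarrow> Inr k)" for e
  define tgt :: "'u \<times> ('u, 'm) gen + ('u, 'm) gen \<times> bool \<Rightarrow> ('u, 'm) gen + ('u, 'm) gen" where
    "tgt e = (case e of Inl (c, \<alpha>) \<Rightarrow> Inl (Stage c)
      | Inr (k, b) \<Rightarrow> (case k of Cell c i u v \<Rightarrow> if b then Inl k else Inl (Stage c)))" for e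
  define ar :: "'u \<times> ('u, 'm) gen + ('u, 'm) gen \<times> bool \<Rightarrow> 'm" where
    "ar e = (case e of Inl (c, \<alpha>) \<Rightarrow> G (Some c) \<alpha>
      | Inr (k, b) \<Rightarrow> (case k of Cell c i u v \<Rightarrow> if b then i else u))" for e
  define ob where "ob n = (case n of Inl \<alpha> \<Rightarrow> ?ob \<alpha> | Inr k \<Rightarrow> (case k of Cell c i u v \<Rightarrow> Dom C i))"
    for n :: "('u, 'm) gen + ('u, 'm) gen"
  have gB: "small \<kappa> (?gens B)" using gens_small B(1) X x by blast
  have gc: "small \<kappa> (?gens (underS l c))" if "c \<in> B" for c
    using small_mono[OF gB] sub that by blast
  have K: "small \<kappa> K" using small_mono[OF gB KG] .
  have NE: "small \<kappa> N" "small \<kappa> E"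
    unfolding N_def E_def
    by (intro small_Plus small_Sigma inacc gB gc K B(1) small_finite; simp)+
  have obO: "ob n \<in> Obj C" if "n \<in> N" for n
    using that unfolding N_def
  proof (elim PlusE)
    fix \<alpha> assume "n = Inl \<alpha>" "\<alpha> \<in> ?gens B"
    then show ?thesis using obG by (simp add: ob_def)
  next
    fix k assume "n = Inr k" "k \<in> K"
    then show ?thesis using Hom_Obj[OF I_Arr] by (auto simp: ob_def K_def cells_def)
  qed
  have edge: "src e \<in> N \<and> tgt e \<in> N \<and> ar e \<in> Hom C (ob (src e)) (ob (tgt e))" if "e \<in> E" for e
    using that unfolding E_def
  proof (elim PlusE SigmaE2)
    fix ca assume "e = Inl ca" "ca \<in> (SIGMA c:B. ?gens (underS l c))"
    then show ?thesis using G sub stB by (auto simp: src_def tgt_def ar_def ob_def N_def)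
  next
    fix kb assume "e = Inr kb" "kb \<in> K \<times> (UNIV :: bool set)"
    then show ?thesis using KG I_Arr
      by (auto simp: src_def tgt_def ar_def ob_def N_def K_def gens_def cells_def)
  qed
  obtain y g where y: "y \<in> Obj C" and g: "\<And>n. n \<in> N \<Longrightarrow> g n \<in> Hom C (ob n) y"
    and ge: "\<And>e. e \<in> E \<Longrightarrow> g (tgt e) \<cdot> ar e = g (src e)"
    and univ: "\<And>w g'. w \<in> Obj C \<Longrightarrow> (\<And>n. n \<in> N \<Longrightarrow> g' n \<in> Hom C (ob n) w) \<Longrightarrow>
      (\<And>e. e \<in> E \<Longrightarrow> g' (tgt e) \<cdot> ar e = g' (src e)) \<Longrightarrow>
      \<exists>!h. h \<in> Hom C y w \<and> (\<forall>n\<in>N. h \<cdot> g n = g' n)"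
    by (rule graph_colimit[where G = ob and s = src and d = tgt and m = ar, OF inacc category_axioms cocomp NE])
      (use obO edge in blast)+
  have gt: "g (Inl (Cell c i u v)) \<cdot> i = g (Inr (Cell c i u v))"
    "g (Inl (Stage c)) \<cdot> u = g (Inr (Cell c i u v))" if "c \<in> B" "(i, u, v) \<in> ?cells c" for c i u v
    using ge[of "Inr (Cell c i u v, True)"] ge[of "Inr (Cell c i u v, False)"] that
    by (auto simp: E_def K_def tgt_def src_def ar_def)
  have cc: "?cocone B y (\<lambda>\<alpha>. g (Inl \<alpha>))" unfolding cocone_def
  proof (intro conjI ballI)
    fix \<alpha> assume "\<alpha> \<in> ?gens B"
    then show "g (Inl \<alpha>) \<in> Hom C (?ob \<alpha>) y" using g[of "Inl \<alpha>"] by (auto simp: N_def ob_def)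
  next
    fix c \<alpha> assume "c \<in> B" "\<alpha> \<in> ?gens (underS l c)"
    then show "g (Inl (Stage c)) \<cdot> G (Some c) \<alpha> = g (Inl \<alpha>)"
      using ge[of "Inl (c, \<alpha>)"] by (auto simp: E_def tgt_def src_def ar_def)
  qed (use y gt in auto)
  have un: "\<exists>!h. h \<in> Hom C y w \<and> (\<forall>\<alpha>\<in>?gens B. h \<cdot> g (Inl \<alpha>) = g' \<alpha>)" if "?cocone B w g'" for w g'
  proof -
    \<comment> \<open>The leg at a domain node is forced to be the cell leg after \<open>i\<close>,
      so cocones on the graph correspond to cocones on the generators.\<close>
    define g2 where "g2 n = (case n of Inl \<alpha> \<Rightarrow> g' \<alpha> | Inr k \<Rightarrow> (case k of Cell c i u v \<Rightarrow> g' k \<cdot> i))"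
      for n :: "('u, 'm) gen + ('u, 'm) gen"
    have w: "w \<in> Obj C" "\<And>\<alpha>. \<alpha> \<in> ?gens B \<Longrightarrow> g' \<alpha> \<in> Hom C (?ob \<alpha>) w"
      "\<And>c \<alpha>. c \<in> B \<Longrightarrow> \<alpha> \<in> ?gens (underS l c) \<Longrightarrow> g' (Stage c) \<cdot> G (Some c) \<alpha> = g' \<alpha>"
      "\<And>c i u v. c \<in> B \<Longrightarrow> (i, u, v) \<in> ?cells c \<Longrightarrow> g' (Cell c i u v) \<cdot> i = g' (Stage c) \<cdot> u"
      using that unfolding cocone_def by blast+
    have "\<exists>!h. h \<in> Hom C y w \<and> (\<forall>n\<in>N. h \<cdot> g n = g2 n)"
    proof (rule univ[OF w(1)])
      fix n assume n: "n \<in> N"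
      show "g2 n \<in> Hom C (ob n) w"
      proof (cases n)
        case (Inl \<alpha>)
        then show ?thesis using n w(2) by (auto simp: N_def g2_def ob_def)
      next
        case (Inr k)
        then have k: "k \<in> K" using n by (auto simp: N_def)
        then obtain c i u v where k': "k = Cell c i u v" "i \<in> I" by (auto simp: K_def cells_def)
        have "g' k \<in> Hom C (Cod C i) w" using w(2)[of k] k KG k' by auto
        then show ?thesis using Inr k' Cmp_in[OF I_Arr] by (auto simp: g2_def ob_def)
      qed
    next
      fix e assume "e \<in> E"
      then show "g2 (tgt e) \<cdot> ar e = g2 (src e)"
        using w(3,4) by (auto simp: E_def K_def g2_def tgt_def src_def ar_def)
    qed
    moreover have "(\<forall>n\<in>N. h \<cdot> g n = g2 n) \<longleftrightarrow> (\<forall>\<alpha>\<in>?gens B. h \<cdot> g (Inl \<alpha>) = g' \<alpha>)"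
      if h: "h \<in> Hom C y w" for h
    proof
      assume H: "\<forall>n\<in>N. h \<cdot> g n = g2 n"
      show "\<forall>\<alpha>\<in>?gens B. h \<cdot> g (Inl \<alpha>) = g' \<alpha>"
      proof
        fix \<alpha> assume "\<alpha> \<in> ?gens B"
        then have "Inl \<alpha> \<in> N" by (auto simp: N_def)
        then show "h \<cdot> g (Inl \<alpha>) = g' \<alpha>" using H by (auto simp: g2_def)
      qed
    next
      assume H: "\<forall>\<alpha>\<in>?gens B. h \<cdot> g (Inl \<alpha>) = g' \<alpha>"
      show "\<forall>n\<in>N. h \<cdot> g n = g2 n"
      proof
        fix n assume n: "n \<in> N"
        show "h \<cdot> g n = g2 n"
        proof (cases n)
          case (Inl \<alpha>)
          then show ?thesis using n H by (auto simp: N_def g2_def)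
        next
          case (Inr k)
          then have k: "k \<in> K" using n by (auto simp: N_def)
          then obtain c i u v where k': "k = Cell c i u v" "i \<in> I" "c \<in> B" "(i, u, v) \<in> ?cells c"
            by (auto simp: K_def cells_def)
          have kN: "Inl k \<in> N" using k KG by (auto simp: N_def)
          have "g (Inl k) \<in> Hom C (Cod C i) y" using g[OF kN] k' by (auto simp: ob_def)
          then have "h \<cdot> g n = (h \<cdot> g (Inl k)) \<cdot> i"
            using assoc[OF I_Arr[OF k'(2)] _ h] gt(1)[OF k'(3,4)] Inr k' by simp
          then show ?thesis using H k KG Inr k' by (auto simp: g2_def)
        qed
      qed
    qed
    ultimately show ?thesis by (simp cong: conj_cong)
  qed
  \<comment> \<open>Each cell carries a commuting square over \<open>x\<close>, so the arrows
    \<open>gval f P\<close> form a cocone; the arrow that it induces is the projection of the new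
    stage.\<close>
  have "?cocone B x (gval f P)" unfolding cocone_def
  proof (intro conjI ballI)
    fix \<alpha> assume "\<alpha> \<in> ?gens B"
    then show "gval f P \<alpha> \<in> Hom C (?ob \<alpha>) x" using f P by (auto simp: gens_def cells_def)
  qed (use x PG in \<open>auto simp: cells_def\<close>)
  then obtain p where "p \<in> Hom C y x" "\<forall>\<alpha>\<in>?gens B. p \<cdot> g (Inl \<alpha>) = gval f P \<alpha>"
    using un by blast
  then have "stage new f x0 x X G P B y (\<lambda>\<alpha>. g (Inl \<alpha>)) p"
    unfolding stage_def using cc un by blast
  then show ?thesis by blast
qed

lemma chain_exists:
  assumes f: "f \<in> Hom C x0 x"
  shows "\<exists>X G P. \<forall>a. stage new f x0 x X G P (below l a) (X a) (G a) (P a)"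
proof -
  \<comment> \<open>Object, legs and projection are packed into one triple, to be chosen
    simultaneously.\<close>
  define Q where "Q F a r = stage new f x0 x (\<lambda>b. fst (F b)) (\<lambda>b. fst (snd (F b))) (\<lambda>b. snd (snd (F b)))
    (below l a) (fst r) (fst (snd r)) (snd (snd r))"
    for F :: "'u option \<Rightarrow> 'o \<times> (('u, 'm) gen \<Rightarrow> 'm) \<times> 'm" and a r
  have "\<exists>F. \<forall>a. Q F a (F a)"
  proof (rule dependent_wf_choice[OF wf_below[OF wo]])
    fix F F' :: "'u option \<Rightarrow> 'o \<times> (('u, 'm) gen \<Rightarrow> 'm) \<times> 'm" and a r
    assume "\<And>z. (z, a) \<in> {(Some c, a) |c a. c \<in> below l a} \<Longrightarrow> F z = F' z"
    then have "F (Some c) = F' (Some c)" if "c \<in> below l a" for c using that by blast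
    then show "Q F a r = Q F' a r" unfolding Q_def
      by (intro stage_cong) (erule (1) below_trans[OF wo], simp)
  next
    fix F :: "'u option \<Rightarrow> 'o \<times> (('u, 'm) gen \<Rightarrow> 'm) \<times> 'm" and a
    assume H: "\<And>y. (y, a) \<in> {(Some c, a) |c a. c \<in> below l a} \<Longrightarrow> Q F y (F y)"
    have "\<exists>y g p. stage new f x0 x (\<lambda>b. fst (F b)) (\<lambda>b. fst (snd (F b))) (\<lambda>b. snd (snd (F b))) (below l a) y g p"
    proof (rule stage_exists[OF f])
      show "small \<kappa> (below l a)" by (rule small_mono[OF l_small]) (auto dest: below_Field)
      show "stage new f x0 x (\<lambda>b. fst (F b)) (\<lambda>b. fst (snd (F b))) (\<lambda>b. snd (snd (F b)))
        (underS l c) (fst (F (Some c))) (fst (snd (F (Some c)))) (snd (snd (F (Some c))))"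
        if "c \<in> below l a" for c
        using H[of "Some c"] that unfolding Q_def by simp
    qed (rule below_trans[OF wo])
    then show "\<exists>r. Q F a r" unfolding Q_def by auto
  qed
  then show ?thesis unfolding Q_def by blast
qed

end

locale cell_chain = small_object_argument C L R \<kappa> l I
  for C :: "('o, 'm, 'z) cat_scheme" (structure) and L R and \<kappa> l :: "'u rel" and I +
  fixes new :: bool and f :: 'm and x0 x :: 'o and X :: "'u option \<Rightarrow> 'o"
    and G :: "'u option \<Rightarrow> ('u, 'm) gen \<Rightarrow> 'm" and P :: "'u option \<Rightarrow> 'm"
  assumes f: "f \<in> Hom C x0 x"
    and stage: "stage new f x0 x X G P (below l a) (X a) (G a) (P a)"
begin

abbreviation Gens where "Gens \<equiv> gens new x X G P"
abbreviation Cells where "Cells \<equiv> cells new x X G P"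
abbreviation Ob where "Ob \<equiv> gob x0 X"
abbreviation Cocone where "Cocone \<equiv> cocone new x0 x X G P"

lemma X_Obj: "X a \<in> Obj C"
  using stage[of a] unfolding stage_def cocone_def by blast

lemma G_Hom: "\<alpha> \<in> Gens (below l a) \<Longrightarrow> G a \<alpha> \<in> Hom C (Ob \<alpha>) (X a)"
  using stage[of a] unfolding stage_def cocone_def by blast

lemma Gens_simps [simp]: "Base \<in> Gens B" "Stage c \<in> Gens B \<longleftrightarrow> c \<in> B"
  "Cell c i u v \<in> Gens B \<longleftrightarrow> c \<in> B \<and> (i, u, v) \<in> Cells c"
  by (auto simp: gens_def)

lemma GensE [consumes 1, case_names Base Stage Cell]:
  assumes "\<alpha> \<in> Gens B"
  obtains "\<alpha> = Base" | c where "\<alpha> = Stage c" "c \<in> B"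
  | c i u v where "\<alpha> = Cell c i u v" "c \<in> B" "(i, u, v) \<in> Cells c"
  using assms by (auto simp: gens_def)

lemma Gens_mono: "A \<subseteq> B \<Longrightarrow> \<alpha> \<in> Gens A \<Longrightarrow> \<alpha> \<in> Gens B"
  by (erule GensE) auto

lemma Base_Hom: "G a Base \<in> Hom C x0 (X a)"
  using G_Hom[of Base] by simp

lemma Stage_Hom: "c \<in> below l a \<Longrightarrow> G a (Stage c) \<in> Hom C (X (Some c)) (X a)"
  using G_Hom[of "Stage c"] by simp

lemma Cell_Hom: "c \<in> below l a \<Longrightarrow> (i, u, v) \<in> Cells c \<Longrightarrow> G a (Cell c i u v) \<in> Hom C (Cod C i) (X a)"
  using G_Hom[of "Cell c i u v"] by simp

lemma Stage_comp: "c \<in> below l a \<Longrightarrow> \<alpha> \<in> Gens (underS l c) \<Longrightarrow> G a (Stage c) \<cdot> G (Some c) \<alpha> = G a \<alpha>"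
  using stage[of a] unfolding stage_def cocone_def by blast

lemma Cell_comp: "c \<in> below l a \<Longrightarrow> (i, u, v) \<in> Cells c \<Longrightarrow> G a (Cell c i u v) \<cdot> i = G a (Stage c) \<cdot> u"
  using stage[of a] unfolding stage_def cocone_def by blast

lemma P_Hom: "P a \<in> Hom C (X a) x"
  using stage[of a] unfolding stage_def by blast

lemma P_G: "\<alpha> \<in> Gens (below l a) \<Longrightarrow> P a \<cdot> G a \<alpha> = gval f P \<alpha>"
  using stage[of a] unfolding stage_def by blast

lemma CellsD:
  assumes "(i, u, v) \<in> Cells c"
  shows "i \<in> I" "i \<in> Hom C (Dom C i) (Cod C i)" "u \<in> Hom C (Dom C i) (X (Some c))"
    "v \<in> Hom C (Cod C i) x" "P (Some c) \<cdot> u = v \<cdot> i"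
  using assms I_Arr by (auto simp: cells_def)

lemma CoconeD:
  assumes "Cocone B w g"
  shows "w \<in> Obj C" "\<alpha> \<in> Gens B \<Longrightarrow> g \<alpha> \<in> Hom C (Ob \<alpha>) w"
    "c \<in> B \<Longrightarrow> \<alpha> \<in> Gens (underS l c) \<Longrightarrow> g (Stage c) \<cdot> G (Some c) \<alpha> = g \<alpha>"
    "c \<in> B \<Longrightarrow> (i, u, v) \<in> Cells c \<Longrightarrow> g (Cell c i u v) \<cdot> i = g (Stage c) \<cdot> u"
  using assms unfolding cocone_def by blast+

section \<open>The universal property of the stages, and recursive construction of maps out of a
  chain\<close>

lemma factor:
  assumes "Cocone (below l a) w g"
  obtains h where "h \<in> Hom C (X a) w" "\<And>\<alpha>. \<alpha> \<in> Gens (below l a) \<Longrightarrow> h \<cdot> G a \<alpha> = g \<alpha>"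
  using stage[of a] assms unfolding stage_def by metis

lemma Cocone_comp:
  assumes "h \<in> Hom C (X a) w"
  shows "Cocone (below l a) w (\<lambda>\<alpha>. h \<cdot> G a \<alpha>)"
  unfolding cocone_def
proof (intro conjI ballI, goal_cases)
  case 1
  then show ?case using Hom_Obj assms by blast
next
  case (2 \<alpha>)
  then show ?case using Cmp_in G_Hom assms by blast
next
  case (3 c \<alpha>)
  have "G (Some c) \<alpha> \<in> Hom C (Ob \<alpha>) (X (Some c))" using G_Hom[of \<alpha> "Some c"] 3 by simp
  then show ?case using assoc[OF _ Stage_Hom[OF 3(1)] assms] Stage_comp[OF 3] by simp
next
  case (4 c k)
  obtain i u v where k: "k = (i, u, v)" by (cases k)
  note c = CellsD[OF 4(2)[unfolded k]]
  show ?case using 4 k assoc[OF c(2) Cell_Hom[OF 4(1)] assms] assoc[OF c(3) Stage_Hom[OF 4(1)] assms]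
    Cell_comp[OF 4(1)] by auto
qed

lemma joint_epi:
  assumes "h \<in> Hom C (X a) w" "h' \<in> Hom C (X a) w"
    "\<And>\<alpha>. \<alpha> \<in> Gens (below l a) \<Longrightarrow> h \<cdot> G a \<alpha> = h' \<cdot> G a \<alpha>"
  shows "h = h'"
proof -
  have "\<exists>!k. k \<in> Hom C (X a) w \<and> (\<forall>\<alpha>\<in>Gens (below l a). k \<cdot> G a \<alpha> = h' \<cdot> G a \<alpha>)"
    using stage[of a] Cocone_comp[OF assms(2)] unfolding stage_def by blast
  then show ?thesis using assms by blast
qed

text \<open>The one recursion behind both constructions of maps. The target is the chain of another
  object in one use and a constant family in the other; \<open>e\<close> says where a cell goes once
  the map \<open>k\<close> on its stage is known. Since \<open>e\<close> is controlled only for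
  those \<open>k\<close> whose composite with \<open>p\<close> is prescribed, the recursion carries
  the prescription \<open>val\<close> along.\<close>

lemma map_out:
  assumes val: "Cocone (Field l) w val"
    and q: "\<And>a. q a \<in> Hom C x0 (Y a)"
    and y: "\<And>a c. c \<in> below l a \<Longrightarrow> y c a \<in> Hom C (Y (Some c)) (Y a)"
      "\<And>a c d. c \<in> below l a \<Longrightarrow> d \<in> underS l c \<Longrightarrow> y c a \<cdot> y d (Some c) = y d a"
      "\<And>a c. c \<in> below l a \<Longrightarrow> y c a \<cdot> q (Some c) = q a"
    and p: "\<And>a. p a \<in> Hom C (Y a) w" "\<And>a. p a \<cdot> q a = val Base"
      "\<And>a c. c \<in> below l a \<Longrightarrow> p a \<cdot> y c a = p (Some c)"
    and e: "\<And>a c i u v k. c \<in> below l a \<Longrightarrow> (i, u, v) \<in> Cells c \<Longrightarrow> k \<in> Hom C (X (Some c)) (Y (Some c)) \<Longrightarrow>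
        p (Some c) \<cdot> k = val (Stage c) \<Longrightarrow>
        e a c i u v k \<in> Hom C (Cod C i) (Y a) \<and> e a c i u v k \<cdot> i = y c a \<cdot> (k \<cdot> u) \<and>
        p a \<cdot> e a c i u v k = val (Cell c i u v)"
      "\<And>a b c i u v k. b \<in> below l a \<Longrightarrow> c \<in> underS l b \<Longrightarrow> (i, u, v) \<in> Cells c \<Longrightarrow>
        k \<in> Hom C (X (Some c)) (Y (Some c)) \<Longrightarrow> p (Some c) \<cdot> k = val (Stage c) \<Longrightarrow>
        y b a \<cdot> e (Some b) c i u v k = e a c i u v k"
  obtains h where "\<And>a. h a \<in> Hom C (X a) (Y a)" "\<And>a. h a \<cdot> G a Base = q a"
    "\<And>a c. c \<in> below l a \<Longrightarrow> h a \<cdot> G a (Stage c) = y c a \<cdot> h (Some c)"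
    "\<And>a c i u v. c \<in> below l a \<Longrightarrow> (i, u, v) \<in> Cells c \<Longrightarrow> h a \<cdot> G a (Cell c i u v) = e a c i u v (h (Some c))"
    "\<And>a \<alpha>. \<alpha> \<in> Gens (below l a) \<Longrightarrow> p a \<cdot> (h a \<cdot> G a \<alpha>) = val \<alpha>"
proof -
  define rs where "rs h a \<alpha> = (case \<alpha> of Base \<Rightarrow> q a | Stage c \<Rightarrow> y c a \<cdot> h (Some c)
     | Cell c i u v \<Rightarrow> e a c i u v (h (Some c)))" for h a \<alpha>
  have rs_simps [simp]: "rs h a Base = q a" "rs h a (Stage c) = y c a \<cdot> h (Some c)"
    "rs h a (Cell c i u v) = e a c i u v (h (Some c))" for h a c i u v
    by (simp_all add: rs_def)
  define Q where "Q h a r \<longleftrightarrow> r \<in> Hom C (X a) (Y a) \<and> (\<forall>\<alpha>\<in>Gens (below l a). r \<cdot> G a \<alpha> = rs h a \<alpha>) \<and>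
    (\<forall>\<alpha>\<in>Gens (below l a). p a \<cdot> (r \<cdot> G a \<alpha>) = val \<alpha>)" for h a r
  have "\<exists>h. \<forall>a. Q h a (h a)"
  proof (rule dependent_wf_choice[OF wf_below[OF wo]])
    fix h h' :: "'u option \<Rightarrow> 'm" and a r
    assume "\<And>z. (z, a) \<in> {(Some c, a) |c a. c \<in> below l a} \<Longrightarrow> h z = h' z"
    then have eq: "h (Some c) = h' (Some c)" if "c \<in> below l a" for c using that by blast
    have "rs h a \<alpha> = rs h' a \<alpha>" if "\<alpha> \<in> Gens (below l a)" for \<alpha>
      using that by (cases rule: GensE) (simp_all add: eq)
    then show "Q h a r = Q h' a r" unfolding Q_def by simp
  next
    fix h :: "'u option \<Rightarrow> 'm" and a
    assume "\<And>z. (z, a) \<in> {(Some c, a) |c a. c \<in> below l a} \<Longrightarrow> Q h z (h z)"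
    then have IH: "Q h (Some c) (h (Some c))" if "c \<in> below l a" for c using that by blast
    have h: "h (Some c) \<in> Hom C (X (Some c)) (Y (Some c))"
      "\<And>\<alpha>. \<alpha> \<in> Gens (underS l c) \<Longrightarrow> h (Some c) \<cdot> G (Some c) \<alpha> = rs h (Some c) \<alpha>"
      "\<And>\<alpha>. \<alpha> \<in> Gens (underS l c) \<Longrightarrow> p (Some c) \<cdot> (h (Some c) \<cdot> G (Some c) \<alpha>) = val \<alpha>" if "c \<in> below l a" for c
      using IH[OF that] unfolding Q_def by auto
    have GS: "G (Some c) \<alpha> \<in> Hom C (Ob \<alpha>) (X (Some c))" if "\<alpha> \<in> Gens (underS l c)" for c \<alpha>
      using G_Hom[of \<alpha> "Some c"] that by simp
    \<comment> \<open>By induction the prescription holds on all generators of stage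
      \<open>c\<close>, hence on the whole stage. This is the side condition for applying
      \<open>e\<close> to \<open>h (Some c)\<close>.\<close>
    have hv: "p (Some c) \<cdot> h (Some c) = val (Stage c)" if c: "c \<in> below l a" for c
    proof (rule joint_epi[OF Cmp_in[OF h(1)[OF c] p(1)]])
      show "val (Stage c) \<in> Hom C (X (Some c)) w"
        using CoconeD(2)[OF val, of "Stage c"] below_Field[OF c] by simp
      fix \<alpha> assume "\<alpha> \<in> Gens (below l (Some c))"
      then have a: "\<alpha> \<in> Gens (underS l c)" by simp
      show "(p (Some c) \<cdot> h (Some c)) \<cdot> G (Some c) \<alpha> = val (Stage c) \<cdot> G (Some c) \<alpha>"
        using assoc[OF GS[OF a] h(1)[OF c] p(1)] h(3)[OF c a] CoconeD(3)[OF val below_Field[OF c] a] by simp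
    qed
    note ee = e(1)[OF _ _ h(1) hv] and ey = e(2)[OF _ _ _ h(1) hv]
    have "Cocone (below l a) (Y a) (rs h a)" unfolding cocone_def
    proof (intro conjI ballI, goal_cases)
      case 1
      then show ?case using Hom_Obj[OF q] by blast
    next
      case (2 \<alpha>)
      then show ?case
        by (cases rule: GensE) (simp_all add: q Cmp_in[OF h(1) y(1)] ee)
    next
      case (3 c \<alpha>)
      note c = 3(1)
      have "rs h a (Stage c) \<cdot> G (Some c) \<alpha> = y c a \<cdot> rs h (Some c) \<alpha>"
        using assoc[OF GS[OF 3(2)] h(1)[OF c] y(1)[OF c]] h(2)[OF c 3(2)] by simp
      also have "\<dots> = rs h a \<alpha>"
        using 3(2)
      proof (cases rule: GensE)
        case (Stage d)
        then have d: "d \<in> below l a" "d \<in> below l (Some c)" using below_trans[OF wo c] by simp_all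
        show ?thesis using Stage assoc[OF h(1)[OF d(1)] y(1)[OF d(2)] y(1)[OF c]] y(2)[OF c] by simp
      next
        case (Cell d i u v)
        then have d: "d \<in> below l a" using below_trans[OF wo c] by simp
        show ?thesis using Cell ey[OF c Cell(2,3) d d] by simp
      qed (use y(3)[OF c] in simp)
      finally show ?case .
    next
      case (4 c k)
      obtain i u v where k: "k = (i, u, v)" by (cases k)
      note c = CellsD[OF 4(2)[unfolded k]]
      show ?case
        using k ee[OF 4(1) 4(2)[unfolded k] 4(1) 4(1)] assoc[OF c(3) h(1)[OF 4(1)] y(1)[OF 4(1)]] by simp
    qed
    then obtain r where r: "r \<in> Hom C (X a) (Y a)" "\<And>\<alpha>. \<alpha> \<in> Gens (below l a) \<Longrightarrow> r \<cdot> G a \<alpha> = rs h a \<alpha>"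
      by (rule factor) blast
    have "p a \<cdot> rs h a \<alpha> = val \<alpha>" if "\<alpha> \<in> Gens (below l a)" for \<alpha>
      using that
    proof (cases rule: GensE)
      case (Stage c)
      have "p a \<cdot> (y c a \<cdot> h (Some c)) = (p a \<cdot> y c a) \<cdot> h (Some c)"
        using assoc[OF h(1)[OF Stage(2)] y(1)[OF Stage(2)] p(1)] by simp
      then show ?thesis using Stage p(3)[OF Stage(2)] hv[OF Stage(2)] by simp
    next
      case (Cell c i u v)
      then show ?thesis using ee by simp
    qed (simp add: p(2))
    then show "\<exists>r. Q h a r" unfolding Q_def using r by auto
  qed
  then obtain h where "\<And>a. Q h a (h a)" by blast
  then show thesis unfolding Q_def by (intro that) auto
qed

text \<open>\<open>Stage b\<close> is not a generator of stage \<open>b\<close> itself, so the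
  diagonal is filled in with identities.\<close>

definition chain_functor :: "('u, 'u \<times> 'u, 'o, 'm) functor_data" where
  "chain_functor = \<lparr>on_obj = (\<lambda>b. X (Some b)),
     on_arr = (\<lambda>(c, b). if c = b then Idt C (X (Some b)) else G (Some b) (Stage c))\<rparr>"

lemma chain_simps [simp]:
  "on_obj chain_functor b = X (Some b)"
  "on_arr chain_functor (b, b) = Idt C (X (Some b))"
  "c \<noteq> b \<Longrightarrow> on_arr chain_functor (c, b) = G (Some b) (Stage c)"
  by (simp_all add: chain_functor_def)

lemma Stage_Stage: "c \<in> below l a \<Longrightarrow> d \<in> underS l c \<Longrightarrow> G a (Stage c) \<cdot> G (Some c) (Stage d) = G a (Stage d)"
  using Stage_comp[of c a "Stage d"] by simp

lemma chain_Hom: "(c, b) \<in> l \<Longrightarrow> on_arr chain_functor (c, b) \<in> Hom C (X (Some c)) (X (Some b))"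
  using Idt_in[OF X_Obj] Stage_Hom[of c "Some b"] by (cases "c = b") (auto simp: underS_def)

lemma chain_functor: "cat_functor (ord_cat l) C chain_functor"
proof -
  note w = Well_order_facts[OF wo]
  have H: "Hom (ord_cat l) b c = (if (b, c) \<in> l then {(b, c)} else {})" for b c
    by (auto simp: Hom_def ord_cat_def)
  have O: "Obj (ord_cat l) = Field l" "Arr (ord_cat l) = l" "Dom (ord_cat l) = fst" "Cod (ord_cat l) = snd"
    "Idt (ord_cat l) b = (b, b)" "Cmp (ord_cat l) g k = (fst k, snd g)" for b g k
    by (simp_all add: ord_cat_def)
  show ?thesis
  proof (intro cat_functor.intro category_axioms cat_functor_axioms.intro, goal_cases)
    case 1
    show ?case
    proof (unfold_locales, goal_cases)
      case (3 b)
      then show ?case using w(1) by (auto simp: H O refl_on_def)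
    next
      case (4 f b c g d)
      then show ?case using w(2) by (auto simp: H O split: if_splits dest: transD)
    qed (auto simp: H O Field_def split: if_splits)
  next
    case (2 b)
    then show ?case by (simp add: X_Obj)
  next
    case (3 f b c)
    then show ?case using chain_Hom by (simp add: H split: if_splits)
  next
    case (4 b)
    then show ?case by (simp add: O)
  next
    case (5 f b c g d)
    then have bcd: "(b, c) \<in> l" "(c, d) \<in> l" "f = (b, c)" "g = (c, d)" by (auto simp: H split: if_splits)
    have "on_arr chain_functor (b, d) = on_arr chain_functor (c, d) \<cdot> on_arr chain_functor (b, c)"
    proof (cases "b = c \<or> c = d")
      case True
      then show ?thesis using Idt_left[OF chain_Hom[OF bcd(1)]] Idt_right[OF chain_Hom[OF bcd(2)]] by auto
    next
      case False
      then have "b \<noteq> d" using bcd w(3) by (auto dest: antisymD)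
      then show ?thesis using False bcd Stage_Stage[of c "Some d" b] by (auto simp: underS_def)
    qed
    then show ?case using bcd by (simp add: O)
  qed
qed

text \<open>Without a largest earlier index, every generator is already present at an earlier stage.
  So no cell is added here, and universality over the generators becomes universality over the
  stages.\<close>

lemma limit_colimit:
  assumes ne: "below l a \<noteq> {}" and lim: "\<And>c. c \<in> below l a \<Longrightarrow> \<exists>d\<in>below l a. c \<in> underS l d"
  shows "is_colimit (ord_cat (Restr l (below l a))) C chain_functor (X a) (\<lambda>b. G a (Stage b))"
proof -
  note w = Well_order_facts[OF wo]
  let ?s = "Restr l (below l a)"
  have F: "Field ?s = below l a"
  proof (cases a)
    case None
    then show ?thesis by (auto simp: Field_def)
  next
    case (Some b)
    then show ?thesis using Field_Restr_underS[OF w(1)] by simp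
  qed
  have Ob: "Obj (ord_cat ?s) = below l a" by (simp add: ord_cat_def F)
  have cc: "is_cocone (ord_cat ?s) C chain_functor z s \<longleftrightarrow> z \<in> Obj C \<and>
    (\<forall>b\<in>below l a. s b \<in> Hom C (X (Some b)) z) \<and>
    (\<forall>c\<in>below l a. \<forall>b\<in>underS l c. s c \<cdot> G (Some c) (Stage b) = s b)" for z s
    unfolding is_cocone_ord_cat F
  proof (intro iffI conjI; elim conjE)
    assume H: "\<forall>b c. (b, c) \<in> ?s \<longrightarrow> s c \<cdot> on_arr chain_functor (b, c) = s b"
    show "\<forall>c\<in>below l a. \<forall>b\<in>underS l c. s c \<cdot> G (Some c) (Stage b) = s b"
    proof (intro ballI)
      fix c b assume cb: "c \<in> below l a" "b \<in> underS l c"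
      then have "(b, c) \<in> ?s" "b \<noteq> c" using below_trans[OF wo cb] by (auto simp: underS_def)
      then show "s c \<cdot> G (Some c) (Stage b) = s b" using H by (metis chain_simps(3))
    qed
  next
    assume H: "\<forall>b\<in>below l a. s b \<in> Hom C (X (Some b)) z"
      "\<forall>c\<in>below l a. \<forall>b\<in>underS l c. s c \<cdot> G (Some c) (Stage b) = s b"
    show "\<forall>b c. (b, c) \<in> ?s \<longrightarrow> s c \<cdot> on_arr chain_functor (b, c) = s b"
    proof (intro allI impI)
      fix b c assume bc: "(b, c) \<in> ?s"
      then show "s c \<cdot> on_arr chain_functor (b, c) = s b"
        using H Idt_right by (cases "b = c") (auto simp: underS_def)
    qed
  qed simp_all
  show ?thesis unfolding is_colimit_def
  proof (intro conjI allI impI)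
    show "is_cocone (ord_cat ?s) C chain_functor (X a) (\<lambda>b. G a (Stage b))"
      unfolding cc using X_Obj Stage_Hom Stage_Stage by blast
  next
    fix z s assume "is_cocone (ord_cat ?s) C chain_functor z s"
    then have z: "z \<in> Obj C" and s: "\<And>b. b \<in> below l a \<Longrightarrow> s b \<in> Hom C (X (Some b)) z"
      and sG: "\<And>b c. c \<in> below l a \<Longrightarrow> b \<in> underS l c \<Longrightarrow> s c \<cdot> G (Some c) (Stage b) = s b"
      unfolding cc by blast+
    \<comment> \<open>A stage in which the generator is already present; by \<open>gd\<close> the
      leg built from it is independent of the choice.\<close>
    define D where "D \<alpha> = (SOME d. d \<in> below l a \<and> \<alpha> \<in> Gens (underS l d))" for \<alpha>
    have D: "D \<alpha> \<in> below l a" "\<alpha> \<in> Gens (underS l (D \<alpha>))" if "\<alpha> \<in> Gens (below l a)" for \<alpha>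
    proof -
      have "\<exists>d. d \<in> below l a \<and> \<alpha> \<in> Gens (underS l d)"
        using that
      proof (cases rule: GensE)
        case Base
        then show ?thesis using ne by auto
      qed (use lim in auto)
      then show "D \<alpha> \<in> below l a" "\<alpha> \<in> Gens (underS l (D \<alpha>))"
        unfolding D_def by (metis (mono_tags, lifting) someI_ex)+
    qed
    define g where "g \<alpha> = s (D \<alpha>) \<cdot> G (Some (D \<alpha>)) \<alpha>" for \<alpha>
    have GS: "G (Some c) \<alpha> \<in> Hom C (Ob \<alpha>) (X (Some c))" if "\<alpha> \<in> Gens (underS l c)" for c \<alpha>
      using G_Hom[of \<alpha> "Some c"] that by simp
    have indep1: "s d \<cdot> G (Some d) \<alpha> = s e \<cdot> G (Some e) \<alpha>"
      if "d \<in> underS l e" "e \<in> below l a" "\<alpha> \<in> Gens (underS l d)" for d e \<alpha>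
    proof -
      have "s d \<cdot> G (Some d) \<alpha> = (s e \<cdot> G (Some e) (Stage d)) \<cdot> G (Some d) \<alpha>" using sG that by simp
      then show ?thesis
        using assoc[OF GS[OF that(3)] Stage_Hom[of d "Some e"] s[OF that(2)]] that Stage_comp[of d "Some e"] by simp
    qed
    have gd: "g \<alpha> = s d \<cdot> G (Some d) \<alpha>" if "d \<in> below l a" "\<alpha> \<in> Gens (underS l d)" for d \<alpha>
    proof -
      have "\<alpha> \<in> Gens (below l a)" using Gens_mono[OF _ that(2)] below_trans[OF wo that(1)] by blast
      note D = D[OF this]
      show ?thesis using underS_linear[OF wo below_Field[OF D(1)] below_Field[OF that(1)]] indep1 D that
        unfolding g_def by metis
    qed
    have gS: "g (Stage c) = s c" if "c \<in> below l a" for c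
    proof -
      obtain d where "d \<in> below l a" "c \<in> underS l d" using lim[OF \<open>c \<in> below l a\<close>] by blast
      then show ?thesis using gd[of d "Stage c"] sG by simp
    qed
    have "Cocone (below l a) z g" unfolding cocone_def
    proof (intro conjI ballI, goal_cases)
      case 1
      then show ?case by (rule z)
    next
      case (2 \<alpha>)
      then show ?case unfolding g_def using Cmp_in[OF GS s] D by blast
    next
      case (3 c \<alpha>)
      then show ?case using gS gd by simp
    next
      case (4 c k)
      obtain i u v where k: "k = (i, u, v)" by (cases k)
      have c: "(i, u, v) \<in> Cells c" using 4 k by simp
      obtain d where d: "d \<in> below l a" "c \<in> underS l d" using lim 4 by blast
      note cd = CellsD[OF c]
      have "g (Cell c i u v) \<cdot> i = s d \<cdot> (G (Some d) (Stage c) \<cdot> u)"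
        using gd[of d "Cell c i u v"] d c assoc[OF cd(2) Cell_Hom[OF _ c, of "Some d"] s[OF d(1)]]
          Cell_comp[OF _ c, of "Some d"] by simp
      also have "\<dots> = s c \<cdot> u" using assoc[OF cd(3) Stage_Hom[of c "Some d"] s[OF d(1)]] sG d by simp
      finally show ?case using k gS 4 by simp
    qed
    then obtain h where h: "h \<in> Hom C (X a) z" "\<And>\<alpha>. \<alpha> \<in> Gens (below l a) \<Longrightarrow> h \<cdot> G a \<alpha> = g \<alpha>"
      by (rule factor) blast
    show "\<exists>!h. h \<in> Hom C (X a) z \<and> (\<forall>j\<in>Obj (ord_cat ?s). h \<cdot> G a (Stage j) = s j)" unfolding Ob
    proof (rule ex1I[of _ h])
      show "h \<in> Hom C (X a) z \<and> (\<forall>j\<in>below l a. h \<cdot> G a (Stage j) = s j)" using h gS by simp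
    next
      fix k assume k: "k \<in> Hom C (X a) z \<and> (\<forall>j\<in>below l a. k \<cdot> G a (Stage j) = s j)"
      show "k = h"
      proof (rule joint_epi)
        fix \<alpha> assume \<alpha>: "\<alpha> \<in> Gens (below l a)"
        note D = D[OF \<alpha>]
        have "k \<cdot> G a \<alpha> = g \<alpha>"
          unfolding g_def using assoc[OF GS[OF D(2)] Stage_Hom[OF D(1)]] k Stage_comp[OF D] D(1) by metis
        then show "k \<cdot> G a \<alpha> = h \<cdot> G a \<alpha>" using h(2)[OF \<alpha>] by simp
      qed (use k h in auto)
    qed
  qed
qed

text \<open>At a successor the only generators that stage \<open>b\<close> lacks are
  \<open>Stage b\<close> and the cells attached to it. A lift is therefore assembled from
  \<open>U\<close> and one lift per cell; testing membership in \<open>L\<close> by lifting avoids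
  presenting the step as a pushout of a coproduct of generators.\<close>

lemma successor_L:
  assumes "is_successor_of l c b"
  shows "G (Some c) (Stage b) \<in> L"
proof -
  note w = Well_order_facts[OF wo]
  have un: "underS l c = insert b (underS l b)"
    using assms w(1) by (auto simp: is_successor_of_def under_def underS_def refl_on_def)
  have bc: "b \<in> below l (Some c)" using un by simp
  note Gb = Stage_Hom[OF bc]
  have GS: "G (Some b) \<alpha> \<in> Hom C (Ob \<alpha>) (X (Some b))" if "\<alpha> \<in> Gens (underS l b)" for \<alpha>
    using G_Hom[of \<alpha> "Some b"] that by simp
  show ?thesis
  proof (rule L_if_lifting)
    show "G (Some c) (Stage b) \<in> Arr C" using Gb by (rule Hom_in_Arr)
    fix p assume p: "p \<in> R"
    have pH: "p \<in> Hom C (Dom C p) (Cod C p)" using p by (rule R_Hom)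
    show "has_lifting C (G (Some c) (Stage b)) p"
    proof (rule has_liftingI[OF Gb pH])
      fix U V assume U: "U \<in> Hom C (X (Some b)) (Dom C p)" and V: "V \<in> Hom C (X (Some c)) (Cod C p)"
        and sq: "p \<cdot> U = V \<cdot> G (Some c) (Stage b)"
      define K where "K i u v = (SOME k. k \<in> Hom C (Cod C i) (Dom C p) \<and> k \<cdot> i = U \<cdot> u \<and>
          p \<cdot> k = V \<cdot> G (Some c) (Cell b i u v))" for i u v
      have K: "K i u v \<in> Hom C (Cod C i) (Dom C p) \<and> K i u v \<cdot> i = U \<cdot> u \<and>
          p \<cdot> K i u v = V \<cdot> G (Some c) (Cell b i u v)" if iuv: "(i, u, v) \<in> Cells b" for i u v
      proof -
        note cd = CellsD[OF iuv]
        have "p \<cdot> (U \<cdot> u) = (V \<cdot> G (Some c) (Cell b i u v)) \<cdot> i"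
          using assoc[OF cd(3) U pH] sq assoc[OF cd(3) Gb V] Cell_comp[OF bc iuv] assoc[OF cd(2) Cell_Hom[OF bc iuv] V]
          by simp
        then have "\<exists>k. k \<in> Hom C (Cod C i) (Dom C p) \<and> k \<cdot> i = U \<cdot> u \<and> p \<cdot> k = V \<cdot> G (Some c) (Cell b i u v)"
          using has_liftingD[OF lifting[of i p] cd(2) pH Cmp_in[OF cd(3) U] Cmp_in[OF Cell_Hom[OF bc iuv] V]]
            cd(1) I_L p by blast
        then show ?thesis unfolding K_def by (rule someI_ex)
      qed
      \<comment> \<open>Old generators are mapped through \<open>U\<close>; only cells attached at
        \<open>b\<close> itself involve the chosen lifts. The default is never met on generators
        below \<open>c\<close>.\<close>
      define g where "g \<alpha> = (if \<alpha> \<in> Gens (underS l b) then U \<cdot> G (Some b) \<alpha> else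
        case \<alpha> of Stage _ \<Rightarrow> U | Cell _ i u v \<Rightarrow> K i u v | _ \<Rightarrow> undefined)" for \<alpha>
      have bb: "b \<notin> underS l b" by (simp add: underS_def)
      have g1: "g \<alpha> = U \<cdot> G (Some b) \<alpha>" if "\<alpha> \<in> Gens (underS l b)" for \<alpha> using that by (simp add: g_def)
      have g2: "g (Stage b) = U" "g (Cell b i u v) = K i u v" for i u v using bb by (simp_all add: g_def)
      note CU = Cocone_comp[OF U, simplified]
      have split: "\<alpha> \<in> Gens (underS l b) \<or> \<alpha> = Stage b \<or> (\<exists>i u v. \<alpha> = Cell b i u v \<and> (i, u, v) \<in> Cells b)"
        if "\<alpha> \<in> Gens (underS l c)" for \<alpha>
        using that by (cases rule: GensE) (auto simp: un)
      have "Cocone (below l (Some c)) (Dom C p) g" unfolding cocone_def below_simps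
      proof (intro conjI ballI, goal_cases)
        case 1
        then show ?case using Hom_Obj[OF pH] by blast
      next
        case (2 \<alpha>)
        from split[OF 2] show ?case
        proof (elim disjE exE conjE)
          assume "\<alpha> \<in> Gens (underS l b)"
          then show ?thesis using CoconeD(2)[OF CU] g1 by simp
        qed (simp_all add: g2 U K)
      next
        case (3 d \<alpha>)
        then consider "d = b" | "d \<in> underS l b" unfolding un by blast
        then show ?case
        proof cases
          case 1
          then show ?thesis using 3 g1 g2 by simp
        next
          case 2
          then have "\<alpha> \<in> Gens (underS l b)" using Gens_mono[OF _ 3(2)] underS_trans[OF wo _ 2] by blast
          then show ?thesis using CoconeD(3)[OF CU 2 3(2)] g1 2 by simp
        qed
      next
        case (4 d k)
        obtain i u v where k: "k = (i, u, v)" by (cases k)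
        from 4 consider "d = b" | "d \<in> underS l b" unfolding un by blast
        then show ?case
        proof cases
          case 1
          then show ?thesis using 4 k g2 K by simp
        next
          case 2
          then show ?thesis using CoconeD(4)[OF CU 2] g1 4 k by simp
        qed
      qed
      then obtain h where h: "h \<in> Hom C (X (Some c)) (Dom C p)"
        "\<And>\<alpha>. \<alpha> \<in> Gens (underS l c) \<Longrightarrow> h \<cdot> G (Some c) \<alpha> = g \<alpha>"
        by (rule factor) simp
      have "p \<cdot> h = V"
      proof (rule joint_epi[OF Cmp_in[OF h(1) pH] V])
        fix \<alpha> assume "\<alpha> \<in> Gens (below l (Some c))"
        then have \<alpha>: "\<alpha> \<in> Gens (underS l c)" by simp
        have "p \<cdot> g \<alpha> = V \<cdot> G (Some c) \<alpha>"
        proof (cases "\<alpha> \<in> Gens (underS l b)")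
          case True
          then show ?thesis
            using g1 assoc[OF GS[OF True] U pH] sq assoc[OF GS[OF True] Gb V] Stage_comp[OF bc True] by simp
        next
          case False
          then show ?thesis using split[OF \<alpha>] g2 sq K by auto
        qed
        then show "(p \<cdot> h) \<cdot> G (Some c) \<alpha> = V \<cdot> G (Some c) \<alpha>"
          using assoc[OF G_Hom[of \<alpha> "Some c"] h(1) pH] h(2)[OF \<alpha>] \<alpha> by simp
      qed
      then show "\<exists>h\<in>Hom C (X (Some c)) (Dom C p). h \<cdot> G (Some c) (Stage b) = U \<and> p \<cdot> h = V"
        using h(1) h(2)[of "Stage b"] g2 un by auto
    qed
  qed
qed

end

section \<open>The two factors of \<open>f\<close>: base leg in \<open>L\<close>, projection in
  \<open>R\<close>\<close>

context cell_chain
begin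

lemma Field_l: "infinite (Field l)" "Card_order l" "Field l \<noteq> {}"
  using regular unfolding regular_ordinal_def by auto

lemma no_max: "c \<in> Field l \<Longrightarrow> \<exists>d\<in>Field l. c \<in> underS l d"
  using infinite_Card_order_limit[OF Field_l(2,1), of c] by (auto simp: underS_def)

lemma top_colimit: "is_colimit (ord_cat l) C chain_functor (X None) (\<lambda>b. G None (Stage b))"
proof -
  have "Restr l (Field l) = l" by (auto simp: Field_def)
  then show ?thesis using limit_colimit[of None] Field_l(3) no_max by simp
qed

lemma chain_sequence: "is_sequence C L l chain_functor"
  unfolding is_sequence_def
proof (intro conjI allI impI wo Field_l(3) chain_functor)
  fix b c assume s: "is_successor_of l c b"
  then have "b \<noteq> c"
    using Well_order_facts(1)[OF wo] by (auto simp: is_successor_of_def under_def underS_def refl_on_def)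
  then show "on_arr chain_functor (b, c) \<in> L" using successor_L[OF s] by simp
next
  fix c assume c: "is_limit_elem l c"
  have cF: "c \<in> Field l" and ne: "underS l c \<noteq> {}" and ns: "\<And>b. \<not> is_successor_of l c b"
    using c unfolding is_limit_elem_def by blast+
  \<comment> \<open>A limit element has no greatest predecessor, since it would be the successor of
    that predecessor.\<close>
  have "\<exists>d\<in>underS l c. b \<in> underS l d" if b: "b \<in> underS l c" for b
  proof (rule ccontr)
    assume H: "\<not> ?thesis"
    have bF: "b \<in> Field l" using b by (auto simp: underS_def Field_def)
    have "d \<in> under l b" if d: "d \<in> underS l c" for d
    proof -
      have "d \<in> Field l" using d by (auto simp: underS_def Field_def)
      then show ?thesis using Well_order_underS_mem[OF wo bF] H d by (auto simp: under_def)
    qed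
    moreover have "d \<in> underS l c" if "d \<in> under l b" for d
    proof (cases "d = b")
      case False
      then have "d \<in> underS l b" using that by (simp add: under_def underS_def)
      then show ?thesis using underS_trans[OF wo _ b] by simp
    qed (simp add: b)
    ultimately have "is_successor_of l c b" using cF bF unfolding is_successor_of_def by blast
    then show False using ns by blast
  qed
  then have "is_colimit (ord_cat (Restr l (underS l c))) C chain_functor (X (Some c)) (\<lambda>b. G (Some c) (Stage b))"
    using limit_colimit[of "Some c"] ne by simp
  moreover have "on_arr chain_functor (b, c) = G (Some c) (Stage b)" if "b \<in> underS l c" for b
    using that by (auto simp: underS_def)
  moreover have "Field (Restr l (underS l c)) = underS l c"
    by (rule Field_Restr_underS[OF Well_order_facts(1)[OF wo]])
  ultimately show "is_colimit (ord_cat (Restr l (underS l c))) C chain_functor (on_obj chain_functor c)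
    (\<lambda>b. on_arr chain_functor (b, c))"
    unfolding is_colimit_def is_cocone_ord_cat by (simp add: ord_cat_def)
qed

lemma Stage_L:
  assumes "b \<in> Field l"
  shows "G None (Stage b) \<in> L"
proof (rule L_if_lifting)
  show "G None (Stage b) \<in> Arr C" using Hom_in_Arr[OF Stage_Hom[of b None]] assms by simp
  fix p assume "p \<in> R"
  then show "has_lifting C (G None (Stage b)) p"
    using sequence_lifting[OF chain_sequence top_colimit _ _ assms] lifting Hom_in_Arr[OF R_Hom] by blast
qed

lemma small_factor:
  assumes "i \<in> I" "u \<in> Hom C (Dom C i) (X None)"
  shows "\<exists>b\<in>Field l. \<exists>u'\<in>Hom C (Dom C i) (X (Some b)). u = G None (Stage b) \<cdot> u'"
proof -
  \<comment> \<open>The ordinal of the smallness condition is itself the length of the chain, so the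
    bound on lengths holds trivially.\<close>
  have "l \<le>o l" using wo ordLeq_reflexive by blast
  then show ?thesis
    using dom_small[OF assms(1)] chain_sequence top_colimit regular l_small assms(2)
    unfolding small_object_rel_def by (metis chain_simps(1))
qed

text \<open>Choosing the least stage makes the square a cell even if only new squares get attached.\<close>

lemma new_cell:
  assumes i: "i \<in> I" and u: "u \<in> Hom C (Dom C i) (X None)" and v: "v \<in> Hom C (Cod C i) x"
    and sq: "P None \<cdot> u = v \<cdot> i"
  obtains b u' where "b \<in> Field l" "(i, u', v) \<in> Cells b" "u = G None (Stage b) \<cdot> u'"
proof -
  define A where "A = {b \<in> Field l. \<exists>u'\<in>Hom C (Dom C i) (X (Some b)). u = G None (Stage b) \<cdot> u'}"
  have "A \<noteq> {}" using small_factor[OF i u] unfolding A_def by blast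
  then obtain b where b: "b \<in> A" "\<And>d. (d, b) \<in> l - Id \<Longrightarrow> d \<notin> A"
    using Well_order_facts(4)[OF wo] unfolding wf_eq_minimal by (metis ex_in_conv)
  then obtain u' where bF: "b \<in> below l None" and u': "u' \<in> Hom C (Dom C i) (X (Some b))" "u = G None (Stage b) \<cdot> u'"
    unfolding A_def by auto
  have "P (Some b) \<cdot> u' = v \<cdot> i"
    using assoc[OF u'(1) Stage_Hom[OF bF] P_Hom] P_G[of "Stage b" None] bF sq u' by simp
  moreover have False if d: "d \<in> underS l b" and w: "w \<in> Hom C (Dom C i) (X (Some d))"
    and e: "u' = G (Some b) (Stage d) \<cdot> w" for d w
  proof -
    have "d \<in> Field l" using d by (auto simp: underS_def Field_def)
    moreover have "u = G None (Stage d) \<cdot> w"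
      using assoc[OF w Stage_Hom[of d "Some b"] Stage_Hom[OF bF]] d e u' Stage_Stage[OF bF d] by simp
    ultimately have "d \<in> A" unfolding A_def using w by blast
    then show False using b(2)[of d] d by (auto simp: underS_def)
  qed
  ultimately have "(i, u', v) \<in> Cells b" unfolding cells_def using i u' v by blast
  then show thesis using that bF u' by simp
qed

text \<open>A square from a generator into the projection descends to a stage, where it is one of
  the attached cells; the leg of that cell in the colimit is the lift. The rest of \<open>L\<close>
  consists of retracts of cell complexes.\<close>

lemma P_R: "P None \<in> R"
proof (rule R_if_lifting)
  show "P None \<in> Arr C" using Hom_in_Arr[OF P_Hom] .
  fix j assume j: "j \<in> L"
  have "has_lifting C i (P None)" if i: "i \<in> I" for i
  proof (rule has_liftingI[OF I_Arr[OF i] P_Hom])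
    fix u v assume u: "u \<in> Hom C (Dom C i) (X None)" and v: "v \<in> Hom C (Cod C i) x" "P None \<cdot> u = v \<cdot> i"
    obtain b u' where b: "b \<in> below l None" "(i, u', v) \<in> Cells b" "u = G None (Stage b) \<cdot> u'"
      using new_cell[OF i u v] by auto
    show "\<exists>h\<in>Hom C (Cod C i) (X None). h \<cdot> i = u \<and> P None \<cdot> h = v"
      using b Cell_Hom[OF b(1,2)] Cell_comp[OF b(1,2)] P_G[of "Cell b i u' v" None] by auto
  qed
  then show "has_lifting C j (P None)"
    using has_lifting_retracts_cell[of j \<kappa> I "P None"] j L_cell Hom_in_Arr[OF P_Hom] by blast
qed

text \<open>The least stage has \<open>Base\<close> as its only generator, so its base leg behaves
  like an isomorphism and lifts against everything. Composing with \<open>Stage_L\<close> leads to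
  the top.\<close>

lemma Base_L: "G None Base \<in> L"
proof (rule L_if_lifting)
  show "G None Base \<in> Arr C" using Hom_in_Arr[OF Base_Hom] .
  fix p assume p: "p \<in> R"
  note pH = R_Hom[OF p]
  obtain b where b: "b \<in> Field l" "\<And>d. (d, b) \<in> l - Id \<Longrightarrow> d \<notin> Field l"
    using Well_order_facts(4)[OF wo] Field_l(3) unfolding wf_eq_minimal by (metis ex_in_conv)
  then have bot: "underS l b = {}" by (auto simp: underS_def Field_def)
  have GB: "\<alpha> = Base" if "\<alpha> \<in> Gens (below l (Some b))" for \<alpha>
    using that by (cases rule: GensE) (auto simp: bot)
  have OB: "Ob \<alpha> = x0" if "\<alpha> \<in> Gens {}" for \<alpha>
    using GB[of \<alpha>] that bot by simp
  have "has_lifting C (G (Some b) Base) p"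
  proof (rule has_liftingI[OF Base_Hom pH])
    fix u v assume u: "u \<in> Hom C x0 (Dom C p)" and v: "v \<in> Hom C (X (Some b)) (Cod C p)"
      and sq: "p \<cdot> u = v \<cdot> G (Some b) Base"
    have "Cocone (below l (Some b)) (Dom C p) (\<lambda>_. u)"
      unfolding cocone_def using OB Hom_Obj[OF pH] u by (auto simp: bot)
    then obtain h where h: "h \<in> Hom C (X (Some b)) (Dom C p)" "h \<cdot> G (Some b) Base = u"
      by (rule factor) simp
    have "p \<cdot> h = v"
    proof (rule joint_epi[OF Cmp_in[OF h(1) pH] v])
      fix \<alpha> assume "\<alpha> \<in> Gens (below l (Some b))"
      then show "(p \<cdot> h) \<cdot> G (Some b) \<alpha> = v \<cdot> G (Some b) \<alpha>"
        using GB[of \<alpha>] assoc[OF Base_Hom h(1) pH] h(2) sq by simp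
    qed
    then show "\<exists>h\<in>Hom C (X (Some b)) (Dom C p). h \<cdot> G (Some b) Base = u \<and> p \<cdot> h = v" using h by blast
  qed
  moreover have bb: "b \<in> below l None" using b by simp
  ultimately have "has_lifting C (G None (Stage b) \<cdot> G (Some b) Base) p"
    using has_lifting_comp[OF Base_Hom Stage_Hom[OF bb] Hom_in_Arr[OF pH]] lifting[OF Stage_L[OF b(1)] p] by blast
  then show "has_lifting C (G None Base) p" using Stage_comp[OF bb, of Base] by simp
qed

end

section \<open>Comonads from cofree objects, and the cofibrantly generated case\<close>

context category
begin

text \<open>\<open>A\<close> plays the maps of a category of structured objects in which each
  \<open>S y\<close> is cofree on \<open>y\<close>: composing with \<open>\<epsilon> y\<close> is a
  bijection from \<open>A x y\<close> onto the arrows \<open>S x\<close> to \<open>y\<close>. This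
  is the coextension form of a comonad, where the functor coextends \<open>f\<close> after the
  counit and \<open>\<Delta>\<close> coextends identities.\<close>

lemma cotriple_if_cofree:
  assumes eps: "\<And>x. x \<in> Obj C \<Longrightarrow> \<epsilon> x \<in> Hom C (S x) x"
    and A_Hom: "\<And>x y h. x \<in> Obj C \<Longrightarrow> y \<in> Obj C \<Longrightarrow> h \<in> A x y \<Longrightarrow> h \<in> Hom C (S x) (S y)"
    and A_id: "\<And>x. x \<in> Obj C \<Longrightarrow> Idt C (S x) \<in> A x x"
    and A_comp: "\<And>x y z h k. x \<in> Obj C \<Longrightarrow> y \<in> Obj C \<Longrightarrow> z \<in> Obj C \<Longrightarrow>
      h \<in> A x y \<Longrightarrow> k \<in> A y z \<Longrightarrow> k \<cdot> h \<in> A x z"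
    and A_ex: "\<And>x y g. x \<in> Obj C \<Longrightarrow> y \<in> Obj C \<Longrightarrow> g \<in> Hom C (S x) y \<Longrightarrow> \<exists>h\<in>A x y. \<epsilon> y \<cdot> h = g"
    and A_unique: "\<And>x y h k. x \<in> Obj C \<Longrightarrow> y \<in> Obj C \<Longrightarrow> h \<in> A x y \<Longrightarrow> k \<in> A x y \<Longrightarrow>
      \<epsilon> y \<cdot> h = \<epsilon> y \<cdot> k \<Longrightarrow> h = k"
  shows "\<exists>F \<Delta>. on_obj F = S \<and> cotriple C F \<epsilon> \<Delta>"
proof -
  define ext where "ext x y g = (SOME h. h \<in> A x y \<and> \<epsilon> y \<cdot> h = g)" for x y g
  have ext: "ext x y g \<in> A x y" "\<epsilon> y \<cdot> ext x y g = g"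
    if "x \<in> Obj C" "y \<in> Obj C" "g \<in> Hom C (S x) y" for x y g
    using someI_ex[of "\<lambda>h. h \<in> A x y \<and> \<epsilon> y \<cdot> h = g"] A_ex[OF that] unfolding ext_def by blast+
  define F where "F = \<lparr>on_obj = S, on_arr = (\<lambda>f. ext (Dom C f) (Cod C f) (f \<cdot> \<epsilon> (Dom C f)))\<rparr>"
  define \<Delta> where "\<Delta> x = ext x (S x) (Idt C (S x))" for x
  have SO: "S x \<in> Obj C" if "x \<in> Obj C" for x using Hom_Obj[OF eps[OF that]] by blast
  have Fo [simp]: "on_obj F = S" by (simp add: F_def)
  have F: "on_arr F f \<in> A x y" "\<epsilon> y \<cdot> on_arr F f = f \<cdot> \<epsilon> x" if f: "f \<in> Hom C x y" for f x y
    using ext[OF _ _ Cmp_in[OF eps f]] Hom_Obj[OF f] f by (auto simp: F_def Hom_Dom[OF f] Hom_Cod[OF f])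
  have FH: "on_arr F f \<in> Hom C (S x) (S y)" if f: "f \<in> Hom C x y" for f x y
    using F(1)[OF f] A_Hom Hom_Obj[OF f] by blast
  have D: "\<Delta> x \<in> A x (S x)" "\<epsilon> (S x) \<cdot> \<Delta> x = Idt C (S x)" if "x \<in> Obj C" for x
    using ext[OF that SO[OF that] Idt_in[OF SO[OF that]]] by (simp_all add: \<Delta>_def)
  have DH: "\<Delta> x \<in> Hom C (S x) (S (S x))" if "x \<in> Obj C" for x
    using A_Hom[OF that SO[OF that] D(1)[OF that]] .
  have fnc: "cat_functor C C F"
  proof (intro cat_functor.intro category_axioms cat_functor_axioms.intro)
    fix x assume x: "x \<in> Obj C"
    show "on_obj F x \<in> Obj C" using SO[OF x] by simp
    show "on_arr F (Idt C x) = Idt C (on_obj F x)"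
      using A_unique[OF x x F(1)[OF Idt_in[OF x]] A_id[OF x]] F(2)[OF Idt_in[OF x]]
        Idt_left[OF eps[OF x]] Idt_right[OF eps[OF x]] by simp
  next
    fix f x y assume "f \<in> Hom C x y"
    then show "on_arr F f \<in> Hom C (on_obj F x) (on_obj F y)" using FH by simp
  next
    fix f g x y z assume f: "f \<in> Hom C x y" and g: "g \<in> Hom C y z"
    have o: "x \<in> Obj C" "y \<in> Obj C" "z \<in> Obj C" using Hom_Obj[OF f] Hom_Obj[OF g] by auto
    have "\<epsilon> z \<cdot> (on_arr F g \<cdot> on_arr F f) = (g \<cdot> f) \<cdot> \<epsilon> x"
      using assoc[OF FH[OF f] FH[OF g] eps[OF o(3)]] F(2)[OF g] assoc[OF FH[OF f] eps[OF o(2)] g]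
        F(2)[OF f] assoc[OF eps[OF o(1)] f g] by simp
    then show "on_arr F (g \<cdot> f) = on_arr F g \<cdot> on_arr F f"
      using A_unique[OF o(1,3) F(1)[OF Cmp_in[OF f g]] A_comp[OF o F(1)[OF f] F(1)[OF g]]]
        F(2)[OF Cmp_in[OF f g]] by simp
  qed
  interpret F: cat_functor C C F by (rule fnc)
  have idf: "cat_functor C C id_functor"
    by unfold_locales (auto simp: id_functor_def)
  have FF: "cat_functor C C (comp_functor F F)"
    using SO FH F.map_Idt F.map_Cmp F.map_Cmp[OF FH FH]
    by unfold_locales (auto simp: comp_functor_def)
  have nat: "nat_trans C C F id_functor \<epsilon>"
    using eps F(2) by (intro nat_trans.intro fnc idf nat_trans_axioms.intro) (auto simp: id_functor_def)
  have nat2: "nat_trans C C F (comp_functor F F) \<Delta>"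
  proof (intro nat_trans.intro fnc FF nat_trans_axioms.intro)
    fix f x y assume f: "f \<in> Hom C x y"
    have o: "x \<in> Obj C" "y \<in> Obj C" using Hom_Obj[OF f] by auto
    note o2 = SO[OF o(1)] SO[OF o(2)]
    note Ff = FH[OF f]
    have "\<epsilon> (S y) \<cdot> (\<Delta> y \<cdot> on_arr F f) = on_arr F f"
      using assoc[OF Ff DH[OF o(2)] eps[OF o2(2)]] D(2)[OF o(2)] Idt_left[OF Ff] by simp
    moreover have "\<epsilon> (S y) \<cdot> (on_arr F (on_arr F f) \<cdot> \<Delta> x) = on_arr F f"
      using assoc[OF DH[OF o(1)] FH[OF Ff] eps[OF o2(2)]] F(2)[OF Ff]
        assoc[OF DH[OF o(1)] eps[OF o2(1)] Ff] D(2)[OF o(1)] Idt_right[OF Ff] by simp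
    ultimately have "\<Delta> y \<cdot> on_arr F f = on_arr F (on_arr F f) \<cdot> \<Delta> x"
      using A_unique[OF o(1) o2(2) A_comp[OF o o2(2) F(1)[OF f] D(1)[OF o(2)]]
          A_comp[OF o(1) o2 D(1)[OF o(1)] F(1)[OF Ff]]] by simp
    then show "\<Delta> y \<cdot> on_arr F f = on_arr (comp_functor F F) f \<cdot> \<Delta> x" by (simp add: comp_functor_def)
  qed (use DH in \<open>simp add: comp_functor_def\<close>)
  have "cotriple C F \<epsilon> \<Delta>"
  proof (intro cotriple.intro nat nat2 cotriple_axioms.intro)
    fix x assume x: "x \<in> Obj C"
    note Sx = SO[OF x] and Dx = DH[OF x]
    show "\<epsilon> (on_obj F x) \<cdot> \<Delta> x = Idt C (on_obj F x)" using D(2)[OF x] by simp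
    have "\<epsilon> x \<cdot> (on_arr F (\<epsilon> x) \<cdot> \<Delta> x) = \<epsilon> x \<cdot> Idt C (S x)"
      using assoc[OF Dx FH[OF eps[OF x]] eps[OF x]] F(2)[OF eps[OF x]] assoc[OF Dx eps[OF Sx] eps[OF x]] D(2)[OF x]
      by simp
    then show "on_arr F (\<epsilon> x) \<cdot> \<Delta> x = Idt C (on_obj F x)"
      using A_unique[OF x x A_comp[OF x Sx x D(1)[OF x] F(1)[OF eps[OF x]]] A_id[OF x]] by simp
    have "\<epsilon> (S (S x)) \<cdot> (\<Delta> (S x) \<cdot> \<Delta> x) = \<Delta> x"
      using assoc[OF Dx DH[OF Sx] eps[OF SO[OF Sx]]] D(2)[OF Sx] Idt_left[OF Dx] by simp
    moreover have "\<epsilon> (S (S x)) \<cdot> (on_arr F (\<Delta> x) \<cdot> \<Delta> x) = \<Delta> x"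
      using assoc[OF Dx FH[OF Dx] eps[OF SO[OF Sx]]] F(2)[OF Dx] assoc[OF Dx eps[OF Sx] Dx] D(2)[OF x]
        Idt_right[OF Dx] by simp
    ultimately have "\<Delta> (S x) \<cdot> \<Delta> x = on_arr F (\<Delta> x) \<cdot> \<Delta> x"
      using A_unique[OF x SO[OF Sx] A_comp[OF x Sx SO[OF Sx] D(1)[OF x] D(1)[OF Sx]]
          A_comp[OF x Sx SO[OF Sx] D(1)[OF x] F(1)[OF Dx]]] by simp
    then show "\<Delta> (on_obj F x) \<cdot> \<Delta> x = on_arr F (\<Delta> x) \<cdot> \<Delta> x" by simp
  qed
  then show ?thesis using Fo by blast
qed

end

section \<open>Chain maps that carry cells to cells\<close>

locale initial_cell_chains = small_object_argument C L R \<kappa> l I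
  for C :: "('o, 'm, 'z) cat_scheme" (structure) and L R and \<kappa> l :: "'u rel" and I +
  fixes e :: 'o and b :: "'o \<Rightarrow> 'm" and X :: "'o \<Rightarrow> 'u option \<Rightarrow> 'o"
    and G :: "'o \<Rightarrow> 'u option \<Rightarrow> ('u, 'm) gen \<Rightarrow> 'm" and P :: "'o \<Rightarrow> 'u option \<Rightarrow> 'm"
  assumes init: "initial C e"
    and chain: "x \<in> Obj C \<Longrightarrow> cell_chain C L R \<kappa> l I False (b x) e x (X x) (G x) (P x)"
begin

abbreviation S where "S x \<equiv> X x None"

text \<open>The second leg of the image of a cell is read off at the top of the chain, where \<open>h\<close> is already
  given.\<close>

definition cell_map :: "'o \<Rightarrow> 'o \<Rightarrow> 'm \<Rightarrow> ('u option \<Rightarrow> 'm) \<Rightarrow> bool" where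
  "cell_map x y h k \<longleftrightarrow> k None = h \<and> (\<forall>a. k a \<in> Hom C (X x a) (X y a)) \<and>
     (\<forall>a. k a \<cdot> G x a Base = G y a Base) \<and>
     (\<forall>a. \<forall>c\<in>below l a. k a \<cdot> G x a (Stage c) = G y a (Stage c) \<cdot> k (Some c)) \<and>
     (\<forall>a. \<forall>c\<in>below l a. \<forall>i u v. (i, u, v) \<in> cells False x (X x) (G x) (P x) c \<longrightarrow>
       (i, k (Some c) \<cdot> u, P y None \<cdot> (h \<cdot> G x None (Cell c i u v))) \<in> cells False y (X y) (G y) (P y) c \<and>
       k a \<cdot> G x a (Cell c i u v) =
         G y a (Cell c i (k (Some c) \<cdot> u) (P y None \<cdot> (h \<cdot> G x None (Cell c i u v)))))"

lemma cell_mapD: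
  assumes "cell_map x y h k"
  shows "k None = h" "k a \<in> Hom C (X x a) (X y a)" "k a \<cdot> G x a Base = G y a Base"
    "c \<in> below l a \<Longrightarrow> k a \<cdot> G x a (Stage c) = G y a (Stage c) \<cdot> k (Some c)"
    "c \<in> Field l \<Longrightarrow> (i, u, v) \<in> cells False x (X x) (G x) (P x) c \<Longrightarrow>
       (i, k (Some c) \<cdot> u, P y None \<cdot> (h \<cdot> G x None (Cell c i u v))) \<in> cells False y (X y) (G y) (P y) c"
    "c \<in> below l a \<Longrightarrow> (i, u, v) \<in> cells False x (X x) (G x) (P x) c \<Longrightarrow>
       k a \<cdot> G x a (Cell c i u v) =
         G y a (Cell c i (k (Some c) \<cdot> u) (P y None \<cdot> (h \<cdot> G x None (Cell c i u v))))"
  using assms unfolding cell_map_def by (metis below_simps(1))+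

lemma cell_map_id:
  assumes "x \<in> Obj C"
  shows "cell_map x x (Idt C (S x)) (\<lambda>a. Idt C (X x a))"
proof -
  interpret x: cell_chain C L R \<kappa> l I False "b x" e x "X x" "G x" "P x" by (rule chain[OF assms])
  have "(i, Idt C (X x (Some c)) \<cdot> u, P x None \<cdot> (Idt C (S x) \<cdot> G x None (Cell c i u v))) = (i, u, v)"
    if "c \<in> below l a" "(i, u, v) \<in> x.Cells c" for a c i u v
  proof -
    have c: "c \<in> below l None" using below_Field that by fastforce
    show ?thesis
      using Idt_left[OF x.CellsD(3)[OF that(2)]] Idt_left[OF x.Cell_Hom[OF c that(2)]]
        x.P_G[of "Cell c i u v" None] c that by simp
  qed
  then show ?thesis unfolding cell_map_def
    using Idt_in[OF x.X_Obj] Idt_left[OF x.Base_Hom] Idt_left[OF x.Stage_Hom] Idt_right[OF x.Stage_Hom]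
      Idt_left[OF x.Cell_Hom] by simp
qed

lemma cell_map_comp:
  assumes o: "x \<in> Obj C" "y \<in> Obj C" "z \<in> Obj C" and h: "cell_map x y h k" and h': "cell_map y z h' k'"
  shows "cell_map x z (h' \<cdot> h) (\<lambda>a. k' a \<cdot> k a)"
proof -
  interpret x: cell_chain C L R \<kappa> l I False "b x" e x "X x" "G x" "P x" by (rule chain[OF o(1)])
  interpret y: cell_chain C L R \<kappa> l I False "b y" e y "X y" "G y" "P y" by (rule chain[OF o(2)])
  interpret z: cell_chain C L R \<kappa> l I False "b z" e z "X z" "G z" "P z" by (rule chain[OF o(3)])
  note hD = cell_mapD[OF h] and hD' = cell_mapD[OF h']
  have hH: "h \<in> Hom C (S x) (S y)" "h' \<in> Hom C (S y) (S z)"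
    using hD(2)[of None] hD'(2)[of None] hD(1) hD'(1) by auto
  show ?thesis unfolding cell_map_def
  proof (intro conjI allI ballI impI)
    show "k' None \<cdot> k None = h' \<cdot> h" using hD(1) hD'(1) by simp
  next
    fix a
    show "k' a \<cdot> k a \<in> Hom C (X x a) (X z a)" using Cmp_in[OF hD(2) hD'(2)] .
    show "(k' a \<cdot> k a) \<cdot> G x a Base = G z a Base"
      using assoc[OF x.Base_Hom hD(2) hD'(2)] hD(3) hD'(3) by simp
  next
    fix a c assume c: "c \<in> below l a"
    show "(k' a \<cdot> k a) \<cdot> G x a (Stage c) = G z a (Stage c) \<cdot> (k' (Some c) \<cdot> k (Some c))"
      using assoc[OF x.Stage_Hom[OF c] hD(2) hD'(2)] hD(4)[OF c] assoc[OF hD(2) y.Stage_Hom[OF c] hD'(2)]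
        hD'(4)[OF c] assoc[OF hD(2) hD'(2) z.Stage_Hom[OF c]] by simp
  next
    fix a c i u v assume c: "c \<in> below l a" and iuv: "(i, u, v) \<in> x.Cells c"
    have cF: "c \<in> Field l" "c \<in> below l None" using below_Field[OF c] by simp_all
    define v' where "v' = P y None \<cdot> (h \<cdot> G x None (Cell c i u v))"
    define u' where "u' = k (Some c) \<cdot> u"
    have c': "(i, u', v') \<in> y.Cells c" unfolding u'_def v'_def by (rule hD(5)[OF cF(1) iuv])
    \<comment> \<open>Reading the second leg at the top pays off here: the leg of the twice
      transported cell is that of the composite \<open>h' \<cdot> h\<close> on the original
      cell.\<close>
    have "h' \<cdot> G y None (Cell c i u' v') = h' \<cdot> (h \<cdot> G x None (Cell c i u v))"
      using hD(6)[OF cF(2) iuv] hD(1) by (simp add: u'_def v'_def)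
    also have "\<dots> = (h' \<cdot> h) \<cdot> G x None (Cell c i u v)"
      using assoc[OF x.Cell_Hom[OF cF(2) iuv] hH] by simp
    finally have v: "h' \<cdot> G y None (Cell c i u' v') = (h' \<cdot> h) \<cdot> G x None (Cell c i u v)" .
    have u: "k' (Some c) \<cdot> u' = (k' (Some c) \<cdot> k (Some c)) \<cdot> u"
      using assoc[OF x.CellsD(3)[OF iuv] hD(2) hD'(2)] by (simp add: u'_def)
    show "(i, (k' (Some c) \<cdot> k (Some c)) \<cdot> u, P z None \<cdot> ((h' \<cdot> h) \<cdot> G x None (Cell c i u v))) \<in> z.Cells c"
      using hD'(5)[OF cF(1) c'] u v by simp
    show "(k' a \<cdot> k a) \<cdot> G x a (Cell c i u v) =
      G z a (Cell c i ((k' (Some c) \<cdot> k (Some c)) \<cdot> u) (P z None \<cdot> ((h' \<cdot> h) \<cdot> G x None (Cell c i u v))))"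
      using assoc[OF x.Cell_Hom[OF c iuv] hD(2) hD'(2)] hD(6)[OF c iuv] hD'(6)[OF c c'] u v
      by (simp add: u'_def v'_def)
  qed
qed

text \<open>Induction along the chain: the image of a cell depends only on the map at its earlier
  stage and on the composite of \<open>h\<close> with \<open>P y None\<close>, which both maps
  share.\<close>

lemma cell_map_unique:
  assumes o: "x \<in> Obj C" "y \<in> Obj C" and h: "cell_map x y h k" and h': "cell_map x y h' k'"
    and eq: "P y None \<cdot> h = P y None \<cdot> h'"
  shows "h = h'"
proof -
  interpret x: cell_chain C L R \<kappa> l I False "b x" e x "X x" "G x" "P x" by (rule chain[OF o(1)])
  interpret y: cell_chain C L R \<kappa> l I False "b y" e y "X y" "G y" "P y" by (rule chain[OF o(2)])
  note hD = cell_mapD[OF h] and hD' = cell_mapD[OF h']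
  have hH: "h \<in> Hom C (S x) (S y)" "h' \<in> Hom C (S x) (S y)"
    using hD(2)[of None] hD'(2)[of None] hD(1) hD'(1) by auto
  have "k a = k' a" for a
    using wf_below[OF wo]
  proof (induct a rule: wf_induct_rule)
    case (less a)
    then have IH: "k (Some c) = k' (Some c)" if "c \<in> below l a" for c using that by blast
    show ?case
    proof (rule x.joint_epi[OF hD(2) hD'(2)])
      fix \<alpha> assume "\<alpha> \<in> x.Gens (below l a)"
      then show "k a \<cdot> G x a \<alpha> = k' a \<cdot> G x a \<alpha>"
      proof (cases rule: x.GensE)
        case (Cell c i u v)
        have c: "c \<in> below l None" using below_Field[OF Cell(2)] by simp
        have "P y None \<cdot> (h \<cdot> G x None (Cell c i u v)) = P y None \<cdot> (h' \<cdot> G x None (Cell c i u v))"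
          using assoc[OF x.Cell_Hom[OF c Cell(3)] hH(1) y.P_Hom]
            assoc[OF x.Cell_Hom[OF c Cell(3)] hH(2) y.P_Hom] eq by simp
        then show ?thesis using hD(6)[OF Cell(2,3)] hD'(6)[OF Cell(2,3)] IH[OF Cell(2)] Cell(1) by simp
      qed (simp_all add: hD hD' IH)
    qed
  qed
  then show ?thesis using hD(1) hD'(1) by metis
qed

text \<open>\<open>cell_map\<close> reads second legs off \<open>h\<close> at the top, which looks
  circular because \<open>h\<close> is where the recursion ends. But only the composite of
  \<open>h\<close> with \<open>P y None\<close> enters, and that is to be \<open>g\<close>, known
  beforehand.\<close>

lemma cell_map_exists:
  assumes o: "x \<in> Obj C" "y \<in> Obj C" and g: "g \<in> Hom C (S x) y"
  shows "\<exists>h k. cell_map x y h k \<and> P y None \<cdot> h = g"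
proof -
  interpret x: cell_chain C L R \<kappa> l I False "b x" e x "X x" "G x" "P x" by (rule chain[OF o(1)])
  interpret y: cell_chain C L R \<kappa> l I False "b y" e y "X y" "G y" "P y" by (rule chain[OF o(2)])
  define val where "val \<alpha> = g \<cdot> G x None \<alpha>" for \<alpha>
  have val: "x.Cocone (Field l) y val" unfolding val_def using x.Cocone_comp[OF g] by simp
  have vC: "val (Cell c i u v) \<in> Hom C (Cod C i) y" "val (Cell c i u v) \<cdot> i = val (Stage c) \<cdot> u"
    if "c \<in> Field l" "(i, u, v) \<in> x.Cells c" for c i u v
    using x.CoconeD(2)[OF val, of "Cell c i u v"] x.CoconeD(4)[OF val] that by auto
  have cell: "(i, k \<cdot> u, val (Cell c i u v)) \<in> y.Cells c"
    if "c \<in> below l a" "(i, u, v) \<in> x.Cells c" "k \<in> Hom C (X x (Some c)) (X y (Some c))"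
      "P y (Some c) \<cdot> k = val (Stage c)" for a c i u v k
    using x.CellsD[OF that(2)] vC[OF below_Field[OF that(1)] that(2)] Cmp_in[OF _ that(3)]
      assoc[OF x.CellsD(3)[OF that(2)] that(3) y.P_Hom] that(4) by (simp add: cells_def)
  obtain k where k: "\<And>a. k a \<in> Hom C (X x a) (X y a)" "\<And>a. k a \<cdot> G x a Base = G y a Base"
    "\<And>a c. c \<in> below l a \<Longrightarrow> k a \<cdot> G x a (Stage c) = G y a (Stage c) \<cdot> k (Some c)"
    "\<And>a c i u v. c \<in> below l a \<Longrightarrow> (i, u, v) \<in> x.Cells c \<Longrightarrow>
      k a \<cdot> G x a (Cell c i u v) = G y a (Cell c i (k (Some c) \<cdot> u) (val (Cell c i u v)))"
    "\<And>a \<alpha>. \<alpha> \<in> x.Gens (below l a) \<Longrightarrow> P y a \<cdot> (k a \<cdot> G x a \<alpha>) = val \<alpha>"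
  proof (rule x.map_out[OF val, where Y = "X y" and q = "\<lambda>a. G y a Base" and y = "\<lambda>c a. G y a (Stage c)"
        and p = "P y" and e = "\<lambda>a c i u v k. G y a (Cell c i (k \<cdot> u) (val (Cell c i u v)))"], goal_cases)
    case (6 a)
    \<comment> \<open>Any two arrows out of the initial object into \<open>y\<close> agree; this is
      a second use of the starting object, besides cofibrancy.\<close>
    have "P y a \<cdot> G y a Base \<in> Hom C e y" "val Base \<in> Hom C e y"
      using Cmp_in[OF y.Base_Hom y.P_Hom] x.CoconeD(2)[OF val, of Base] by auto
    then show ?case using init o(2) unfolding initial_def by blast
  next
    case (8 a c i u v k)
    show ?case
      using cell[OF 8(2-5)] y.Cell_Hom[OF 8(2) cell[OF 8(2-5)]] y.Cell_comp[OF 8(2) cell[OF 8(2-5)]]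
        y.P_G[of "Cell c i (k \<cdot> u) (val (Cell c i u v))" a] 8(2) by simp
  next
    case (9 a c d i u v k)
    have "d \<in> below l (Some c)" using 9 by simp
    note c = cell[OF this 9(4-6)]
    show ?case using y.Stage_comp[OF 9(2), of "Cell d i (k \<cdot> u) (val (Cell d i u v))"] c 9(3) by simp
  next
    case (7 a c)
    then show ?case using y.P_G[of "Stage c" a] by simp
  qed (auto intro: y.Base_Hom y.P_Hom y.Stage_Hom y.Stage_Stage y.Stage_comp)
  \<comment> \<open>At the top this is the required composite \<open>g\<close>; at a stage it is the
    condition under which \<open>cell\<close> applies.\<close>
  have pk: "P y a \<cdot> k a = (if a = None then g else val (Stage (the a)))" if "a = None \<or> the a \<in> Field l" for a
  proof (rule x.joint_epi[OF Cmp_in[OF k(1) y.P_Hom]])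
    show "(if a = None then g else val (Stage (the a))) \<in> Hom C (X x a) y"
      using g that x.CoconeD(2)[OF val, of "Stage (the a)"] by (cases a) auto
    fix \<alpha> assume \<alpha>: "\<alpha> \<in> x.Gens (below l a)"
    show "(P y a \<cdot> k a) \<cdot> G x a \<alpha> = (if a = None then g else val (Stage (the a))) \<cdot> G x a \<alpha>"
      using assoc[OF x.G_Hom[OF \<alpha>] k(1) y.P_Hom] k(5)[OF \<alpha>] that \<alpha> x.CoconeD(3)[OF val, of "the a" \<alpha>]
      by (cases a) (auto simp: val_def)
  qed
  have pg: "P y None \<cdot> k None = g" using pk[of None] by simp
  have v: "P y None \<cdot> (k None \<cdot> G x None \<alpha>) = val \<alpha>" if "\<alpha> \<in> x.Gens (Field l)" for \<alpha>
    using k(5)[of \<alpha> None] that by simp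
  have "cell_map x y (k None) k" unfolding cell_map_def
  proof (intro conjI allI ballI impI)
    fix a c i u v assume c: "c \<in> below l a" and iuv: "(i, u, v) \<in> x.Cells c"
    have "P y (Some c) \<cdot> k (Some c) = val (Stage c)" using pk[of "Some c"] below_Field[OF c] by simp
    note cc = cell[OF c iuv k(1) this]
    show "(i, k (Some c) \<cdot> u, P y None \<cdot> (k None \<cdot> G x None (Cell c i u v))) \<in> y.Cells c"
      using cc v[of "Cell c i u v"] below_Field[OF c] iuv by simp
    show "k a \<cdot> G x a (Cell c i u v) =
         G y a (Cell c i (k (Some c) \<cdot> u) (P y None \<cdot> (k None \<cdot> G x None (Cell c i u v))))"
      using k(4)[OF c iuv] v[of "Cell c i u v"] below_Field[OF c] iuv by simp
  qed (simp_all add: k)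
  then show ?thesis using pg by blast
qed

lemma cotriple_exists: "\<exists>F \<Delta>. on_obj F = S \<and> cotriple C F (\<lambda>x. P x None) \<Delta>"
proof (rule cotriple_if_cofree[where A = "\<lambda>x y. {h. \<exists>k. cell_map x y h k}"])
  fix x assume "x \<in> Obj C"
  then interpret x: cell_chain C L R \<kappa> l I False "b x" e x "X x" "G x" "P x" by (rule chain)
  show "P x None \<in> Hom C (S x) x" by (rule x.P_Hom)
next
  fix x y h assume "h \<in> {h. \<exists>k. cell_map x y h k}"
  then show "h \<in> Hom C (S x) (S y)" using cell_mapD(1,2) by blast
qed (use cell_map_id cell_map_comp cell_map_exists cell_map_unique in blast)+

end

section \<open>Free algebraically fibrant objects, and the fibrantly generated case\<close>

text \<open>In use \<open>C\<close> is the opposite category: \<open>t\<close> is the initial object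
  of the original one, \<open>L\<close> its acyclic fibrations, and \<open>L_mono\<close> dualizes
  their being epimorphisms.\<close>

locale terminal_cell_chains = small_object_argument C L R \<kappa> l I
  for C :: "('o, 'm, 'z) cat_scheme" (structure) and L R and \<kappa> l :: "'u rel" and I +
  fixes t :: 'o and b :: "'o \<Rightarrow> 'm" and X :: "'o \<Rightarrow> 'u option \<Rightarrow> 'o"
    and G :: "'o \<Rightarrow> 'u option \<Rightarrow> ('u, 'm) gen \<Rightarrow> 'm" and P :: "'o \<Rightarrow> 'u option \<Rightarrow> 'm"
  assumes terminal: "x \<in> Obj C \<Longrightarrow> \<exists>!f. f \<in> Hom C x t"
    and L_mono: "i \<in> L \<Longrightarrow> g \<in> Hom C w (Dom C i) \<Longrightarrow> h \<in> Hom C w (Dom C i) \<Longrightarrow> i \<cdot> g = i \<cdot> h \<Longrightarrow> g = h"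
    and chain: "x \<in> Obj C \<Longrightarrow> cell_chain C L R \<kappa> l I True (b x) x t (X x) (G x) (P x)"
begin

abbreviation S where "S x \<equiv> X x None"

lemma terminal_eq: "f \<in> Hom C x t \<Longrightarrow> g \<in> Hom C x t \<Longrightarrow> f = g"
  using terminal[of x] Hom_Obj[of f x t] by blast

text \<open>The choice is among the resulting legs \<open>w\<close>, not among the triples
  \<open>c\<close>, \<open>u'\<close>, \<open>v\<close>, so evaluating it requires only that all
  candidates for \<open>w\<close> coincide.\<close>

definition fill :: "'o \<Rightarrow> 'm \<Rightarrow> 'm \<Rightarrow> 'm" where
  "fill x i u = (SOME w. \<exists>c\<in>Field l. \<exists>u' v. (i, u', v) \<in> cells True t (X x) (G x) (P x) c \<and>
     u = G x None (Stage c) \<cdot> u' \<and> w = G x None (Cell c i u' v))"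

context
  fixes x assumes x: "x \<in> Obj C"
begin

interpretation cell_chain C L R \<kappa> l I True "b x" x t "X x" "G x" "P x"
  by (rule chain[OF x])

text \<open>Over the terminal object a second leg exists and the square commutes automatically, so
  every attaching arrow comes from a cell.\<close>

lemma exists_cell:
  assumes "i \<in> I" "u \<in> Hom C (Dom C i) (S x)"
  obtains c u' v where "c \<in> Field l" "(i, u', v) \<in> Cells c" "u = G x None (Stage c) \<cdot> u'"
proof -
  obtain v where v: "v \<in> Hom C (Cod C i) t" using terminal Hom_Obj[OF I_Arr[OF assms(1)]] by blast
  have "P x None \<cdot> u = v \<cdot> i"
    using Cmp_in[OF assms(2) P_Hom] Cmp_in[OF I_Arr[OF assms(1)] v] by (rule terminal_eq)
  then show thesis using new_cell[OF assms v] that by blast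
qed

lemma Stage_cancel:
  assumes "c \<in> Field l" "u \<in> Hom C w (X x (Some c))" "u' \<in> Hom C w (X x (Some c))"
    "G x None (Stage c) \<cdot> u = G x None (Stage c) \<cdot> u'"
  shows "u = u'"
  using L_mono[OF Stage_L[OF assms(1)]] assms Hom_Dom[OF Stage_Hom[of c None]] by auto

text \<open>This is where monomorphisms are needed: an arrow into \<open>S x\<close> is attached to at exactly one
  stage, hence the filler does not depend on a choice.\<close>

lemma fill_Cell:
  assumes c: "c \<in> Field l" and u: "(i, u, v) \<in> Cells c"
  shows "fill x i (G x None (Stage c) \<cdot> u) = G x None (Cell c i u v)"
proof -
  \<comment> \<open>If \<open>c\<close> precedes \<open>d\<close>, cancelling the stage inclusion
    shows that the attaching arrow at \<open>d\<close> factors through \<open>c\<close>,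
    contradicting its newness.\<close>
  have not_less: False
    if "d \<in> Field l" "c \<in> Field l" "(i, u, v) \<in> Cells c" "(i, u', v') \<in> Cells d" "c \<in> underS l d"
      "G x None (Stage c) \<cdot> u = G x None (Stage d) \<cdot> u'" for c d u u' v v'
  proof -
    note U = CellsD(3)[OF that(3)] and U' = CellsD(3)[OF that(4)]
    have S: "G x (Some d) (Stage c) \<in> Hom C (X x (Some c)) (X x (Some d))" using Stage_Hom[of c "Some d"] that by simp
    have "G x None (Stage d) \<cdot> (G x (Some d) (Stage c) \<cdot> u) = G x None (Stage d) \<cdot> u'"
      using assoc[OF U S Stage_Hom[of d None]] that(1,5,6) Stage_Stage[of d None c] by simp
    then have "G x (Some d) (Stage c) \<cdot> u = u'" using Stage_cancel[OF that(1) Cmp_in[OF U S] U'] by simp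
    then show False using that(4,5) U by (auto simp: cells_def)
  qed
  have "w = G x None (Cell c i u v)"
    if "d \<in> Field l" "(i, u', v') \<in> Cells d" "G x None (Stage c) \<cdot> u = G x None (Stage d) \<cdot> u'"
      "w = G x None (Cell d i u' v')" for d u' v' w
  proof -
    have "c = d"
      using underS_linear[OF wo c that(1)] not_less[OF that(1) c u that(2) _ that(3)]
        not_less[OF c that(1,2) u _ that(3)[symmetric]] by blast
    moreover have "v = v'" using terminal_eq CellsD(4)[OF u] CellsD(4)[OF that(2)] .
    moreover have "u = u'"
      using Stage_cancel[OF c CellsD(3)[OF u]] CellsD(3)[OF that(2)] that(3) \<open>c = d\<close> by simp
    ultimately show ?thesis using that by simp
  qed
  then show ?thesis unfolding fill_def using c u by (intro some_equality) blast+
qed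

lemma fill:
  assumes "i \<in> I" "u \<in> Hom C (Dom C i) (S x)"
  shows "fill x i u \<in> Hom C (Cod C i) (S x)" "fill x i u \<cdot> i = u"
proof -
  obtain c u' v where c: "c \<in> Field l" "(i, u', v) \<in> Cells c" "u = G x None (Stage c) \<cdot> u'"
    using exists_cell[OF assms] .
  show "fill x i u \<in> Hom C (Cod C i) (S x)" "fill x i u \<cdot> i = u"
    using Cell_Hom[of c None] Cell_comp[of c None] fill_Cell[OF c(1,2)] c by simp_all
qed

end

text \<open>Morphisms of algebraically fibrant objects: chosen fillers are preserved
  strictly.\<close>

definition fill_map :: "'o \<Rightarrow> 'o \<Rightarrow> 'm \<Rightarrow> bool" where
  "fill_map x y h \<longleftrightarrow> h \<in> Hom C (S x) (S y) \<and>
     (\<forall>i\<in>I. \<forall>u\<in>Hom C (Dom C i) (S x). h \<cdot> fill x i u = fill y i (h \<cdot> u))"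

lemma fill_mapD:
  assumes "fill_map x y h"
  shows "h \<in> Hom C (S x) (S y)"
    "i \<in> I \<Longrightarrow> u \<in> Hom C (Dom C i) (S x) \<Longrightarrow> h \<cdot> fill x i u = fill y i (h \<cdot> u)"
  using assms unfolding fill_map_def by blast+

lemma fill_map_id:
  assumes x: "x \<in> Obj C"
  shows "fill_map x x (Idt C (S x))"
proof -
  interpret cell_chain C L R \<kappa> l I True "b x" x t "X x" "G x" "P x" by (rule chain[OF x])
  show ?thesis unfolding fill_map_def
    using Idt_in[OF X_Obj] Idt_left[OF fill(1)[OF x]] Idt_left by auto
qed

lemma fill_map_comp:
  assumes x: "x \<in> Obj C" and h: "fill_map x y h" and k: "fill_map y z k"
  shows "fill_map x z (k \<cdot> h)"
  unfolding fill_map_def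
proof (intro conjI ballI)
  note h = fill_mapD[OF h] and k = fill_mapD[OF k]
  show "k \<cdot> h \<in> Hom C (S x) (S z)" using Cmp_in[OF h(1) k(1)] .
  fix i u assume i: "i \<in> I" and u: "u \<in> Hom C (Dom C i) (S x)"
  show "(k \<cdot> h) \<cdot> fill x i u = fill z i ((k \<cdot> h) \<cdot> u)"
    using assoc[OF fill(1)[OF x i u] h(1) k(1)] assoc[OF u h(1) k(1)] h(2)[OF i u]
      k(2)[OF i Cmp_in[OF u h(1)]] by simp
qed

text \<open>A cell leg is the filler of its attaching arrow, so its image is determined by the image
  of its stage; induction along the chain leaves only \<open>Base\<close>.\<close>

lemma fill_map_unique:
  assumes x: "x \<in> Obj C" and h: "fill_map x y h" and h': "fill_map x y h'"
    and eq: "h \<cdot> G x None Base = h' \<cdot> G x None Base"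
  shows "h = h'"
proof -
  interpret cell_chain C L R \<kappa> l I True "b x" x t "X x" "G x" "P x" by (rule chain[OF x])
  note hD = fill_mapD[OF h] and hD' = fill_mapD[OF h']
  have gens: "h \<cdot> G x None \<alpha> = h' \<cdot> G x None \<alpha>"
    if "\<And>c. c \<in> B \<Longrightarrow> h \<cdot> G x None (Stage c) = h' \<cdot> G x None (Stage c)" "B \<subseteq> Field l" "\<alpha> \<in> Gens B" for B \<alpha>
    using that(3)
  proof (cases rule: GensE)
    case (Cell c i u v)
    have c: "c \<in> below l None" using Cell(2) that(2) by auto
    note iuv = CellsD[OF Cell(3)]
    note u = Cmp_in[OF iuv(3) Stage_Hom[OF c]]
    have "h \<cdot> (G x None (Stage c) \<cdot> u) = h' \<cdot> (G x None (Stage c) \<cdot> u)"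
      using assoc[OF iuv(3) Stage_Hom[OF c] hD(1)] assoc[OF iuv(3) Stage_Hom[OF c] hD'(1)] that(1)[OF Cell(2)] by simp
    then show ?thesis
      using hD(2)[OF iuv(1) u] hD'(2)[OF iuv(1) u] fill_Cell[OF x _ Cell(3)] c Cell(1) by simp
  qed (use that(1) eq in auto)
  have stages: "c \<in> Field l \<longrightarrow> h \<cdot> G x None (Stage c) = h' \<cdot> G x None (Stage c)" for c
    using Well_order_facts(4)[OF wo]
  proof (induct c rule: wf_induct_rule)
    case (less c)
    have sub: "underS l c \<subseteq> Field l" by (auto simp: underS_def Field_def)
    then have IH: "h \<cdot> G x None (Stage d) = h' \<cdot> G x None (Stage d)" if "d \<in> underS l c" for d
      using less[of d] that by (auto simp: underS_def)
    show ?case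
    proof
      assume "c \<in> Field l"
      then have c: "c \<in> below l None" by simp
      show "h \<cdot> G x None (Stage c) = h' \<cdot> G x None (Stage c)"
      proof (rule joint_epi[OF Cmp_in[OF Stage_Hom[OF c] hD(1)] Cmp_in[OF Stage_Hom[OF c] hD'(1)]])
        fix \<alpha> assume a: "\<alpha> \<in> Gens (below l (Some c))"
        show "(h \<cdot> G x None (Stage c)) \<cdot> G x (Some c) \<alpha> = (h' \<cdot> G x None (Stage c)) \<cdot> G x (Some c) \<alpha>"
          using assoc[OF G_Hom[OF a] Stage_Hom[OF c] hD(1)] assoc[OF G_Hom[OF a] Stage_Hom[OF c] hD'(1)]
            Stage_comp[OF c] gens[OF IH sub] a by simp
      qed
    qed
  qed
  show ?thesis
  proof (rule joint_epi[OF hD(1) hD'(1)])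
    fix \<alpha> assume "\<alpha> \<in> Gens (below l None)"
    then show "h \<cdot> G x None \<alpha> = h' \<cdot> G x None \<alpha>" using gens[of "Field l" \<alpha>] stages by simp
  qed
qed

text \<open>\<open>S y\<close> is the target at every stage, with identity transitions, and a cell
  goes to the filler of the transported attaching arrow. Comparisons of arrows into \<open>t\<close>
  hold because \<open>t\<close> is terminal.\<close>

lemma fill_map_exists:
  assumes x: "x \<in> Obj C" and y: "y \<in> Obj C" and g: "g \<in> Hom C x (S y)"
  shows "\<exists>h. fill_map x y h \<and> h \<cdot> G x None Base = g"
proof -
  interpret x: cell_chain C L R \<kappa> l I True "b x" x t "X x" "G x" "P x" by (rule chain[OF x])
  interpret y: cell_chain C L R \<kappa> l I True "b y" y t "X y" "G y" "P y" by (rule chain[OF y])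
  note Sy = Idt_in[OF y.X_Obj[of None]] and Py = y.P_Hom[of None]
  define val where "val \<alpha> = P x None \<cdot> G x None \<alpha>" for \<alpha>
  have val: "x.Cocone (Field l) t val" unfolding val_def using x.Cocone_comp[OF x.P_Hom, of None] by simp
  obtain k where k: "\<And>a. k a \<in> Hom C (X x a) (S y)" "\<And>a. k a \<cdot> G x a Base = g"
    "\<And>a c. c \<in> below l a \<Longrightarrow> k a \<cdot> G x a (Stage c) = Idt C (S y) \<cdot> k (Some c)"
    "\<And>a c i u v. c \<in> below l a \<Longrightarrow> (i, u, v) \<in> x.Cells c \<Longrightarrow>
      k a \<cdot> G x a (Cell c i u v) = fill y i (k (Some c) \<cdot> u)"
    "\<And>a \<alpha>. \<alpha> \<in> x.Gens (below l a) \<Longrightarrow> P y None \<cdot> (k a \<cdot> G x a \<alpha>) = val \<alpha>"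
  proof (rule x.map_out[OF val, where Y = "\<lambda>_. S y" and q = "\<lambda>_. g" and y = "\<lambda>_ _. Idt C (S y)"
        and p = "\<lambda>_. P y None" and e = "\<lambda>a c i u v k. fill y i (k \<cdot> u)"], goal_cases)
    case (6 a)
    show ?case using Cmp_in[OF g Py] x.CoconeD(2)[OF val, of Base] terminal_eq by simp
  next
    case (8 a c i u v k)
    note iuv = x.CellsD[OF 8(3)] and c = below_Field[OF 8(2)]
    note ku = Cmp_in[OF iuv(3) 8(4)]
    have "P y None \<cdot> fill y i (k \<cdot> u) = val (Cell c i u v)"
      using Cmp_in[OF fill(1)[OF y iuv(1) ku] Py] x.CoconeD(2)[OF val, of "Cell c i u v"] c 8(3) terminal_eq by simp
    then show ?case using fill[OF y iuv(1) ku] Idt_left[OF ku] by simp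
  next
    case (9 a c d i u v k)
    note iuv = x.CellsD[OF 9(4)]
    show ?case using Idt_left[OF fill(1)[OF y iuv(1) Cmp_in[OF iuv(3) 9(5)]]] .
  qed (auto simp: Idt_left[OF g] Idt_left[OF Sy] Idt_right[OF Py] intro: g Sy Py)
  have "fill_map x y (k None)" unfolding fill_map_def
  proof (intro conjI ballI k(1))
    fix i u assume i: "i \<in> I" and u: "u \<in> Hom C (Dom C i) (S x)"
    \<comment> \<open>Fillers have to be preserved for every arrow into \<open>S x\<close>; each
      comes from a cell, on which \<open>k\<close> was defined to be a filler.\<close>
    obtain c u' v where c: "c \<in> Field l" "(i, u', v) \<in> x.Cells c" "u = G x None (Stage c) \<cdot> u'"
      using exists_cell[OF x i u] .
    note iuv = x.CellsD[OF c(2)]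
    have cb: "c \<in> below l None" using c by simp
    have "k None \<cdot> u = k (Some c) \<cdot> u'"
      using assoc[OF iuv(3) x.Stage_Hom[OF cb] k(1)] k(3)[OF cb] Idt_left[OF k(1)] c by simp
    then show "k None \<cdot> fill x i u = fill y i (k None \<cdot> u)"
      using fill_Cell[OF x c(1,2)] k(4)[OF cb c(2)] c(3) by simp
  qed
  then show ?thesis using k(2) by blast
qed

end

section \<open>Choosing chains for all objects, and passing to the opposite model category\<close>

lemma (in small_object_argument) cell_chain_exists:
  "f \<in> Hom C x0 x \<Longrightarrow> \<exists>X G P. cell_chain C L R \<kappa> l I new f x0 x X G P"
  using chain_exists small_object_argument_axioms
  by (fastforce simp: cell_chain_def cell_chain_axioms_def)

lemma (in small_object_argument) cell_chains_exist:
  assumes "\<And>x. x \<in> Obj C \<Longrightarrow> f x \<in> Hom C (s x) (t x)"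
  shows "\<exists>X G P. \<forall>x\<in>Obj C. cell_chain C L R \<kappa> l I new (f x) (s x) (t x) (X x) (G x) (P x)"
proof -
  have "\<forall>x\<in>Obj C. \<exists>D. cell_chain C L R \<kappa> l I new (f x) (s x) (t x) (fst D) (fst (snd D)) (snd (snd D))"
    using cell_chain_exists[OF assms] by auto
  then obtain D where "\<forall>x\<in>Obj C. cell_chain C L R \<kappa> l I new (f x) (s x) (t x)
      (fst (D x)) (fst (snd (D x))) (snd (snd (D x)))"
    unfolding bchoice_iff by blast
  then show ?thesis by (intro exI)
qed

text \<open>Completeness refers to \<open>op_cat M\<close>, while the dual argument runs in
  \<open>op_model M\<close>, a record of a different type with the same underlying category.\<close>

lemma cocomplete_cong:
  fixes \<kappa> :: "'u rel"
  assumes "cocomplete \<kappa> C" "Obj C = Obj D" "Arr C = Arr D" "Dom C = Dom D" "Cod C = Cod D"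
    "Idt C = Idt D" "Cmp C = Cmp D"
  shows "cocomplete \<kappa> D"
proof -
  have H: "Hom C = Hom D" using assms by (auto simp: Hom_def fun_eq_iff)
  have "cat_functor J D F = cat_functor J C F" for J :: "('u, 'u) cat" and F
    unfolding cat_functor_def cat_functor_axioms_def category_def by (simp only: H assms)
  moreover have "is_colimit J D F = is_colimit J C F" for J :: "('u, 'u) cat" and F
    by (intro ext) (simp only: is_colimit_def is_cocone_def H assms)
  ultimately show ?thesis using assms(1) unfolding cocomplete_def by simp
qed

lemma op_model_simps [simp]:
  "Obj (op_model M) = Obj M" "Arr (op_model M) = Arr M" "Dom (op_model M) = Cod M"
  "Cod (op_model M) = Dom M" "Idt (op_model M) = Idt M" "Cmp (op_model M) g f = Cmp M f g"
  "weq (op_model M) = weq M" "cof (op_model M) = fib M" "fib (op_model M) = cof M"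
  "Hom (op_model M) x y = Hom M y x"
  by (auto simp: op_model_def Hom_def)

lemma has_lifting_op_model: "has_lifting M i p \<Longrightarrow> has_lifting (op_model M) p i"
  unfolding has_lifting_def by simp metis

lemma is_retract_op_model: "is_retract (op_model M) f g \<Longrightarrow> is_retract M f g"
  unfolding is_retract_def by simp metis

context model_category
begin

text \<open>The colimit of the empty graph.\<close>

lemma initial_exists:
  assumes "inaccessible \<kappa>"
  obtains e where "initial M e"
proof (rule graph_colimit[OF assms category_axioms has_colimits, where N = "{} :: unit set" and
      E = "{} :: unit set" and G = undefined and s = undefined and d = undefined and m = undefined], goal_cases)
  case (5 y g)
  have "\<exists>!h. h \<in> Hom M y w" if "w \<in> Obj M" for w
    using 5(5)[OF that, of undefined] by simp
  then show ?case using 5(1,2) unfolding initial_def by blast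
qed (use assms small_finite in auto)

lemma weak_factorization_system: "weak_factorization_system M (cof M) (acyclic_fib M)"
proof unfold_locales
  show "cof M \<subseteq> Arr M" "acyclic_fib M \<subseteq> Arr M" using cof_Arr fib_Arr by blast+
qed (use lift_cof_acyclic_fib factor_cof_acyclic_fib cof_retract fib_retract weq_retract in blast)+

lemma weak_factorization_system_op: "weak_factorization_system (op_model M) (acyclic_fib M) (cof M)"
proof -
  interpret W: weak_factorization_system M "cof M" "acyclic_fib M" by (rule weak_factorization_system)
  have "category (op_model M)"
    by unfold_locales (simp_all add: Dom_in Cod_in Idt_in Idt_left Idt_right Cmp_in assoc)
  then show ?thesis
  proof (intro weak_factorization_system.intro weak_factorization_system_axioms.intro)
    show "acyclic_fib M \<subseteq> Arr (op_model M)" "cof M \<subseteq> Arr (op_model M)"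
      using W.L_Arr W.R_Arr by simp_all
    show "has_lifting (op_model M) i p" if "i \<in> acyclic_fib M" "p \<in> cof M" for i p
      by (rule has_lifting_op_model[OF W.lifting[OF that(2,1)]])
    show "f \<in> acyclic_fib M" if "g \<in> acyclic_fib M" "is_retract (op_model M) f g" for f g
      by (rule W.R_retract[OF that(1) is_retract_op_model[OF that(2)]])
    show "f \<in> cof M" if "g \<in> cof M" "is_retract (op_model M) f g" for f g
      by (rule W.L_retract[OF that(1) is_retract_op_model[OF that(2)]])
    fix f x y assume "f \<in> Hom (op_model M) x y"
    then show "\<exists>z. \<exists>i\<in>Hom (op_model M) x z \<inter> acyclic_fib M. \<exists>p\<in>Hom (op_model M) z y \<inter> cof M.
      f = p \<cdot>\<^bsub>op_model M\<^esub> i"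
      using W.factorization[of f y x] by auto
  qed
qed

end

section \<open>Cofibrant replacement in the two cases\<close>

lemma cofibrantly_generated_cotriple:
  assumes inacc: "inaccessible \<kappa>" and M: "model_category \<kappa> M" and gen: "cofibrantly_generated \<kappa> M"
  shows "\<exists>S \<epsilon> \<Delta>. cofibrant_replacement_cotriple M S \<epsilon> \<Delta>"
proof -
  interpret M: model_category \<kappa> M by (rule M)
  obtain I l where I: "I \<subseteq> cof M" "small \<kappa> I" "cof M = retracts M (relative_cell_complexes \<kappa> M I)"
    and l: "regular_ordinal l" "small \<kappa> (Field l)" "\<forall>i\<in>I. small_object_rel \<kappa> M l (cof M) (Dom M i)"
    using gen unfolding cofibrantly_generated_def by metis
  interpret W: small_object_argument M "cof M" "acyclic_fib M" \<kappa> l I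
    using M.weak_factorization_system I l inacc M.has_colimits M.locally_small
    by (intro small_object_argument.intro small_object_argument_axioms.intro) blast+
  obtain e where e: "initial M e" by (rule M.initial_exists[OF inacc])
  define f where "f x = (THE f. f \<in> Hom M e x)" for x
  have f: "f x \<in> Hom M e x" if "x \<in> Obj M" for x
    using theI'[of "\<lambda>f. f \<in> Hom M e x"] e that unfolding f_def initial_def by blast
  obtain X G P where chain:
    "\<And>x. x \<in> Obj M \<Longrightarrow> cell_chain M (cof M) (acyclic_fib M) \<kappa> l I False (f x) e x (X x) (G x) (P x)"
    using W.cell_chains_exist[of f "\<lambda>_. e" "\<lambda>x. x" False, OF f] by blast
  interpret initial_cell_chains M "cof M" "acyclic_fib M" \<kappa> l I e f X G P
    by (intro initial_cell_chains.intro W.small_object_argument_axioms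
        initial_cell_chains_axioms.intro e chain)
  obtain F \<Delta> where F: "on_obj F = (\<lambda>x. X x None)" "cotriple M F (\<lambda>x. P x None) \<Delta>"
    using cotriple_exists by blast
  have "cofibrant_replacement_cotriple M F (\<lambda>x. P x None) \<Delta>"
  proof (intro cofibrant_replacement_cotriple.intro F(2) cofibrant_replacement_cotriple_axioms.intro)
    fix x assume "x \<in> Obj M"
    then interpret x: cell_chain M "cof M" "acyclic_fib M" \<kappa> l I False "f x" e x "X x" "G x" "P x"
      by (rule chain)
    show "P x None \<in> weq M" using x.P_R by blast
    show "cofibrant M (on_obj F x)"
      unfolding cofibrant_def F(1) using e x.Base_Hom x.Base_L by blast
  qed
  then show ?thesis by blast
qed

lemma fibrantly_generated_cotriple:
  assumes inacc: "inaccessible \<kappa>" and M: "model_category \<kappa> M" and gen: "fibrantly_generated \<kappa> M"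
    and epi: "\<forall>f\<in>acyclic_fib M. epi M f"
  shows "\<exists>S \<epsilon> \<Delta>. cofibrant_replacement_cotriple M S \<epsilon> \<Delta>"
proof -
  interpret M: model_category \<kappa> M by (rule M)
  let ?N = "op_model M"
  \<comment> \<open>The generating acyclic cofibrations of the opposite category are acyclic
    fibrations of \<open>M\<close>. They drive the construction, since the counit is to be an
    acyclic fibration.\<close>
  obtain J l where J: "J \<subseteq> acyclic_fib M" "small \<kappa> J"
      "acyclic_fib M = retracts ?N (relative_cell_complexes \<kappa> ?N J)"
    and l: "regular_ordinal l" "small \<kappa> (Field l)"
      "\<forall>j\<in>J. small_object_rel \<kappa> ?N l (acyclic_fib M) (Dom ?N j)"
    using gen unfolding fibrantly_generated_def cofibrantly_generated_def
    by (simp only: op_model_simps) metis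
  have coc: "cocomplete \<kappa> ?N"
    using M.has_limits unfolding complete_def
    by (rule cocomplete_cong) (simp_all add: op_cat_def op_model_def)
  have ls: "small \<kappa> (Hom ?N x y)" if "x \<in> Obj ?N" "y \<in> Obj ?N" for x y
    using M.locally_small that by simp
  interpret W: small_object_argument ?N "acyclic_fib M" "cof M" \<kappa> l J
    using M.weak_factorization_system_op J l inacc coc ls
    by (intro small_object_argument.intro small_object_argument_axioms.intro) blast+
  obtain t where t: "initial M t" by (rule M.initial_exists[OF inacc])
  define f where "f x = (THE f. f \<in> Hom M t x)" for x
  have f: "f x \<in> Hom ?N x t" if "x \<in> Obj ?N" for x
    using theI'[of "\<lambda>f. f \<in> Hom M t x"] t that unfolding f_def initial_def by simp
  obtain X G P where chain:
    "\<And>x. x \<in> Obj ?N \<Longrightarrow> cell_chain ?N (acyclic_fib M) (cof M) \<kappa> l J True (f x) x t (X x) (G x) (P x)"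
    using W.cell_chains_exist[of f "\<lambda>x. x" "\<lambda>_. t" True, OF f] by blast
  interpret terminal_cell_chains ?N "acyclic_fib M" "cof M" \<kappa> l J t f X G P
  proof (intro terminal_cell_chains.intro W.small_object_argument_axioms
      terminal_cell_chains_axioms.intro, goal_cases)
    case (1 x)
    then show ?case using t by (simp add: initial_def)
  next
    case (2 i g w h)
    then have "epi M i" "g \<in> Hom M (Cod M i) w" "h \<in> Hom M (Cod M i) w" "g \<cdot>\<^bsub>M\<^esub> i = h \<cdot>\<^bsub>M\<^esub> i"
      using epi by simp_all
    then show ?case unfolding epi_def by blast
  qed (use chain in auto)
  \<comment> \<open>Read in \<open>M\<close>, the base leg of the chain is the counit, and an arrow
    from \<open>S x\<close> to \<open>S y\<close> is structured if it is a \<open>fill_map\<close>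
    from \<open>y\<close> to \<open>x\<close>.\<close>
  have "\<exists>F \<Delta>. on_obj F = (\<lambda>x. X x None) \<and> cotriple M F (\<lambda>x. G x None Base) \<Delta>"
  proof (rule M.cotriple_if_cofree[where A = "\<lambda>x y. {h. fill_map y x h}"], goal_cases)
    case (1 x)
    then interpret x: cell_chain ?N "acyclic_fib M" "cof M" \<kappa> l J True "f x" x t "X x" "G x" "P x"
      using chain by simp
    show ?case using x.Base_Hom[of None] by simp
  next
    case (2 x y h)
    then show ?case using fill_mapD(1)[of y x h] by simp
  next
    case (3 x)
    then show ?case using fill_map_id[of x] by simp
  next
    case (4 x y z h k)
    then show ?case using fill_map_comp[of z y k x h] by simp
  next
    case (5 x y g)
    then show ?case using fill_map_exists[of y x g] by auto
  next
    case (6 x y h k)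
    then show ?case using fill_map_unique[of y x h k] by simp
  qed
  then obtain F \<Delta> where F: "on_obj F = (\<lambda>x. X x None)" "cotriple M F (\<lambda>x. G x None Base) \<Delta>" by blast
  have "cofibrant_replacement_cotriple M F (\<lambda>x. G x None Base) \<Delta>"
  proof (intro cofibrant_replacement_cotriple.intro F(2) cofibrant_replacement_cotriple_axioms.intro)
    fix x assume "x \<in> Obj M"
    then interpret x: cell_chain ?N "acyclic_fib M" "cof M" \<kappa> l J True "f x" x t "X x" "G x" "P x"
      using chain by simp
    show "G x None Base \<in> weq M" using x.Base_L by blast
    show "cofibrant M (on_obj F x)"
      \<comment> \<open>The projection of the chain, reversed, is a cofibration from the initial
        object \<open>t\<close> of \<open>M\<close> to \<open>S x\<close>.\<close>
      unfolding cofibrant_def F(1) using t x.P_Hom[of None] x.P_R by auto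
  qed
  then show ?thesis by blast
qed

theorem theorem3p2:
  fixes \<kappa> :: "'u rel" and M :: "('o, 'm) model_cat"
  assumes "inaccessible \<kappa>"
    and "model_category \<kappa> M"
    and "cofibrantly_generated \<kappa> M \<or>
      (fibrantly_generated \<kappa> M \<and> (\<forall>f \<in> acyclic_fib M. epi M f))"
  shows "\<exists>S \<epsilon> \<Delta>. cofibrant_replacement_cotriple M S \<epsilon> \<Delta>"
  using assms cofibrantly_generated_cotriple fibrantly_generated_cotriple by blast

end
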